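(* Let $X\subseteq\mathbb P(\mathcal L)$ be an irreducible projective variety and $F$ a homogeneous polynomial on $\mathcal L$. Then $\mathrm{MLD}_F(X)=1$ if and only if there exists a dominant rational map $\Psi:\mathcal L^*\dashrightarrow C_X$ such that (a) $\Psi(t\mathbf u)=t^{-1}\Psi(\mathbf u)$ for all $t\in\mathbb C\setminus\{0\}$, and (b) $\nabla_{\mathbf u}\log(F\circ\Psi)=-\Psi(\mathbf u)$ for general $\mathbf u\in\mathcal L^*$ (where the gradient of a function on $\mathcal L^*$ is viewed as an element of $(\mathcal L^* )^*=\mathcal L$). In this case $\Psi=\mathrm{MLE}_{X,\mathcal L,F}$.
   Context: Let $\mathcal L$ be a finite-dimensional complex vector space with dual $\mathcal L^*$. For a polynomial $F$ on $\mathcal L$, $\mathbf u\in\mathcal L^*$, $p\in\mathcal L\setminus V(F)$, the log-likelihood is $\ell_{F,\mathbf u}(p)=\log F(p)-\mathbf u(p)$ (gradient $\nabla_pF/F(p)-\mathbf u$). For an irreducible affine variety $Y\subseteq\mathcal L$, $\mathrm{MLD}_F(Y)$ is the number of $p\in Y^{\mathrm{sm}}\setminus V(F)$ with $T_pY\subseteq\ker(\nabla_p\ell_{F,\mathbf u})$ for general $\mathbf u$. For an irreducible projective $X\subseteq\mathbb P(\mathcal L)$ with affine cone $C_X$ and homogeneous $F$, $\mathrm{MLD}_F(X):=\mathrm{MLD}_F(C_X)$. When $\mathrm{MLD}_F(X)=1$, $\mathrm{MLE}_{X,\mathcal L,F}:\mathcal L^*\dashrightarrow C_X^{\mathrm{sm}}\setminus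 V(F)$ sends a general $\mathbf u$ to the unique critical point of $\ell_{F,\mathbf u}$ along $C_X$. *)

theory Defs
  imports "HOL-Analysis.Analysis"
begin

text \<open>We fix coordinates: the finite-dimensional complex vector space L is
  complex^'n, and its dual L* is identified with complex^'n via the pairing
  u(p) = sum_i u_i p_i.\<close>

definition pairing :: "complex^'n \<Rightarrow> complex^'n \<Rightarrow> complex" where
  "pairing u p = (\<Sum>i\<in>UNIV. u $ i * p $ i)"

inductive is_poly :: "(complex^'n \<Rightarrow> complex) \<Rightarrow> bool" where
  const: "is_poly (\<lambda>x. c)"
| coord: "is_poly (\<lambda>x. x $ i)"
| add: "is_poly f \<Longrightarrow> is_poly g \<Longrightarrow> is_poly (\<lambda>x. f x + g x)"
| mult: "is_poly f \<Longrightarrow> is_poly g \<Longrightarrow> is_poly (\<lambda>x. f x * g x)"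

definition homogeneous_poly :: "(complex^'n \<Rightarrow> complex) \<Rightarrow> bool" where
  "homogeneous_poly F \<longleftrightarrow> is_poly F \<and> (\<exists>d::nat. \<forall>t x. F (t *s x) = t ^ d * F x)"

definition zclosed :: "(complex^'n) set \<Rightarrow> bool" where
  "zclosed S \<longleftrightarrow> (\<exists>P. (\<forall>f\<in>P. is_poly f) \<and> S = {x. \<forall>f\<in>P. f x = 0})"

definition zopen :: "(complex^'n) set \<Rightarrow> bool" where
  "zopen U \<longleftrightarrow> zclosed (- U)"

definition zclosure :: "(complex^'n) set \<Rightarrow> (complex^'n) set" where
  "zclosure S = \<Inter>{A. zclosed A \<and> S \<subseteq> A}"

definition irreducible_variety :: "(complex^'n) set \<Rightarrow> bool" where
  "irreducible_variety Y \<longleftrightarrow> zclosed Y \<and> Y \<noteq> {} \<and>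
     (\<forall>A B. zclosed A \<and> zclosed B \<and> Y \<subseteq> A \<union> B \<longrightarrow> Y \<subseteq> A \<or> Y \<subseteq> B)"

text \<open>Affine cones over irreducible projective varieties X in P(L): closed,
  irreducible, stable under scaling, and not just the origin.\<close>
definition projective_cone :: "(complex^'n) set \<Rightarrow> bool" where
  "projective_cone C \<longleftrightarrow> irreducible_variety C \<and> (\<forall>t x. x \<in> C \<longrightarrow> t *s x \<in> C) \<and> C \<noteq> {0}"

definition zdim :: "(complex^'n) set \<Rightarrow> nat" where
  "zdim Y = Sup {n. \<exists>Z :: nat \<Rightarrow> (complex^'n) set.
      (\<forall>i\<le>n. irreducible_variety (Z i)) \<and> (\<forall>i<n. Z i \<subset> Z (Suc i)) \<and> Z n \<subseteq> Y}"

definition dir_deriv :: "(complex^'n \<Rightarrow> complex) \<Rightarrow> complex^'n \<Rightarrow> complex^'n \<Rightarrow> complex" where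
  "dir_deriv f p v = deriv (\<lambda>s::complex. f (p + s *s v)) 0"

definition tangent_space :: "(complex^'n) set \<Rightarrow> complex^'n \<Rightarrow> (complex^'n) set" where
  "tangent_space Y p = {v. \<forall>f. is_poly f \<and> (\<forall>y\<in>Y. f y = 0) \<longrightarrow> dir_deriv f p v = 0}"

definition smooth_points :: "(complex^'n) set \<Rightarrow> (complex^'n) set" where
  "smooth_points Y = {p \<in> Y. vec.dim (tangent_space Y p) = zdim Y}"

text \<open>Critical points of the log-likelihood l_{F,u}(p) = log F(p) - u(p) along Y:
  smooth points of Y outside V(F) with T_pY contained in the kernel of the gradient.\<close>
definition crit_points ::
  "(complex^'n \<Rightarrow> complex) \<Rightarrow> (complex^'n) set \<Rightarrow> complex^'n \<Rightarrow> (complex^'n) set" where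
  "crit_points F Y u = {p \<in> smooth_points Y. F p \<noteq> 0 \<and>
      (\<forall>v\<in>tangent_space Y p. dir_deriv F p v / F p - pairing u v = 0)}"

definition has_MLD :: "(complex^'n \<Rightarrow> complex) \<Rightarrow> (complex^'n) set \<Rightarrow> nat \<Rightarrow> bool" where
  "has_MLD F Y m \<longleftrightarrow> (\<exists>U. zopen U \<and> U \<noteq> {} \<and>
      (\<forall>u\<in>U. finite (crit_points F Y u) \<and> card (crit_points F Y u) = m))"

text \<open>Rational maps L* -> L, given by a representative Psi on a nonempty Zariski
  open domain D on which every coordinate is a quotient of polynomials.\<close>
definition rational_map :: "(complex^'n) set \<Rightarrow> (complex^'n \<Rightarrow> complex^'n) \<Rightarrow> bool" where
  "rational_map D \<Psi> \<longleftrightarrow> zopen D \<and> D \<noteq> {} \<and>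
     (\<forall>i. \<exists>p q. is_poly p \<and> is_poly q \<and> (\<forall>u\<in>D. q u \<noteq> 0 \<and> \<Psi> u $ i = p u / q u))"

definition dominant_rational_map ::
  "(complex^'n) set \<Rightarrow> (complex^'n \<Rightarrow> complex^'n) \<Rightarrow> (complex^'n) set \<Rightarrow> bool" where
  "dominant_rational_map D \<Psi> C \<longleftrightarrow> rational_map D \<Psi> \<and> \<Psi> ` D \<subseteq> C \<and> zclosure (\<Psi> ` D) = C"

definition inv_homogeneous :: "(complex^'n) set \<Rightarrow> (complex^'n \<Rightarrow> complex^'n) \<Rightarrow> bool" where
  "inv_homogeneous D \<Psi> \<longleftrightarrow>
     (\<forall>u t. u \<in> D \<and> t \<noteq> 0 \<and> t *s u \<in> D \<longrightarrow> \<Psi> (t *s u) = inverse t *s \<Psi> u)"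

text \<open>Condition (b): grad_u log(F o Psi) = - Psi(u) for general u, the gradient
  being viewed in L via the pairing: for all directions w,
  D_w (F o Psi)(u) / F(Psi u) = - w(Psi u).\<close>
definition log_gradient_condition ::
  "(complex^'n \<Rightarrow> complex) \<Rightarrow> (complex^'n) set \<Rightarrow> (complex^'n \<Rightarrow> complex^'n) \<Rightarrow> bool" where
  "log_gradient_condition F D \<Psi> \<longleftrightarrow> (\<exists>U. zopen U \<and> U \<noteq> {} \<and> U \<subseteq> D \<and>
     (\<forall>u\<in>U. F (\<Psi> u) \<noteq> 0 \<and>
        (\<forall>w. dir_deriv (\<lambda>x. F (\<Psi> x)) u w / F (\<Psi> u) = - pairing w (\<Psi> u))))"

end

theory Submission
  imports Defs "HOL-Computational_Algebra.Fundamental_Theorem_Algebra"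
begin

text \<open>
  Candidate maps are estimators. For \<open>\<Psi>\<close> as in (a), (b), Euler's identity gives
  \<open>u(\<Psi>(u)) = deg F\<close>; differentiating it and comparing with (b) shows that the gradient of the
  log-likelihood vanishes on the image of \<open>d\<Psi>\<close>, which is the tangent space at a general point.
  Condition (b) also says that \<open>d\<Psi>\<close> is minus a Hessian, hence symmetric, hence kills the conormal
  vectors \<open>\<nabla>g(\<Psi>(u))\<close> for g vanishing on C. This forces \<open>\<Psi>\<close> to be constant along the affine
  space \<open>u + N\<close>, N the conormal space at \<open>\<Psi>(u)\<close>. If p is any critical point for u, then
  \<open>u = \<nabla> log F(p) + \<nabla>g(p)\<close> for such a g, and the identity
  \<open>\<Psi>(\<nabla> log F(q) + \<nabla>g(q)) = q\<close>, true for general \<open>q = \<Psi>(x)\<close>, extends to q = p.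

  Degree one gives a candidate. On the variety of pairs (p, c), the map
  \<open>\<Theta>(p, c) = \<nabla> log F(p) + \<Sum> c\<^sub>i \<nabla>G\<^sub>i(p)\<close>, with \<open>\<nabla>G\<^sub>i\<close> a frame of the conormal spaces, is
  dominant between varieties of equal dimension, so every coordinate of p is algebraic over the
  coordinates of \<open>\<Theta>\<close>. A minimal polynomial of degree at least two would have a second root that
  lifts to a second critical point; hence p is a rational function of \<open>\<Theta>(p, c)\<close>.

  Both halves rest on one extension principle: a point of an algebra of functions, with values in a
  ring B, extends to one more function either freely (transcendental case) or by a root of the
  minimal relation (algebraic case). With B the complex numbers it lifts points; with B the dual
  numbers it produces tangent vectors and hence the dimension theory.
\<close>

section \<open>Generic points of algebras of functions\<close>

text \<open>The obstacle is dimension. \<open>zdim\<close> is defined by chains of irreducible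
  closed sets and \<open>smooth_points\<close> compares it with tangent spaces, so three numbers
  must be matched: the length of chains, the number of independent functions, the tangent dimension.
  Independent functions never outnumber the tangent dimension at any point; a strict inclusion makes
  room for one more of them; and for the image of a parametrization a chain of the right length is
  built explicitly. In the other direction a critical point is smooth by definition and already
  supplies the equality.

  The fibres of \<Psi> are treated analytically. That d\<Psi> kills \<open>grad g (\<Psi> x)\<close>
  gives constancy along a vector field, whereas constancy along a straight line is wanted; the gap
  closes because the field depends on x only through \<Psi>(x).

  A critical point p need not lie in the image of \<Psi>, nor in the chart on which \<Theta> is
  built. This is why a polynomial g is fixed from the data at p: its gradient makes sense at all
  nearby points, and identities proved on a dense part of C can be carried to p.\<close>

class complex_algebra = comm_ring_1 +
  fixes scalar :: "complex \<Rightarrow> 'a"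
  assumes scalar_add: "scalar (a + b) = scalar a + scalar b"
    and scalar_mult: "scalar (a * b) = scalar a * scalar b"
    and scalar_1 [simp]: "scalar 1 = 1"
begin

lemma scalar_0 [simp]: "scalar 0 = 0"
  using scalar_add[of 0 0] by simp

lemma scalar_minus: "scalar (- a) = - scalar a"
  using scalar_add[of a "- a"] by (simp add: eq_neg_iff_add_eq_0 add.commute)

end

instantiation complex :: complex_algebra
begin
definition scalar_complex :: "complex \<Rightarrow> complex" where [simp]: "scalar_complex c = c"
instance by standard auto
end

text \<open>Polynomials over B are again a value ring: evaluating an expression with one variable
  sent to the indeterminate exhibits its coefficients in that variable.\<close>

instantiation poly :: (complex_algebra) complex_algebra
begin
definition scalar_poly :: "complex \<Rightarrow> 'a poly" where "scalar_poly c = [:scalar c:]"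
instance by standard (auto simp: scalar_poly_def scalar_add scalar_mult one_pCons)
end

text \<open>The ring C[eps]/(eps^2): a point with values in it is a complex point together with a
  tangent vector.\<close>

datatype dual = Dual (dre: complex) (deps: complex)

lemma dual_eq_iff: "x = y \<longleftrightarrow> dre x = dre y \<and> deps x = deps y"
  by (cases x; cases y) auto

instantiation dual :: complex_algebra
begin
definition "0 = Dual 0 0"
definition "1 = Dual 1 0"
definition "x + y = Dual (dre x + dre y) (deps x + deps y)"
definition "x - y = Dual (dre x - dre y) (deps x - deps y)"
definition "- x = Dual (- dre x) (- deps x)"
definition "x * y = Dual (dre x * dre y) (dre x * deps y + deps x * dre y)"
definition scalar_dual :: "complex \<Rightarrow> dual" where "scalar_dual c = Dual c 0"
instance
  by standard (auto simp: dual_eq_iff zero_dual_def one_dual_def plus_dual_def minus_dual_def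
      uminus_dual_def times_dual_def scalar_dual_def algebra_simps)
end

lemma dual_simps [simp]:
  "dre 0 = 0" "deps 0 = 0" "dre 1 = 1" "deps 1 = 0"
  "dre (x + y) = dre x + dre y" "deps (x + y) = deps x + deps y"
  "dre (x - y) = dre x - dre y" "deps (x - y) = deps x - deps y"
  "dre (- x) = - dre x" "deps (- x) = - deps x"
  "dre (x * y) = dre x * dre y" "deps (x * y) = dre x * deps y + deps x * dre y"
  "dre (scalar c) = c" "deps (scalar c) = 0"
  by (simp_all add: zero_dual_def one_dual_def plus_dual_def minus_dual_def
      uminus_dual_def times_dual_def scalar_dual_def)

lemma dre_sum [simp]: "dre (sum f A) = (\<Sum>i\<in>A. dre (f i))"
  by (induction A rule: infinite_finite_induct) auto

lemma deps_sum [simp]: "deps (sum f A) = (\<Sum>i\<in>A. deps (f i))"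
  by (induction A rule: infinite_finite_induct) auto

lemma dre_power [simp]: "dre (x ^ n) = dre x ^ n"
  by (induction n) auto

lemma deps_power: "deps (x ^ n) = of_nat n * dre x ^ (n - 1) * deps x"
proof (induction n)
  case (Suc n)
  then show ?case by (cases n) (auto simp: algebra_simps)
qed auto

text \<open>Polynomials in variables indexed by natural numbers: unlike \<open>is_poly\<close> on \<open>complex^'n\<close>, their
  number of variables may vary within a proof.\<close>
datatype pexp = Cst complex | Var nat | Add pexp pexp | Mul pexp pexp

primrec peval :: "(nat \<Rightarrow> 'b::complex_algebra) \<Rightarrow> pexp \<Rightarrow> 'b" where
  "peval \<rho> (Cst c) = scalar c"
| "peval \<rho> (Var i) = \<rho> i"
| "peval \<rho> (Add p q) = peval \<rho> p + peval \<rho> q"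
| "peval \<rho> (Mul p q) = peval \<rho> p * peval \<rho> q"

primrec vars_below :: "nat \<Rightarrow> pexp \<Rightarrow> bool" where
  "vars_below k (Cst c) \<longleftrightarrow> True"
| "vars_below k (Var i) \<longleftrightarrow> i < k"
| "vars_below k (Add p q) \<longleftrightarrow> vars_below k p \<and> vars_below k q"
| "vars_below k (Mul p q) \<longleftrightarrow> vars_below k p \<and> vars_below k q"

primrec psubst :: "(nat \<Rightarrow> pexp) \<Rightarrow> pexp \<Rightarrow> pexp" where
  "psubst \<sigma> (Cst c) = Cst c"
| "psubst \<sigma> (Var i) = \<sigma> i"
| "psubst \<sigma> (Add p q) = Add (psubst \<sigma> p) (psubst \<sigma> q)"
| "psubst \<sigma> (Mul p q) = Mul (psubst \<sigma> p) (psubst \<sigma> q)"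

lemma peval_psubst: "peval \<rho> (psubst \<sigma> p) = peval (\<lambda>i. peval \<rho> (\<sigma> i)) p"
  by (induction p) auto

lemma vars_below_psubst: "vars_below k p \<Longrightarrow> (\<And>i. i < k \<Longrightarrow> vars_below l (\<sigma> i)) \<Longrightarrow> vars_below l (psubst \<sigma> p)"
  by (induction p) auto

lemma vars_below_mono: "vars_below k p \<Longrightarrow> k \<le> l \<Longrightarrow> vars_below l p"
  by (induction p) auto

lemma peval_cong: "vars_below k p \<Longrightarrow> (\<And>i. i < k \<Longrightarrow> \<rho> i = \<rho>' i) \<Longrightarrow> peval \<rho> p = peval \<rho>' p"
  by (induction p) auto

lemma peval_upd [simp]: "vars_below k p \<Longrightarrow> k \<le> j \<Longrightarrow> peval (\<rho>(j := t)) p = peval \<rho> p"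
  by (rule peval_cong) auto

lemma peval_closed: "vars_below 0 p \<Longrightarrow> peval \<rho> p = scalar (peval (\<lambda>_. 0 :: complex) p)"
  by (induction p) (auto simp: scalar_add scalar_mult)

lemma dre_peval: "dre (peval \<rho> p) = peval (\<lambda>i. dre (\<rho> i)) p"
  by (induction p) auto

primrec psum :: "(nat \<Rightarrow> pexp) \<Rightarrow> nat \<Rightarrow> pexp" where
  "psum f 0 = Cst 0"
| "psum f (Suc n) = Add (psum f n) (f n)"

lemma peval_psum [simp]: "peval \<rho> (psum f n) = (\<Sum>i<n. peval \<rho> (f i))"
  by (induction n) auto

lemma vars_below_psum: "(\<And>i. i < n \<Longrightarrow> vars_below k (f i)) \<Longrightarrow> vars_below k (psum f n)"
  by (induction n) auto

primrec ppow :: "pexp \<Rightarrow> nat \<Rightarrow> pexp" where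
  "ppow p 0 = Cst 1"
| "ppow p (Suc n) = Mul p (ppow p n)"

lemma peval_ppow [simp]: "peval \<rho> (ppow p n) = peval \<rho> p ^ n"
  by (induction n) auto

lemma vars_below_ppow: "vars_below k p \<Longrightarrow> vars_below k (ppow p n)"
  by (induction n) auto

text \<open>The coefficients are again expressions, so that they can be tested one by one for
  vanishing on S.\<close>

primrec pcoeff :: "nat \<Rightarrow> pexp \<Rightarrow> nat \<Rightarrow> pexp" where
  "pcoeff k (Cst c) = (\<lambda>i. if i = 0 then Cst c else Cst 0)"
| "pcoeff k (Var j) = (\<lambda>i. if j = k then (if i = 1 then Cst 1 else Cst 0)
                        else (if i = 0 then Var j else Cst 0))"
| "pcoeff k (Add p q) = (\<lambda>i. Add (pcoeff k p i) (pcoeff k q i))"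
| "pcoeff k (Mul p q) = (\<lambda>i. psum (\<lambda>j. Mul (pcoeff k p j) (pcoeff k q (i - j))) (Suc i))"

text \<open>Only an upper bound for the degree in any single variable; surplus coefficients evaluate
  to zero.\<close>

primrec pdeg :: "pexp \<Rightarrow> nat" where
  "pdeg (Cst c) = 0"
| "pdeg (Var j) = 1"
| "pdeg (Add p q) = max (pdeg p) (pdeg q)"
| "pdeg (Mul p q) = pdeg p + pdeg q"

lemma vars_below_pcoeff: "vars_below (Suc k) p \<Longrightarrow> vars_below k (pcoeff k p i)"
proof (induction p arbitrary: i)
  case (Mul p q)
  then show ?case by (auto simp del: psum.simps intro!: vars_below_psum)
qed auto

text \<open>Evaluate in polynomials over B, with variable k sent to the indeterminate and the others
  to constants; \<open>coeff\<close> then turns into \<open>pcoeff\<close>.\<close>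

lemma peval_pcoeff:
  "peval \<rho> p = (\<Sum>i<Suc (pdeg p). peval \<rho> (pcoeff k p i) * (\<rho> k) ^ i)"
proof -
  define P where "P = peval (\<lambda>j. if j = k then [:0, 1:] else [:\<rho> j:]) p"
  have c: "coeff (peval (\<lambda>j. if j = k then [:0, 1:] else [:\<rho> j:]) p) i = peval \<rho> (pcoeff k p i)" for i
    by (induction p arbitrary: i)
       (auto simp: scalar_poly_def coeff_mult lessThan_Suc_atMost coeff_pCons split: nat.split
             simp del: sum.lessThan_Suc psum.simps)
  have d: "degree (peval (\<lambda>j. if j = k then [:0, 1:] else [:\<rho> j:]) p) \<le> pdeg p"
  proof (induction p)
    case (Add p q) then show ?case by (auto intro!: degree_add_le)
  next
    case (Mul p q) then show ?case by (auto intro: order.trans[OF degree_mult_le])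
  qed (auto simp: scalar_poly_def)
  have "poly (peval (\<lambda>j. if j = k then [:0, 1:] else [:\<rho> j:]) p) (\<rho> k) = peval \<rho> p"
    by (induction p) (auto simp: scalar_poly_def)
  hence "peval \<rho> p = poly P (\<rho> k)" by (simp add: P_def)
  also have "\<dots> = (\<Sum>i\<le>degree P. coeff P i * \<rho> k ^ i)" by (rule poly_altdef)
  also have "\<dots> = (\<Sum>i\<le>pdeg p. coeff P i * \<rho> k ^ i)"
    using d by (intro sum.mono_neutral_left) (auto simp: P_def coeff_eq_0)
  finally show ?thesis using c by (simp add: P_def lessThan_Suc_atMost del: sum.lessThan_Suc)
qed

section \<open>Relations among functions and points with values in a ring\<close>

definition vanishes :: "'a set \<Rightarrow> ('a \<Rightarrow> nat \<Rightarrow> complex) \<Rightarrow> pexp \<Rightarrow> bool" where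
  "vanishes S H p \<longleftrightarrow> (\<forall>x\<in>S. peval (H x) p = 0)"

text \<open>The number d counts coefficients, so the degree is below d.\<close>

definition relation :: "'a set \<Rightarrow> ('a \<Rightarrow> nat \<Rightarrow> complex) \<Rightarrow> nat \<Rightarrow> nat \<Rightarrow> (nat \<Rightarrow> pexp) \<Rightarrow> bool" where
  "relation S H k d q \<longleftrightarrow> (\<forall>i<d. vars_below k (q i)) \<and>
     (\<forall>x\<in>S. (\<Sum>i<d. peval (H x) (q i) * H x k ^ i) = 0)"

text \<open>Coefficients are asked to vanish on S, not to be zero as expressions, since the earlier
  entries may satisfy relations themselves.\<close>

definition transc :: "'a set \<Rightarrow> ('a \<Rightarrow> nat \<Rightarrow> complex) \<Rightarrow> nat \<Rightarrow> bool" where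
  "transc S H k \<longleftrightarrow> (\<forall>d q. relation S H k d q \<longrightarrow> (\<forall>i<d. vanishes S H (q i)))"

text \<open>A minimal polynomial of degree e without a field of fractions: the leading coefficient
  is any function that is not identically zero on S.\<close>

definition min_relation :: "'a set \<Rightarrow> ('a \<Rightarrow> nat \<Rightarrow> complex) \<Rightarrow> nat \<Rightarrow> nat \<Rightarrow> (nat \<Rightarrow> pexp) \<Rightarrow> bool" where
  "min_relation S H k e q \<longleftrightarrow> relation S H k (Suc e) q \<and> \<not> vanishes S H (q e) \<and>
     (\<forall>d r. d \<le> e \<longrightarrow> relation S H k d r \<longrightarrow> (\<forall>i<d. vanishes S H (r i)))"

text \<open>A B-valued point of the Zariski closure of the image of S under the first k functions.\<close>
definition gen_point :: "'a set \<Rightarrow> ('a \<Rightarrow> nat \<Rightarrow> complex) \<Rightarrow> nat \<Rightarrow> (nat \<Rightarrow> 'b::complex_algebra) \<Rightarrow> bool" where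
  "gen_point S H k \<tau> \<longleftrightarrow> (\<forall>p. vars_below k p \<longrightarrow> vanishes S H p \<longrightarrow> peval \<tau> p = 0)"

definition integral_on :: "'a set \<Rightarrow> ('a \<Rightarrow> nat \<Rightarrow> complex) \<Rightarrow> nat \<Rightarrow> bool" where
  "integral_on S H N \<longleftrightarrow> S \<noteq> {} \<and>
     (\<forall>p q. vars_below N p \<longrightarrow> vars_below N q \<longrightarrow> vanishes S H (Mul p q) \<longrightarrow> vanishes S H p \<or> vanishes S H q)"

lemma integral_on_mono: "integral_on S H N \<Longrightarrow> M \<le> N \<Longrightarrow> integral_on S H M"
  unfolding integral_on_def by (meson vars_below_mono)

lemma integral_on_mult: "integral_on S H N \<Longrightarrow> vars_below N p \<Longrightarrow> vars_below N q \<Longrightarrow> \<not> vanishes S H p \<Longrightarrow> \<not> vanishes S H q \<Longrightarrow> \<not> vanishes S H (Mul p q)"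
  unfolding integral_on_def by blast

lemma integral_on_ppow: "integral_on S H N \<Longrightarrow> vars_below N p \<Longrightarrow> \<not> vanishes S H p \<Longrightarrow> \<not> vanishes S H (ppow p n)"
proof (induction n)
  case 0 then show ?case by (auto simp: integral_on_def vanishes_def)
next
  case (Suc n) then show ?case using integral_on_mult[of S H N p "ppow p n"] by (auto simp: vars_below_ppow)
qed

lemma transc_cong:
  assumes "\<And>x i. x \<in> S \<Longrightarrow> i \<le> k \<Longrightarrow> H x i = H' x i" and "transc S H k"
  shows "transc S H' k"
  unfolding transc_def
proof (intro allI impI)
  fix d q i assume r: "relation S H' k d q" and i: "i < d"
  have e: "vars_below k p \<Longrightarrow> x \<in> S \<Longrightarrow> peval (H x) p = peval (H' x) p" for p x
    by (rule peval_cong) (auto intro: assms(1))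
  have "relation S H k d q"
    unfolding relation_def
  proof (intro conjI ballI allI impI)
    fix x assume x: "x \<in> S"
    have "(\<Sum>i<d. peval (H x) (q i) * H x k ^ i) = (\<Sum>i<d. peval (H' x) (q i) * H' x k ^ i)"
      using r e x assms(1)[OF x, of k] by (intro sum.cong) (auto simp: relation_def)
    thus "(\<Sum>i<d. peval (H x) (q i) * H x k ^ i) = 0" using r x by (simp add: relation_def)
  qed (use r in \<open>auto simp: relation_def\<close>)
  with assms(2) i have "vanishes S H (q i)" by (auto simp: transc_def)
  thus "vanishes S H' (q i)" using e r i by (auto simp: vanishes_def relation_def)
qed

text \<open>Take a nontrivial relation with the fewest coefficients; if its leading coefficient
  vanished on S, dropping it would leave a shorter nontrivial one.\<close>

lemma ex_min_relation:
  assumes "\<not> transc S H k"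
  obtains e q where "min_relation S H k e q"
proof -
  define P where "P d \<longleftrightarrow> (\<exists>q. relation S H k d q \<and> (\<exists>i<d. \<not> vanishes S H (q i)))" for d
  define d where "d = (LEAST d. P d)"
  have "\<exists>d. P d" using assms by (auto simp: transc_def P_def)
  hence Pd: "P d" unfolding d_def by (rule LeastI_ex)
  have least: "\<not> P d'" if "d' < d" for d' using that not_less_Least d_def by blast
  from Pd obtain q where q: "relation S H k d q" "\<exists>i<d. \<not> vanishes S H (q i)" by (auto simp: P_def)
  then obtain e where e: "d = Suc e" by (cases d) auto
  have "\<not> vanishes S H (q e)"
  proof
    assume z: "vanishes S H (q e)"
    have "relation S H k e q" using q(1) z by (auto simp: relation_def e vanishes_def)
    moreover have "\<exists>i<e. \<not> vanishes S H (q i)" using q(2) z e less_antisym by blast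
    ultimately show False using least[of e] e by (auto simp: P_def)
  qed
  hence "min_relation S H k e q"
    using q(1) least by (auto simp: min_relation_def e P_def less_Suc_eq_le)
  thus thesis by (rule that)
qed

lemma min_relation_pos: "min_relation S H k e q \<Longrightarrow> 0 < e"
  by (cases e) (auto simp: min_relation_def relation_def vanishes_def)

text \<open>The formal derivative has only e coefficients, so if it were a relation, minimality
  would make them all vanish; yet the top one is e times the leading coefficient. This is
  separability in characteristic zero.\<close>

lemma min_relation_deriv:
  assumes "min_relation S H k e q"
  shows "\<exists>x\<in>S. (\<Sum>i<e. of_nat (Suc i) * peval (H x) (q (Suc i)) * H x k ^ i) \<noteq> 0"
proof (rule ccontr)
  assume a: "\<not> ?thesis"
  define r where "r i = Mul (Cst (of_nat (Suc i))) (q (Suc i))" for i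
  have "relation S H k e r" using assms a
    by (auto simp: relation_def r_def min_relation_def simp del: of_nat_Suc)
  hence "\<forall>i<e. vanishes S H (r i)" using assms by (auto simp: min_relation_def)
  moreover have "\<not> vanishes S H (r (e - 1))"
    using assms min_relation_pos[OF assms] by (auto simp: min_relation_def vanishes_def r_def)
  ultimately show False using min_relation_pos[OF assms] by simp
qed

text \<open>If p vanishes on S, transcendence makes each of its coefficients in the new variable
  vanish on S, hence at \<tau>; any value t is then allowed.\<close>

lemma ext_trans:
  assumes "transc S H k" "gen_point S H k \<tau>"
  shows "gen_point S H (Suc k) (\<tau>(k := t))"
  unfolding gen_point_def
proof (intro allI impI)
  fix p assume p: "vars_below (Suc k) p" "vanishes S H p"
  have "relation S H k (Suc (pdeg p)) (pcoeff k p)"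
    using p by (auto simp: relation_def vars_below_pcoeff vanishes_def peval_pcoeff[of _ p k] simp del: sum.lessThan_Suc)
  hence z: "vanishes S H (pcoeff k p i)" if "i < Suc (pdeg p)" for i using assms(1) that by (auto simp: transc_def)
  have "peval \<tau> (pcoeff k p i) = 0" if "i < Suc (pdeg p)" for i
    using assms(2) z[OF that] vars_below_pcoeff[OF p(1)] by (auto simp: gen_point_def)
  thus "peval (\<tau>(k := t)) p = 0"
    by (subst peval_pcoeff[of _ p k]) (auto simp: peval_upd[OF vars_below_pcoeff[OF p(1)]] simp del: sum.lessThan_Suc intro!: sum.neutral)
qed

text \<open>Pseudo-division by the minimal relation.\<close>
lemma ext_alg_aux:
  fixes \<tau> :: "nat \<Rightarrow> 'b::complex_algebra"
  assumes m: "min_relation S H k e q" and p: "gen_point S H k \<tau>"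
    and reg: "\<And>b. b * peval \<tau> (q e) = 0 \<Longrightarrow> b = 0"
    and root: "(\<Sum>i<Suc e. peval \<tau> (q i) * t ^ i) = 0"
    and r: "relation S H k d r"
  shows "(\<Sum>i<d. peval \<tau> (r i) * t ^ i) = 0"
  using r
proof (induction d arbitrary: r)
  case 0 then show ?case by simp
next
  case (Suc d r)
  show ?case
  proof (cases "Suc d \<le> e")
    case True
    hence "\<forall>i<Suc d. vanishes S H (r i)" using m Suc.prems by (auto simp: min_relation_def)
    moreover have "\<forall>i<Suc d. vars_below k (r i)" using Suc.prems by (auto simp: relation_def)
    ultimately have "\<forall>i<Suc d. peval \<tau> (r i) = 0" using p by (auto simp: gen_point_def)
    thus ?thesis by (intro sum.neutral) auto
  next
    case False
    hence de: "e \<le> d" by simp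
    \<comment> \<open>The combination q_e r - r_d X^(d-e) q: its top coefficient cancels
      identically, which leaves a relation with one coefficient fewer.\<close>
    define s where "s i = Add (Mul (q e) (r i))
       (if d - e \<le> i then Mul (Cst (-1)) (Mul (r d) (q (i - (d - e)))) else Cst 0)" for i
    have qr: "\<forall>i<Suc e. vars_below k (q i)" "\<forall>i<Suc d. vars_below k (r i)"
      using m Suc.prems by (auto simp: min_relation_def relation_def)
    have key: "(\<Sum>i<Suc d. peval \<rho> (s i) * u ^ i) =
        peval \<rho> (q e) * (\<Sum>i<Suc d. peval \<rho> (r i) * u ^ i)
        - peval \<rho> (r d) * u ^ (d - e) * (\<Sum>i<Suc e. peval \<rho> (q i) * u ^ i)" for \<rho> :: "nat \<Rightarrow> 'c::complex_algebra" and u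
    proof -
      have "(\<Sum>i<Suc d. peval \<rho> (s i) * u ^ i) = (\<Sum>i<Suc d. peval \<rho> (q e) * (peval \<rho> (r i) * u ^ i))
         - (\<Sum>i<Suc d. if d - e \<le> i then peval \<rho> (r d) * (peval \<rho> (q (i - (d - e))) * u ^ i) else 0)"
        unfolding sum_subtractf[symmetric]
        by (intro sum.cong) (auto simp: s_def algebra_simps scalar_minus)
      also have "(\<Sum>i<Suc d. if d - e \<le> i then peval \<rho> (r d) * (peval \<rho> (q (i - (d - e))) * u ^ i) else 0)
         = (\<Sum>i\<in>{d - e..<Suc d}. peval \<rho> (r d) * (peval \<rho> (q (i - (d - e))) * u ^ i))"
        by (intro sum.mono_neutral_cong_right) auto
      also have "\<dots> = (\<Sum>i<Suc e. peval \<rho> (r d) * (peval \<rho> (q i) * u ^ (i + (d - e))))"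
        by (rule sum.reindex_bij_witness[of _ "\<lambda>i. i + (d - e)" "\<lambda>i. i - (d - e)"]) (use de in auto)
      finally show ?thesis
        by (simp add: sum_distrib_left power_add algebra_simps del: sum.lessThan_Suc)
    qed
    have sd: "peval \<rho> (s d) = 0" for \<rho> :: "nat \<Rightarrow> 'c::complex_algebra"
      using de by (simp add: s_def scalar_minus algebra_simps)
    have "relation S H k d s"
      unfolding relation_def
    proof (intro conjI ballI allI impI)
      fix i assume "i < d" thus "vars_below k (s i)" using qr de by (auto simp: s_def)
    next
      fix x assume x: "x \<in> S"
      have "(\<Sum>i<Suc d. peval (H x) (s i) * H x k ^ i) = 0"
        using key[of "H x" "H x k"] m Suc.prems x by (simp add: min_relation_def relation_def del: sum.lessThan_Suc)
      thus "(\<Sum>i<d. peval (H x) (s i) * H x k ^ i) = 0" by (simp add: sd)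
    qed
    hence "(\<Sum>i<d. peval \<tau> (s i) * t ^ i) = 0" by (rule Suc.IH)
    hence "(\<Sum>i<Suc d. peval \<tau> (s i) * t ^ i) = 0" by (simp add: sd)
    \<comment> \<open>The part containing q is zero because t is a root; the remaining factor q_e is
      cancelled by \<open>reg\<close>, which says that it is no zero divisor in B.\<close>
    hence "(\<Sum>i<Suc d. peval \<tau> (r i) * t ^ i) * peval \<tau> (q e) = 0"
      using key[of \<tau> t] root by (simp add: mult.commute del: sum.lessThan_Suc)
    thus ?thesis by (rule reg)
  qed
qed

lemma ext_alg:
  fixes \<tau> :: "nat \<Rightarrow> 'b::complex_algebra"
  assumes m: "min_relation S H k e q" and p: "gen_point S H k \<tau>"
    and reg: "\<And>b. b * peval \<tau> (q e) = 0 \<Longrightarrow> b = 0"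
    and root: "(\<Sum>i<Suc e. peval \<tau> (q i) * t ^ i) = 0"
  shows "gen_point S H (Suc k) (\<tau>(k := t))"
  unfolding gen_point_def
proof (intro allI impI)
  fix p assume p: "vars_below (Suc k) p" "vanishes S H p"
  have "relation S H k (Suc (pdeg p)) (pcoeff k p)"
    using p by (auto simp: relation_def vars_below_pcoeff vanishes_def peval_pcoeff[of _ p k] simp del: sum.lessThan_Suc)
  hence "(\<Sum>i<Suc (pdeg p). peval \<tau> (pcoeff k p i) * t ^ i) = 0"
    using ext_alg_aux[OF m \<open>gen_point S H k \<tau>\<close> reg root] by blast
  thus "peval (\<tau>(k := t)) p = 0"
    by (subst peval_pcoeff[of _ p k]) (simp add: peval_upd[OF vars_below_pcoeff[OF p(1)]] del: sum.lessThan_Suc)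
qed

lemma gen_point_0: "S \<noteq> {} \<Longrightarrow> gen_point S H 0 \<tau>"
  unfolding gen_point_def vanishes_def
proof (intro allI impI)
  fix p assume "S \<noteq> {}" "vars_below 0 p" "\<forall>x\<in>S. peval (H x) p = 0"
  then obtain x where "x \<in> S" "peval (H x) p = 0" by auto
  thus "peval \<tau> p = 0" using peval_closed[OF \<open>vars_below 0 p\<close>, of "H x"] peval_closed[OF \<open>vars_below 0 p\<close>, of \<tau>] by simp
qed

text \<open>Independent functions impose no equation, so every assignment is a point: the closure of
  their image is an affine space.\<close>

lemma gen_point_trans:
  assumes "S \<noteq> {}" "\<And>i. i < k \<Longrightarrow> transc S H i"
  shows "gen_point S H k \<tau>"
  using assms(2)
proof (induction k)
  case 0 then show ?case by (intro gen_point_0 assms(1))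
next
  case (Suc k)
  have "gen_point S H (Suc k) (\<tau>(k := \<tau> k))" using Suc by (intro ext_trans) auto
  thus ?case by simp
qed

text \<open>Tangent components are prescribed on k independent functions and extended one function
  at a time: a transcendental function gets component zero, an algebraic one is forced by implicit
  differentiation of its minimal relation. The factors of \<delta> exclude the points where a
  leading coefficient or the derivative of a relation vanishes.\<close>

lemma generic_tangent:
  assumes d: "integral_on S H N" and tr: "\<And>i. i < k \<Longrightarrow> transc S H i" and kN: "k \<le> N"
  shows "\<exists>\<delta>. vars_below N \<delta> \<and> \<not> vanishes S H \<delta> \<and> (\<forall>x\<in>S. peval (H x) \<delta> \<noteq> 0 \<longrightarrow>
     (\<forall>w. \<exists>\<tau>. gen_point S H N \<tau> \<and> (\<forall>i<N. dre (\<tau> i) = H x i) \<and> (\<forall>i<k. deps (\<tau> i) = w i)))"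
  using kN d
proof (induction N rule: dec_induct)
  case base
  have ne: "S \<noteq> {}" using base by (simp add: integral_on_def)
  show ?case
  proof (intro exI[of _ "Cst 1"] conjI ballI impI allI)
    show "\<not> vanishes S H (Cst 1)" using ne by (auto simp: vanishes_def)
  next
    fix x w assume "x \<in> S"
    show "\<exists>\<tau>. gen_point S H k \<tau> \<and> (\<forall>i<k. dre (\<tau> i) = H x i) \<and> (\<forall>i<k. deps (\<tau> i) = w i)"
      by (rule exI[of _ "\<lambda>i. Dual (H x i) (w i)"]) (use gen_point_trans[OF ne tr] in auto)
  qed simp
next
  case (step N)
  obtain \<delta> where \<delta>: "vars_below N \<delta>" "\<not> vanishes S H \<delta>" and
    ex: "\<And>x w. x \<in> S \<Longrightarrow> peval (H x) \<delta> \<noteq> 0 \<Longrightarrow> \<exists>\<tau>. gen_point S H N \<tau> \<and>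
         (\<forall>i<N. dre (\<tau> i) = H x i) \<and> (\<forall>i<k. deps (\<tau> i) = w i)"
    using step.IH integral_on_mono[OF step.prems, of N] by auto
  show ?case
  proof (cases "transc S H N")
    case True
    show ?thesis
    proof (intro exI[of _ \<delta>] conjI ballI impI allI)
      fix x w assume x: "x \<in> S" "peval (H x) \<delta> \<noteq> 0"
      then obtain \<tau> where \<tau>: "gen_point S H N \<tau>" "\<forall>i<N. dre (\<tau> i) = H x i" "\<forall>i<k. deps (\<tau> i) = w i"
        using ex by blast
      show "\<exists>\<tau>. gen_point S H (Suc N) \<tau> \<and> (\<forall>i<Suc N. dre (\<tau> i) = H x i) \<and> (\<forall>i<k. deps (\<tau> i) = w i)"
        by (rule exI[of _ "\<tau>(N := Dual (H x N) 0)"])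
           (use \<tau> step.hyps ext_trans[OF True \<tau>(1)] in \<open>auto simp: less_Suc_eq\<close>)
    qed (use \<delta> in \<open>auto intro: vars_below_mono\<close>)
  next
    case False
    then obtain e q where m: "min_relation S H N e q" by (rule ex_min_relation)
    \<comment> \<open>The derivative of the minimal relation in its last variable, which is not
      identically zero on S.\<close>
    define P' where "P' = psum (\<lambda>i. Mul (Mul (Cst (of_nat (Suc i))) (q (Suc i))) (ppow (Var N) i)) e"
    have evP': "peval (H x) P' = (\<Sum>i<e. of_nat (Suc i) * peval (H x) (q (Suc i)) * H x N ^ i)" for x
      by (simp add: P'_def)
    have vq: "vars_below N (q i)" if "i < Suc e" for i using m that by (auto simp: min_relation_def relation_def)
    have vP': "vars_below (Suc N) P'" unfolding P'_def
      by (intro vars_below_psum) (auto intro!: vars_below_ppow vars_below_mono[OF vq])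
    have nP': "\<not> vanishes S H P'" using min_relation_deriv[OF m] by (simp only: vanishes_def evP') auto
    have nq: "\<not> vanishes S H (q e)" using m by (auto simp: min_relation_def)
    define \<delta>' where "\<delta>' = Mul \<delta> (Mul (q e) P')"
    have v\<delta>': "vars_below (Suc N) \<delta>'" "vars_below (Suc N) (Mul (q e) P')"
      using \<delta>(1) vP' vq[of e] by (auto simp: \<delta>'_def intro: vars_below_mono)
    have "\<not> vanishes S H \<delta>'" unfolding \<delta>'_def
      using v\<delta>' \<delta> nq nP' vP' vq[of e] step.prems
      by (intro integral_on_mult[of S H "Suc N"]) (auto simp del: vars_below.simps intro: vars_below_mono)
    moreover have "\<exists>\<tau>. gen_point S H (Suc N) \<tau> \<and> (\<forall>i<Suc N. dre (\<tau> i) = H x i) \<and> (\<forall>i<k. deps (\<tau> i) = w i)"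
      if x: "x \<in> S" "peval (H x) \<delta>' \<noteq> 0" for x w
    proof -
      have nz: "peval (H x) \<delta> \<noteq> 0" "peval (H x) (q e) \<noteq> 0" "peval (H x) P' \<noteq> 0"
        using x(2) by (auto simp: \<delta>'_def)
      obtain \<tau> where \<tau>: "gen_point S H N \<tau>" "\<forall>i<N. dre (\<tau> i) = H x i" "\<forall>i<k. deps (\<tau> i) = w i"
        using ex[OF x(1) nz(1)] by blast
      have dr: "dre (peval \<tau> (q i)) = peval (H x) (q i)" if "i < Suc e" for i
        unfolding dre_peval using \<tau>(2) by (intro peval_cong[OF vq[OF that]]) auto
      \<comment> \<open>The change of the relation caused by moving its coefficients along \<tau>; y
        solves P' y + A = 0.\<close>
      define A where "A = (\<Sum>i<Suc e. deps (peval \<tau> (q i)) * H x N ^ i)"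
      define y where "y = - A / peval (H x) P'"
      define t where "t = Dual (H x N) y"
      have "(\<Sum>i<Suc e. peval \<tau> (q i) * t ^ i) = 0" (is "?L = 0")
      proof -
        have "dre ?L = (\<Sum>i<Suc e. peval (H x) (q i) * H x N ^ i)"
          unfolding dre_sum by (intro sum.cong) (auto simp: dr t_def)
        also have "\<dots> = 0" using m x by (auto simp: min_relation_def relation_def)
        finally have 1: "dre ?L = 0" .
        have "deps ?L = (\<Sum>i<Suc e. peval (H x) (q i) * (of_nat i * H x N ^ (i - 1) * y)) + A"
          unfolding deps_sum A_def sum.distrib[symmetric]
          by (intro sum.cong) (auto simp: dr t_def deps_power)
        also have "(\<Sum>i<Suc e. peval (H x) (q i) * (of_nat i * H x N ^ (i - 1) * y)) = peval (H x) P' * y"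
          unfolding sum.lessThan_Suc_shift evP' sum_distrib_right by (simp add: algebra_simps)
        also have "\<dots> = - A" using nz(3) by (simp add: y_def)
        finally have "deps ?L = 0" by simp
        with 1 show ?thesis by (simp add: dual_eq_iff)
      qed
      \<comment> \<open>A dual number with nonzero complex part is a unit.\<close>
      moreover have "b = 0" if "b * peval \<tau> (q e) = 0" for b
      proof -
        have "dre b = 0" using arg_cong[OF that, of dre] nz(2) by (simp add: dr)
        moreover have "deps b = 0" using arg_cong[OF that, of deps] nz(2) \<open>dre b = 0\<close> by (simp add: dr)
        ultimately show ?thesis by (simp add: dual_eq_iff)
      qed
      ultimately have "gen_point S H (Suc N) (\<tau>(N := t))" by (intro ext_alg[OF m \<tau>(1)])
      thus ?thesis by (intro exI[of _ "\<tau>(N := t)"])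
        (use \<tau> step.hyps in \<open>auto simp: less_Suc_eq t_def\<close>)
    qed
    ultimately show ?thesis using v\<delta>' by blast
  qed
qed

section \<open>Lifting complex points through algebraic extensions\<close>

lemma ex_root:
  fixes a :: "nat \<Rightarrow> complex"
  assumes "0 < e" "a e \<noteq> 0"
  shows "\<exists>t. (\<Sum>i<Suc e. a i * t ^ i) = 0"
proof -
  define P where "P = (\<Sum>i<Suc e. monom (a i) i)"
  have peval: "poly P t = (\<Sum>i<Suc e. a i * t ^ i)" for t
    by (simp add: P_def poly_sum poly_monom del: sum.lessThan_Suc)
  have "coeff P e = a e"
    by (simp add: P_def coeff_sum)
  hence "degree P \<noteq> 0" using assms le_degree[of P e] by auto
  hence "\<not> constant (poly P)" by (simp add: constant_degree)
  thus ?thesis using fundamental_theorem_of_algebra[of P] peval by auto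
qed

text \<open>Each step asks for a root of the minimal relation at the point reached so far, so its
  leading coefficient must not vanish there. By \<open>dvs\<close> that coefficient divides a
  nonzero function of the first n entries alone, and the condition can be imposed on the given point
  in advance.\<close>

lemma lift_gen_point:
  assumes d: "integral_on S H N" and nN: "n \<le> N"
    and alg: "\<And>j. n \<le> j \<Longrightarrow> j < N \<Longrightarrow> \<not> transc S H j"
    and dvs: "\<And>j p. n \<le> j \<Longrightarrow> j \<le> N \<Longrightarrow> vars_below j p \<Longrightarrow> \<not> vanishes S H p \<Longrightarrow>
        \<exists>\<gamma> r. vars_below n \<gamma> \<and> vars_below j r \<and> \<not> vanishes S H \<gamma> \<and> (\<forall>x\<in>S. peval (H x) \<gamma> = peval (H x) p * peval (H x) r)"
  shows "\<exists>\<delta>. vars_below n \<delta> \<and> \<not> vanishes S H \<delta> \<and> (\<forall>\<tau>::nat \<Rightarrow> complex. gen_point S H n \<tau> \<longrightarrow> peval \<tau> \<delta> \<noteq> 0 \<longrightarrow>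
     (\<exists>\<tau>'. gen_point S H N \<tau>' \<and> (\<forall>i<n. \<tau>' i = \<tau> i)))"
  using nN d alg dvs
proof (induction N rule: dec_induct)
  case base
  show ?case by (rule exI[of _ "Cst 1"]) (use base in \<open>auto simp: vanishes_def integral_on_def\<close>)
next
  case (step N)
  obtain \<delta> where \<delta>: "vars_below n \<delta>" "\<not> vanishes S H \<delta>" and
    ex: "\<And>\<tau>::nat \<Rightarrow> complex. gen_point S H n \<tau> \<Longrightarrow> peval \<tau> \<delta> \<noteq> 0 \<Longrightarrow>
     (\<exists>\<tau>'. gen_point S H N \<tau>' \<and> (\<forall>i<n. \<tau>' i = \<tau> i))"
    using step.IH integral_on_mono[OF step.prems(1), of N] step.prems by auto
  obtain e q where m: "min_relation S H N e q"
    using ex_min_relation[OF step.prems(2)[of N]] step.hyps by auto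
  have vq: "vars_below N (q e)" and nq: "\<not> vanishes S H (q e)" using m by (auto simp: min_relation_def relation_def)
  obtain \<gamma> r where \<gamma>: "vars_below n \<gamma>" "vars_below N r" "\<not> vanishes S H \<gamma>"
      "\<forall>x\<in>S. peval (H x) \<gamma> = peval (H x) (q e) * peval (H x) r"
    using step.prems(3)[OF _ _ vq nq] step.hyps by auto
  have "\<not> vanishes S H (Mul \<delta> \<gamma>)"
    using \<delta> \<gamma> integral_on_mono[OF step.prems(1), of n] step.hyps by (intro integral_on_mult) auto
  moreover have "\<exists>\<tau>'. gen_point S H (Suc N) \<tau>' \<and> (\<forall>i<n. \<tau>' i = \<tau> i)"
    if \<tau>: "gen_point S H n \<tau>" "peval \<tau> (Mul \<delta> \<gamma>) \<noteq> 0" for \<tau> :: "nat \<Rightarrow> complex"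
  proof -
    obtain \<tau>' where \<tau>': "gen_point S H N \<tau>'" "\<forall>i<n. \<tau>' i = \<tau> i" using ex[of \<tau>] \<tau> by auto
    \<comment> \<open>The identity \<gamma> = q_e r holds on S, hence at \<tau>'. As \<gamma> sees
      only the first n entries, its nonvanishing at \<tau> passes to q_e at \<tau>'.\<close>
    have "vanishes S H (Add \<gamma> (Mul (Cst (-1)) (Mul (q e) r)))" using \<gamma> by (auto simp: vanishes_def)
    moreover have "vars_below N (Add \<gamma> (Mul (Cst (-1)) (Mul (q e) r)))"
      using \<gamma>(1,2) vq step.hyps(1) vars_below_mono[of n \<gamma> N] by simp
    ultimately have "peval \<tau>' (Add \<gamma> (Mul (Cst (-1)) (Mul (q e) r))) = 0"
      using \<tau>'(1) unfolding gen_point_def by blast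
    moreover have "peval \<tau>' \<gamma> = peval \<tau> \<gamma>" using \<tau>' \<gamma>(1) by (intro peval_cong) auto
    ultimately have nz: "peval \<tau>' (q e) \<noteq> 0" using \<tau>(2) by auto
    obtain t where t: "(\<Sum>i<Suc e. peval \<tau>' (q i) * t ^ i) = 0"
      using ex_root[of e "\<lambda>i. peval \<tau>' (q i)"] nz min_relation_pos[OF m] by auto
    have "gen_point S H (Suc N) (\<tau>'(N := t))" by (rule ext_alg[OF m \<tau>'(1) _ t]) (use nz in auto)
    thus ?thesis by (intro exI[of _ "\<tau>'(N := t)"]) (use \<tau>' step.hyps in auto)
  qed
  ultimately show ?case using \<delta> \<gamma> by (intro exI[of _ "Mul \<delta> \<gamma>"]) auto
qed

section \<open>Polynomial and rational functions\<close>

lemma is_poly_sum: "(\<And>i. i \<in> A \<Longrightarrow> is_poly (f i)) \<Longrightarrow> is_poly (\<lambda>x. \<Sum>i\<in>A. f i x)"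
proof (induction A rule: infinite_finite_induct)
  case (insert a A)
  have "is_poly (\<lambda>x. f a x + (\<Sum>i\<in>A. f i x))" by (intro is_poly.add insert) auto
  thus ?case using insert by simp
qed (auto intro: is_poly.const)

lemma is_poly_prod: "(\<And>i. i \<in> A \<Longrightarrow> is_poly (f i)) \<Longrightarrow> is_poly (\<lambda>x. \<Prod>i\<in>A. f i x)"
proof (induction A rule: infinite_finite_induct)
  case (insert a A)
  have "is_poly (\<lambda>x. f a x * (\<Prod>i\<in>A. f i x))" by (intro is_poly.mult insert) auto
  thus ?case using insert by simp
qed (auto intro: is_poly.const)

lemma is_poly_power: "is_poly f \<Longrightarrow> is_poly (\<lambda>x. f x ^ n)"
  using is_poly_prod[of "{..<n}" "\<lambda>_. f"] by simp

lemma is_poly_uminus: "is_poly f \<Longrightarrow> is_poly (\<lambda>x. - f x)"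
  using is_poly.mult[OF is_poly.const[of "-1"], of f] by simp

lemma is_poly_diff: "is_poly f \<Longrightarrow> is_poly g \<Longrightarrow> is_poly (\<lambda>x. f x - g x)"
  using is_poly.add[OF _ is_poly_uminus, of f g] by simp

lemma is_poly_det:
  "(\<And>i j. is_poly (\<lambda>x. A x $ i $ j)) \<Longrightarrow> is_poly (\<lambda>x. det (A x :: complex^'m^'m))"
  unfolding det_def by (intro is_poly_sum is_poly.mult is_poly.const is_poly_prod) auto

lemmas is_poly_intros = is_poly.const is_poly.coord is_poly.add is_poly.mult is_poly_sum is_poly_prod
  is_poly_power is_poly_uminus is_poly_diff

lemma is_poly_comp: "is_poly f \<Longrightarrow> (\<And>i. is_poly (\<lambda>x. g x $ i)) \<Longrightarrow> is_poly (\<lambda>x. f (g x))"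
  by (induction rule: is_poly.induct) (auto intro: is_poly_intros)

lemma is_poly_continuous: "is_poly f \<Longrightarrow> continuous_on A f"
  by (induction rule: is_poly.induct) (auto intro!: continuous_intros)

section \<open>Coordinates of vectors as numbered slots\<close>

definition index :: "'n::finite \<Rightarrow> nat" where
  "index = (SOME f. bij_betw f UNIV {..<CARD('n)})"

lemma bij_index: "bij_betw (index :: 'n::finite \<Rightarrow> nat) UNIV {..<CARD('n)}"
proof -
  have "\<exists>f. bij_betw f (UNIV :: 'n set) {..<CARD('n)}"
    using ex_bij_betw_finite_nat[of "UNIV :: 'n set"] by (auto simp: atLeast0LessThan)
  from someI_ex[OF this] show ?thesis unfolding index_def .
qed

lemma index_less [simp]: "index (a :: 'n::finite) < CARD('n)"
  using bij_index bij_betwE by blast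

lemma inj_index: "inj (index :: 'n::finite \<Rightarrow> nat)"
  using bij_index by (auto simp: bij_betw_def)

definition coord_at :: "nat \<Rightarrow> 'n::finite" where "coord_at = inv index"

lemma coord_at_index [simp]: "coord_at (index a) = a"
  unfolding coord_at_def by (rule inv_f_f[OF inj_index])

lemma index_coord_at: "i < CARD('n) \<Longrightarrow> index (coord_at i :: 'n::finite) = i"
  unfolding coord_at_def using bij_index by (intro f_inv_into_f) (auto simp: bij_betw_def)

definition vec_at :: "nat \<Rightarrow> (nat \<Rightarrow> complex) \<Rightarrow> complex^'n" where
  "vec_at m \<rho> = (\<chi> a. \<rho> (m + index a))"

lemma vec_at_nth [simp]: "vec_at m \<rho> $ a = \<rho> (m + index a)"
  by (simp add: vec_at_def)

lemma ex_pexp: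
  fixes f :: "complex^'n \<Rightarrow> complex"
  assumes "is_poly f"
  shows "\<exists>p. vars_below CARD('n) p \<and> (\<forall>\<rho>. peval \<rho> p = f (vec_at 0 \<rho>))"
  using assms
proof (induction rule: is_poly.induct)
  case (const c) show ?case by (rule exI[of _ "Cst c"]) auto
next
  case (coord i) show ?case by (rule exI[of _ "Var (index i)"]) auto
next
  case (add f g)
  then obtain p q where "vars_below CARD('n) p \<and> (\<forall>\<rho>. peval \<rho> p = f (vec_at 0 \<rho>))"
    "vars_below CARD('n) q \<and> (\<forall>\<rho>. peval \<rho> q = g (vec_at 0 \<rho>))" by blast
  then show ?case by (intro exI[of _ "Add p q"]) auto
next
  case (mult f g)
  then obtain p q where "vars_below CARD('n) p \<and> (\<forall>\<rho>. peval \<rho> p = f (vec_at 0 \<rho>))"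
    "vars_below CARD('n) q \<and> (\<forall>\<rho>. peval \<rho> q = g (vec_at 0 \<rho>))" by blast
  then show ?case by (intro exI[of _ "Mul p q"]) auto
qed

text \<open>A chosen expression for f that reads its argument from slot m onwards, so that several
  vectors can share one assignment.\<close>

definition pexp_at :: "nat \<Rightarrow> (complex^'n \<Rightarrow> complex) \<Rightarrow> pexp" where
  "pexp_at m f = psubst (\<lambda>i. Var (m + i)) (SOME p. vars_below CARD('n) p \<and> (\<forall>\<rho>. peval \<rho> p = f (vec_at 0 \<rho>)))"

lemma pexp_at:
  fixes f :: "complex^'n \<Rightarrow> complex"
  assumes "is_poly f"
  shows vars_below_pexp_at: "m + CARD('n) \<le> k \<Longrightarrow> vars_below k (pexp_at m f)" and peval_pexp_at: "peval \<rho> (pexp_at m f) = f (vec_at m \<rho>)"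
proof -
  define p where "p = (SOME p. vars_below CARD('n) p \<and> (\<forall>\<rho>. peval \<rho> p = f (vec_at 0 \<rho>)))"
  have p: "vars_below CARD('n) p" "\<And>\<rho>. peval \<rho> p = f (vec_at 0 \<rho>)"
    using someI_ex[OF ex_pexp[OF assms], folded p_def] by auto
  show "vars_below k (pexp_at m f)" if "m + CARD('n) \<le> k"
    unfolding pexp_at_def p_def[symmetric] using that by (intro vars_below_psubst[OF p(1)]) auto
  have "peval \<rho> (pexp_at m f) = f (vec_at 0 (\<lambda>i. \<rho> (m + i)))"
    unfolding pexp_at_def p_def[symmetric] by (simp add: peval_psubst p(2))
  also have "vec_at 0 (\<lambda>i. \<rho> (m + i)) = (vec_at m \<rho> :: complex^'n)"
    by (simp add: vec_at_def)
  finally show "peval \<rho> (pexp_at m f) = f (vec_at m \<rho>)" .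
qed

text \<open>Evaluation at a dual point is a first order expansion: the eps part is the derivative
  along the line through the complex part. This links algebraic tangent vectors with
  \<open>dir_deriv\<close>.\<close>

lemma dual_has_deriv:
  "((\<lambda>s. peval (\<lambda>i. dre (\<rho> i) + s * deps (\<rho> i)) p) has_field_derivative deps (peval \<rho> p)) (at 0)"
proof (induction p)
  case (Mul p q)
  show ?case using DERIV_mult[OF Mul] by (simp add: dre_peval algebra_simps)
qed (auto intro!: derivative_eq_intros)

lemma deps_pexp_at:
  assumes "is_poly f"
  shows "deps (peval \<rho> (pexp_at m f)) = dir_deriv f (vec_at m (\<lambda>i. dre (\<rho> i))) (vec_at m (\<lambda>i. deps (\<rho> i)))"
proof -
  have "(\<lambda>s. peval (\<lambda>i. dre (\<rho> i) + s * deps (\<rho> i)) (pexp_at m f)) =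
     (\<lambda>s. f (vec_at m (\<lambda>i. dre (\<rho> i)) + s *s vec_at m (\<lambda>i. deps (\<rho> i))))"
    by (intro ext, subst peval_pexp_at[OF assms], intro arg_cong[of _ _ f]) (simp add: vec_eq_iff)
  thus ?thesis unfolding dir_deriv_def using dual_has_deriv[of \<rho> "pexp_at m f"] by (simp add: DERIV_imp_deriv)
qed

lemma pairing_add_left: "pairing (u + v) p = pairing u p + pairing v p"
  and pairing_add_right: "pairing u (p + q) = pairing u p + pairing u q"
  and pairing_scale_left: "pairing (c *s u) p = c * pairing u p"
  and pairing_scale_right: "pairing u (c *s p) = c * pairing u p"
  and pairing_diff_left: "pairing (u - v) p = pairing u p - pairing v p"
  and pairing_diff_right: "pairing u (p - q) = pairing u p - pairing u q"
  and pairing_0 [simp]: "pairing 0 p = 0" "pairing u 0 = 0"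
  by (simp_all add: pairing_def algebra_simps sum.distrib sum_distrib_left sum_subtractf)

lemma pairing_commute: "pairing u p = pairing p u"
  by (simp add: pairing_def mult.commute)

lemma pairing_sum_left: "pairing (sum f A) p = (\<Sum>i\<in>A. pairing (f i) p)"
  by (induction A rule: infinite_finite_induct) (auto simp: pairing_add_left)

lemma pairing_sum_right: "pairing p (sum f A) = (\<Sum>i\<in>A. pairing p (f i))"
  by (induction A rule: infinite_finite_induct) (auto simp: pairing_add_right)

lemma pairing_axis [simp]: "pairing u (axis i 1) = u $ i" "pairing (axis i 1) u = u $ i"
  by (auto simp: pairing_def axis_def if_distrib[of "\<lambda>x. _ * x"] if_distrib[of "\<lambda>x. x * _"] cong: if_cong)

text \<open>Given by closure rules, so that derivatives and composites are handled by induction;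
  \<open>rational_on_numden\<close> recovers a single quotient of polynomials. Rule
  \<open>cong\<close> disregards values outside D.\<close>

inductive rational_on :: "(complex^'n) set \<Rightarrow> (complex^'n \<Rightarrow> complex) \<Rightarrow> bool" for D where
  const: "rational_on D (\<lambda>x. c)"
| coord: "rational_on D (\<lambda>x. x $ i)"
| add: "rational_on D f \<Longrightarrow> rational_on D g \<Longrightarrow> rational_on D (\<lambda>x. f x + g x)"
| mult: "rational_on D f \<Longrightarrow> rational_on D g \<Longrightarrow> rational_on D (\<lambda>x. f x * g x)"
| inv: "rational_on D f \<Longrightarrow> (\<forall>x\<in>D. f x \<noteq> 0) \<Longrightarrow> rational_on D (\<lambda>x. inverse (f x))"
| cong: "rational_on D f \<Longrightarrow> (\<forall>x\<in>D. f x = g x) \<Longrightarrow> rational_on D g"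

lemma rational_on_subset: "rational_on D f \<Longrightarrow> D' \<subseteq> D \<Longrightarrow> rational_on D' f"
proof (induction rule: rational_on.induct)
  case (cong f g)
  show ?case by (rule rational_on.cong[OF cong.IH[OF cong.prems]]) (use cong in auto)
qed (auto intro!: rational_on.const rational_on.coord rational_on.add rational_on.mult rational_on.inv)

lemma rational_on_sum: "(\<And>i. i \<in> A \<Longrightarrow> rational_on D (f i)) \<Longrightarrow> rational_on D (\<lambda>x. \<Sum>i\<in>A. f i x)"
proof (induction A rule: infinite_finite_induct)
  case (insert a A)
  have "rational_on D (\<lambda>x. f a x + (\<Sum>i\<in>A. f i x))" by (intro rational_on.add insert) auto
  thus ?case using insert by simp
qed (auto intro: rational_on.const)

lemma rational_on_prod: "(\<And>i. i \<in> A \<Longrightarrow> rational_on D (f i)) \<Longrightarrow> rational_on D (\<lambda>x. \<Prod>i\<in>A. f i x)"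
proof (induction A rule: infinite_finite_induct)
  case (insert a A)
  have "rational_on D (\<lambda>x. f a x * (\<Prod>i\<in>A. f i x))" by (intro rational_on.mult insert) auto
  thus ?case using insert by simp
qed (auto intro: rational_on.const)

lemma rational_on_det:
  "(\<And>i j. rational_on D (\<lambda>x. A x $ i $ j)) \<Longrightarrow> rational_on D (\<lambda>x. det (A x :: complex^'m^'m))"
  unfolding det_def by (intro rational_on_sum rational_on.mult rational_on.const rational_on_prod) auto

lemma rational_on_uminus: "rational_on D f \<Longrightarrow> rational_on D (\<lambda>x. - f x)"
  using rational_on.mult[OF rational_on.const[of _ "-1"], of D f] by simp

lemma rational_on_diff: "rational_on D f \<Longrightarrow> rational_on D g \<Longrightarrow> rational_on D (\<lambda>x. f x - g x)"
  using rational_on.add[OF _ rational_on_uminus, of D f g] by simp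

lemma rational_on_divide: "rational_on D f \<Longrightarrow> rational_on D g \<Longrightarrow> (\<forall>x\<in>D. g x \<noteq> 0) \<Longrightarrow> rational_on D (\<lambda>x. f x / g x)"
  unfolding divide_inverse by (intro rational_on.mult rational_on.inv)

lemma is_poly_rational_on_comp: "is_poly f \<Longrightarrow> (\<And>i. rational_on D (\<lambda>x. g x $ i)) \<Longrightarrow> rational_on D (\<lambda>x. f (g x))"
  by (induction rule: is_poly.induct) (auto intro: rational_on.const rational_on.add rational_on.mult)

lemma is_poly_rational_on: "is_poly f \<Longrightarrow> rational_on D f"
  by (rule is_poly_rational_on_comp[of f D "\<lambda>x. x"]) (auto intro: rational_on.coord)

lemma rational_on_numden:
  assumes "rational_on D f"
  shows "\<exists>p q. is_poly p \<and> is_poly q \<and> (\<forall>x\<in>D. q x \<noteq> 0 \<and> f x = p x / q x)"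
  using assms
proof (induction rule: rational_on.induct)
  case (const c) show ?case by (intro exI[of _ "\<lambda>x. c"] exI[of _ "\<lambda>x. 1"]) (auto intro: is_poly_intros)
next
  case (coord i) show ?case by (intro exI[of _ "\<lambda>x. x $ i"] exI[of _ "\<lambda>x. 1"]) (auto intro: is_poly_intros)
next
  case (add f g)
  then obtain p q p' q' where "is_poly p \<and> is_poly q \<and> (\<forall>x\<in>D. q x \<noteq> 0 \<and> f x = p x / q x)"
   "is_poly p' \<and> is_poly q' \<and> (\<forall>x\<in>D. q' x \<noteq> 0 \<and> g x = p' x / q' x)" by blast
  then show ?case
    by (intro exI[of _ "\<lambda>x. p x * q' x + p' x * q x"] exI[of _ "\<lambda>x. q x * q' x"])
       (auto intro: is_poly_intros simp: add_frac_eq)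
next
  case (mult f g)
  then obtain p q p' q' where "is_poly p \<and> is_poly q \<and> (\<forall>x\<in>D. q x \<noteq> 0 \<and> f x = p x / q x)"
   "is_poly p' \<and> is_poly q' \<and> (\<forall>x\<in>D. q' x \<noteq> 0 \<and> g x = p' x / q' x)" by blast
  then show ?case
    by (intro exI[of _ "\<lambda>x. p x * p' x"] exI[of _ "\<lambda>x. q x * q' x"])
       (auto intro: is_poly_intros)
next
  case (inv f)
  then obtain p q where "is_poly p \<and> is_poly q \<and> (\<forall>x\<in>D. q x \<noteq> 0 \<and> f x = p x / q x)" by blast
  then show ?case using inv(2)
    by (intro exI[of _ q] exI[of _ p]) auto
next
  case (cong f g) then show ?case by simp
qed

lemma open_line_nhds:
  fixes x v :: "complex^'n"
  assumes "open D" "x \<in> D"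
  shows "eventually (\<lambda>s. x + s *s v \<in> D) (nhds 0)"
proof -
  have "(\<lambda>s::complex. x + s *s v) = (\<lambda>s. \<chi> i. x $ i + s * v $ i)"
    by (simp add: vec_eq_iff fun_eq_iff)
  hence c: "continuous_on UNIV (\<lambda>s::complex. x + s *s v)"
    by (simp only:) (intro continuous_on_vec_lambda continuous_intros)
  have "open ((\<lambda>s::complex. x + s *s v) -` D)"
    by (rule open_vimage[OF assms(1) c])
  moreover have "0 \<in> (\<lambda>s::complex. x + s *s v) -` D" using assms by simp
  ultimately have "eventually (\<lambda>s. s \<in> (\<lambda>s::complex. x + s *s v) -` D) (nhds 0)"
    by (rule eventually_nhds_in_open)
  thus ?thesis by simp
qed

text \<open>The partial derivatives are produced together with the derivative, rational on the same
  D, so that they can be differentiated again. Openness of D lets rule \<open>cong\<close> pass to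
  derivatives.\<close>

lemma rational_on_deriv:
  assumes "rational_on D f" "open D"
  shows "\<exists>G. (\<forall>i. rational_on D (G i)) \<and> (\<forall>x\<in>D. \<forall>v.
     ((\<lambda>s. f (x + s *s v)) has_field_derivative (\<Sum>i\<in>UNIV. G i x * v $ i)) (at 0))"
  using assms(1)
proof (induction rule: rational_on.induct)
  case (const c)
  show ?case by (rule exI[of _ "\<lambda>i x. 0"]) (auto intro: rational_on.const)
next
  case (coord j)
  have "(\<Sum>i\<in>UNIV. (if i = j then 1 else 0) * v $ i) = v $ j" for v :: "complex^'a"
    by (simp add: if_distrib[of "\<lambda>x. x * _"] cong: if_cong)
  then show ?case by (intro exI[of _ "\<lambda>i x. if i = j then 1 else 0"])
    (auto intro!: rational_on.const derivative_eq_intros)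
next
  case (add f g)
  then obtain G G' where G: "\<And>i. rational_on D (G i)" "\<And>i. rational_on D (G' i)"
   "\<And>x v. x \<in> D \<Longrightarrow> ((\<lambda>s. f (x + s *s v)) has_field_derivative (\<Sum>i\<in>UNIV. G i x * v $ i)) (at 0)"
   "\<And>x v. x \<in> D \<Longrightarrow> ((\<lambda>s. g (x + s *s v)) has_field_derivative (\<Sum>i\<in>UNIV. G' i x * v $ i)) (at 0)" by blast
  show ?case
    by (rule exI[of _ "\<lambda>i x. G i x + G' i x"])
       (auto intro!: rational_on.add G derivative_eq_intros simp: algebra_simps sum.distrib)
next
  case (mult f g)
  then obtain G G' where G: "\<And>i. rational_on D (G i)" "\<And>i. rational_on D (G' i)"
   "\<And>x v. x \<in> D \<Longrightarrow> ((\<lambda>s. f (x + s *s v)) has_field_derivative (\<Sum>i\<in>UNIV. G i x * v $ i)) (at 0)"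
   "\<And>x v. x \<in> D \<Longrightarrow> ((\<lambda>s. g (x + s *s v)) has_field_derivative (\<Sum>i\<in>UNIV. G' i x * v $ i)) (at 0)" by blast
  show ?case
  proof (intro exI[of _ "\<lambda>i x. f x * G' i x + G i x * g x"] conjI allI ballI)
    fix x v assume x: "x \<in> D"
    show "((\<lambda>s. f (x + s *s v) * g (x + s *s v)) has_field_derivative
       (\<Sum>i\<in>UNIV. (f x * G' i x + G i x * g x) * v $ i)) (at 0)"
      by (rule derivative_eq_intros G(3)[OF x] G(4)[OF x] refl)+
         (simp add: algebra_simps sum.distrib sum_distrib_left)
  qed (intro rational_on.add rational_on.mult G mult.hyps)
next
  case (inv f)
  then obtain G where G: "\<And>i. rational_on D (G i)"
   "\<And>x v. x \<in> D \<Longrightarrow> ((\<lambda>s. f (x + s *s v)) has_field_derivative (\<Sum>i\<in>UNIV. G i x * v $ i)) (at 0)" by blast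
  show ?case
  proof (intro exI[of _ "\<lambda>i x. - (inverse (f x) * G i x * inverse (f x))"] conjI allI ballI)
    fix x v assume x: "x \<in> D"
    show "((\<lambda>s. inverse (f (x + s *s v))) has_field_derivative
       (\<Sum>i\<in>UNIV. - (inverse (f x) * G i x * inverse (f x)) * v $ i)) (at 0)"
      by (rule derivative_eq_intros G(2)[OF x] refl)+
         (use inv x in \<open>auto simp: algebra_simps sum_distrib_left sum_negf\<close>)
  qed (intro rational_on_uminus rational_on.inv rational_on.mult G inv.hyps)
next
  case (cong f g)
  then obtain G where G: "\<And>i. rational_on D (G i)"
   "\<And>x v. x \<in> D \<Longrightarrow> ((\<lambda>s. f (x + s *s v)) has_field_derivative (\<Sum>i\<in>UNIV. G i x * v $ i)) (at 0)" by blast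
  show ?case
  proof (intro exI[of _ G] conjI allI ballI G)
    fix x v assume x: "x \<in> D"
    have "eventually (\<lambda>s. f (x + s *s v) = g (x + s *s v)) (nhds 0)"
      using open_line_nhds[OF assms(2) x, of v] by eventually_elim (use cong in auto)
    thus "((\<lambda>s. g (x + s *s v)) has_field_derivative (\<Sum>i\<in>UNIV. G i x * v $ i)) (at 0)"
      using G(2)[OF x, of v] DERIV_cong_ev[OF refl _ refl, of "\<lambda>s. f (x + s *s v)" "\<lambda>s. g (x + s *s v)" 0] by simp
  qed
qed

definition grad :: "(complex^'n \<Rightarrow> complex) \<Rightarrow> complex^'n \<Rightarrow> complex^'n" where
  "grad f x = (\<chi> i. dir_deriv f x (axis i 1))"

context
  fixes D :: "(complex^'n) set" and f :: "complex^'n \<Rightarrow> complex"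
  assumes r: "rational_on D f" and o: "open D"
begin

lemma rational_on_has_deriv:
  assumes "x \<in> D"
  shows "((\<lambda>s. f (x + s *s v)) has_field_derivative dir_deriv f x v) (at 0)"
proof -
  obtain G where "\<And>x v. x \<in> D \<Longrightarrow> ((\<lambda>s. f (x + s *s v)) has_field_derivative (\<Sum>i\<in>UNIV. G i x * v $ i)) (at 0)"
    using rational_on_deriv[OF r o] by blast
  from this[OF assms, of v] show ?thesis unfolding dir_deriv_def by (simp add: DERIV_imp_deriv)
qed

lemma dir_deriv_grad:
  assumes "x \<in> D"
  shows "dir_deriv f x v = pairing (grad f x) v"
proof -
  obtain G where G: "\<And>i. rational_on D (G i)" "\<And>x v. x \<in> D \<Longrightarrow> ((\<lambda>s. f (x + s *s v)) has_field_derivative (\<Sum>i\<in>UNIV. G i x * v $ i)) (at 0)"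
    using rational_on_deriv[OF r o] by blast
  have e: "dir_deriv f x v = (\<Sum>i\<in>UNIV. G i x * v $ i)" for v
    unfolding dir_deriv_def by (rule DERIV_imp_deriv[OF G(2)[OF assms]])
  hence "dir_deriv f x v = pairing (\<chi> i. G i x) v" for v by (simp add: pairing_def)
  hence "grad f x = (\<chi> i. G i x)" by (simp add: grad_def vec_eq_iff)
  thus ?thesis by (simp add: e pairing_def)
qed

lemma rational_on_dir_deriv: "rational_on D (\<lambda>x. dir_deriv f x v)"
proof -
  obtain G where G: "\<And>i. rational_on D (G i)" "\<And>x v. x \<in> D \<Longrightarrow> ((\<lambda>s. f (x + s *s v)) has_field_derivative (\<Sum>i\<in>UNIV. G i x * v $ i)) (at 0)"
    using rational_on_deriv[OF r o] by blast
  have e: "dir_deriv f x v = (\<Sum>i\<in>UNIV. G i x * v $ i)" if "x \<in> D" for x v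
    unfolding dir_deriv_def by (rule DERIV_imp_deriv[OF G(2)[OF that]])
  have "rational_on D (\<lambda>x. \<Sum>i\<in>UNIV. G i x * v $ i)" by (intro rational_on_sum rational_on.mult G rational_on.const)
  thus ?thesis by (rule rational_on.cong) (simp add: e)
qed

lemma rational_on_continuous: "continuous_on D f"
  using r
proof (induction rule: rational_on.induct)
  case (cong f g) thus ?case using continuous_on_eq[of D f g] by auto
qed (auto intro!: continuous_intros)

end

lemma dir_deriv_cong_open:
  assumes "open D" "x \<in> D" "\<And>y. y \<in> D \<Longrightarrow> f y = g y"
  shows "dir_deriv f x v = dir_deriv g x v"
  unfolding dir_deriv_def
proof (rule deriv_cong_ev)
  show "eventually (\<lambda>s. f (x + s *s v) = g (x + s *s v)) (nhds 0)"
    using open_line_nhds[OF assms(1,2), of v] by eventually_elim (use assms in auto)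
qed simp

lemma dir_deriv_const [simp]: "dir_deriv (\<lambda>x. c) x v = 0"
  by (simp add: dir_deriv_def)

lemma dir_deriv_coord [simp]: "dir_deriv (\<lambda>x. x $ i) x v = v $ i"
  unfolding dir_deriv_def by (rule DERIV_imp_deriv) (auto intro!: derivative_eq_intros)

context
  fixes D :: "(complex^'n) set" and f g :: "complex^'n \<Rightarrow> complex" and x :: "complex^'n"
  assumes r: "rational_on D f" "rational_on D g" and o: "open D" and x: "x \<in> D"
begin

lemma dir_deriv_add: "dir_deriv (\<lambda>x. f x + g x) x v = dir_deriv f x v + dir_deriv g x v"
  unfolding dir_deriv_def[of "\<lambda>x. f x + g x"]
  by (rule DERIV_imp_deriv) (intro DERIV_add rational_on_has_deriv[OF r(1) o x] rational_on_has_deriv[OF r(2) o x])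

lemma dir_deriv_mult: "dir_deriv (\<lambda>x. f x * g x) x v = dir_deriv f x v * g x + dir_deriv g x v * f x"
  unfolding dir_deriv_def[of "\<lambda>x. f x * g x"]
  by (rule DERIV_imp_deriv)
     (use DERIV_mult[OF rational_on_has_deriv[OF r(1) o x] rational_on_has_deriv[OF r(2) o x]] in simp)

end

lemma dir_deriv_inverse:
  assumes "rational_on D f" "open D" "x \<in> D" "f x \<noteq> 0"
  shows "dir_deriv (\<lambda>x. inverse (f x)) x v = - (dir_deriv f x v * (inverse (f x) * inverse (f x)))"
  unfolding dir_deriv_def[of "\<lambda>x. inverse (f x)"]
proof (rule DERIV_imp_deriv)
  show "((\<lambda>s. inverse (f (x + s *s v))) has_field_derivative
      - (dir_deriv f x v * (inverse (f x) * inverse (f x)))) (at 0)"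
    using DERIV_inverse_fun[OF rational_on_has_deriv[OF assms(1-3), of v]] assms(4)
    by (simp add: power2_eq_square divide_inverse)
qed

text \<open>By structural induction: the product and reciprocal rules yield expressions symmetric in
  v and w once the second derivatives of the constituents are.\<close>

lemma dir_deriv_symmetric:
  assumes "rational_on D f" and o: "open D" and "x \<in> D"
  shows "dir_deriv (\<lambda>y. dir_deriv f y v) x w = dir_deriv (\<lambda>y. dir_deriv f y w) x v"
  using assms(1,3)
proof (induction arbitrary: x rule: rational_on.induct)
  case (const c) then show ?case by simp
next
  case (coord i) then show ?case by simp
next
  case (add f g)
  have "dir_deriv (\<lambda>y. dir_deriv (\<lambda>x. f x + g x) y v) x w
      = dir_deriv (\<lambda>y. dir_deriv f y v) x w + dir_deriv (\<lambda>y. dir_deriv g y v) x w" for v w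
    by (subst dir_deriv_cong_open[OF o add.prems dir_deriv_add[OF add.hyps o]], assumption)
       (rule dir_deriv_add[OF rational_on_dir_deriv rational_on_dir_deriv]; (fact add.hyps o add.prems))
  then show ?case using add by simp
next
  case (mult f g)
  note h = mult.hyps
  have "dir_deriv (\<lambda>y. dir_deriv (\<lambda>x. f x * g x) y v) x w
      = dir_deriv (\<lambda>y. dir_deriv f y v) x w * g x + dir_deriv g x w * dir_deriv f x v
      + (dir_deriv (\<lambda>y. dir_deriv g y v) x w * f x + dir_deriv f x w * dir_deriv g x v)" for v w
    apply (subst dir_deriv_cong_open[OF o mult.prems dir_deriv_mult[OF h o]], assumption)
    apply (subst dir_deriv_add[OF rational_on.mult rational_on.mult o mult.prems], (intro h rational_on_dir_deriv o)+)
    apply (subst dir_deriv_mult[OF rational_on_dir_deriv _ o mult.prems], (intro h o)+)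
    apply (subst dir_deriv_mult[OF rational_on_dir_deriv _ o mult.prems], (intro h o)+)
    by simp
  then show ?case using mult by simp
next
  case (inv f)
  note h = inv.hyps(1)
  have i: "rational_on D (\<lambda>x. inverse (f x))" by (rule rational_on.inv[OF inv.hyps])
  have "dir_deriv (\<lambda>y. dir_deriv (\<lambda>x. inverse (f x)) y v) x w
      = - (dir_deriv (\<lambda>y. dir_deriv f y v) x w * (inverse (f x) * inverse (f x))
       + 2 * dir_deriv (\<lambda>x. inverse (f x)) x w * inverse (f x) * dir_deriv f x v)" for v w
  proof -
    have "dir_deriv (\<lambda>y. dir_deriv (\<lambda>x. inverse (f x)) y v) x w
      = dir_deriv (\<lambda>y. (-1) * (dir_deriv f y v * (inverse (f y) * inverse (f y)))) x w"
      by (rule dir_deriv_cong_open[OF o inv.prems])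
         (use dir_deriv_inverse[OF h o] inv.hyps(2) in simp)
    also have "\<dots> = - dir_deriv (\<lambda>y. dir_deriv f y v * (inverse (f y) * inverse (f y))) x w"
      by (subst dir_deriv_mult[OF rational_on.const rational_on.mult o inv.prems], (intro rational_on.mult i rational_on_dir_deriv h o)+) simp
    also have "\<dots> = - (dir_deriv (\<lambda>y. dir_deriv f y v) x w * (inverse (f x) * inverse (f x))
       + 2 * dir_deriv (\<lambda>x. inverse (f x)) x w * inverse (f x) * dir_deriv f x v)"
      apply (subst dir_deriv_mult[OF rational_on_dir_deriv rational_on.mult o inv.prems], (intro rational_on.mult i h o)+)
      apply (subst dir_deriv_mult[OF i i o inv.prems])
      by (simp add: algebra_simps)
    finally show ?thesis .
  qed
  note e = this
  show ?case unfolding e inv.IH[OF inv.prems]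
    using dir_deriv_inverse[OF h o inv.prems] inv.hyps(2) inv.prems by simp
next
  case (cong f g)
  have "dir_deriv (\<lambda>y. dir_deriv g y v) x w = dir_deriv (\<lambda>y. dir_deriv f y v) x w" for v w
    by (rule dir_deriv_cong_open[OF o cong.prems], rule dir_deriv_cong_open[OF o]) (use cong in auto)
  then show ?case using cong by simp
qed

lemma chain_rule:
  assumes F: "is_poly F" and P: "\<And>i. rational_on D (\<lambda>x. \<Psi> x $ i)" and o: "open D" and x: "x \<in> D"
  shows "dir_deriv (\<lambda>y. F (\<Psi> y)) x v = dir_deriv F (\<Psi> x) (\<chi> i. dir_deriv (\<lambda>y. \<Psi> y $ i) x v)"
  using F
proof (induction rule: is_poly.induct)
  case (add f g)
  show ?case
    by (subst dir_deriv_add[OF is_poly_rational_on_comp is_poly_rational_on_comp o x], (intro add.hyps P)+)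
       (subst dir_deriv_add[OF is_poly_rational_on is_poly_rational_on open_UNIV UNIV_I], (intro add)+, simp add: add)
next
  case (mult f g)
  show ?case
    by (subst dir_deriv_mult[OF is_poly_rational_on_comp is_poly_rational_on_comp o x], (intro mult.hyps P)+)
       (subst dir_deriv_mult[OF is_poly_rational_on is_poly_rational_on open_UNIV UNIV_I], (intro mult)+, simp add: mult)
qed auto

lemma poly_dir_deriv: "is_poly f \<Longrightarrow> dir_deriv f x v = pairing (grad f x) v"
  by (rule dir_deriv_grad[OF is_poly_rational_on open_UNIV UNIV_I])

lemma is_poly_dir_deriv: "is_poly f \<Longrightarrow> is_poly (\<lambda>x. dir_deriv f x v)"
proof (induction rule: is_poly.induct)
  case (add f g)
  have "dir_deriv (\<lambda>x. f x + g x) x v = dir_deriv f x v + dir_deriv g x v" for x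
    by (rule dir_deriv_add[OF is_poly_rational_on is_poly_rational_on open_UNIV UNIV_I]; fact add.hyps)
  thus ?case using add by (simp add: is_poly_intros)
next
  case (mult f g)
  have "dir_deriv (\<lambda>x. f x * g x) x v = dir_deriv f x v * g x + dir_deriv g x v * f x" for x
    by (rule dir_deriv_mult[OF is_poly_rational_on is_poly_rational_on open_UNIV UNIV_I]; fact mult.hyps)
  thus ?case using mult by (simp add: is_poly_intros)
qed (auto intro: is_poly_intros)

lemma is_poly_grad: "is_poly f \<Longrightarrow> is_poly (\<lambda>x. grad f x $ i)"
  unfolding grad_def using is_poly_dir_deriv by simp

text \<open>Reduces nonvanishing to one variable, where a nonzero polynomial has only finitely many
  zeros.\<close>

lemma poly_on_line:
  assumes "is_poly f"
  shows "\<exists>P. \<forall>s. f (x + s *s v) = poly P s"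
  using assms
proof (induction rule: is_poly.induct)
  case (const c) show ?case by (rule exI[of _ "[:c:]"]) auto
next
  case (coord i) show ?case by (rule exI[of _ "[:x $ i, v $ i:]"]) auto
next
  case (add f g)
  then obtain P Q where "\<forall>s. f (x + s *s v) = poly P s" "\<forall>s. g (x + s *s v) = poly Q s" by blast
  then show ?case by (intro exI[of _ "P + Q"]) auto
next
  case (mult f g)
  then obtain P Q where "\<forall>s. f (x + s *s v) = poly P s" "\<forall>s. g (x + s *s v) = poly Q s" by blast
  then show ?case by (intro exI[of _ "P * Q"]) auto
qed

lemma poly_common_nonzero:
  fixes P Q R :: "complex poly"
  assumes "poly P a \<noteq> 0" "poly Q b \<noteq> 0" "poly R c \<noteq> 0"
  shows "\<exists>s. poly P s \<noteq> 0 \<and> poly Q s \<noteq> 0 \<and> poly R s \<noteq> 0"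
proof -
  have "P * Q * R \<noteq> 0" using assms by auto
  hence "finite {s. poly (P * Q * R) s = 0}" by (rule poly_roots_finite)
  hence "{s. poly (P * Q * R) s = 0} \<noteq> UNIV" using infinite_UNIV_char_0[where 'a=complex] by metis
  thus ?thesis by auto
qed

section \<open>Tangent and conormal spaces\<close>

lemma mult_rows: "(\<chi> i. g i) *v v = (\<chi> i. pairing (g i) v)"
  by (simp add: vec_eq_iff matrix_vector_mult_def pairing_def)

text \<open>Evaluating the functionals embeds W into the coordinate space spanned by the axes of
  A.\<close>

lemma dim_le_card_functionals:
  fixes W :: "(complex^'n) set" and g :: "'m::finite \<Rightarrow> complex^'n"
  assumes W: "vec.subspace W" and inj: "\<And>v. v \<in> W \<Longrightarrow> (\<And>a. a \<in> A \<Longrightarrow> pairing (g a) v = 0) \<Longrightarrow> v = 0"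
  shows "vec.dim W \<le> card A"
proof -
  define f :: "complex^'n \<Rightarrow> complex^'m" where "f = (\<lambda>v. \<chi> a. pairing (if a \<in> A then g a else 0) v)"
  have lin: "Vector_Spaces.linear (*s) (*s) f" unfolding f_def mult_rows[symmetric] by (rule matrix_vector_mul_linear_gen)
  have "inj_on f W"
  proof (rule inj_onI)
    fix x y assume xy: "x \<in> W" "y \<in> W" "f x = f y"
    have "x - y = 0"
    proof (rule inj)
      show "x - y \<in> W" using xy W by (simp add: vec.subspace_diff)
      fix a assume "a \<in> A"
      thus "pairing (g a) (x - y) = 0" using xy(3) by (auto simp: f_def vec_eq_iff pairing_diff_right split: if_splits)
    qed
    thus "x = y" by simp
  qed
  hence "vec.dim W = vec.dim (f ` W)"
    using vec.dim_image_eq[OF lin, of W] vec.span_eq_iff[THEN iffD2, OF W] by simp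
  also have "\<dots> \<le> card ((\<lambda>a. axis a 1) ` A :: (complex^'m) set)"
  proof (rule vec.dim_le_card)
    show "f ` W \<subseteq> vec.span ((\<lambda>a. axis a 1) ` A)"
    proof
      fix y assume "y \<in> f ` W"
      then obtain v where v: "y = f v" by auto
      have "y = (\<Sum>a\<in>A. pairing (g a) v *s axis a 1)"
        by (simp add: v f_def vec_eq_iff axis_def if_distrib cong: if_cong)
      also have "\<dots> \<in> vec.span ((\<lambda>a. axis a 1) ` A)"
        by (intro vec.span_sum vec.span_scale vec.span_base) auto
      finally show "y \<in> vec.span ((\<lambda>a. axis a 1) ` A)" .
    qed
  qed simp
  also have "\<dots> \<le> card A" by (rule card_image_le) simp
  finally show ?thesis .
qed

text \<open>Independence is stated for an indexed family; two equal members would already violate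
  it, by the combination with coefficients 1 and -1.\<close>

lemma card_le_dim_family:
  fixes y :: "nat \<Rightarrow> complex^'n"
  assumes W: "vec.subspace W" and y: "\<And>i. i < k \<Longrightarrow> y i \<in> W"
    and ind: "\<And>l i. (\<Sum>j<k. l j *s y j) = 0 \<Longrightarrow> i < k \<Longrightarrow> l i = 0"
  shows "k \<le> vec.dim W"
proof -
  have inj: "inj_on y {..<k}"
  proof (rule inj_onI, rule ccontr)
    fix i j assume ij: "i \<in> {..<k}" "j \<in> {..<k}" "y i = y j" "i \<noteq> j"
    define l where "l m = (if m = i then 1 else if m = j then -1 else (0::complex))" for m
    have "(\<Sum>m<k. l m *s y m) = (\<Sum>m<k. (if m = i then y i else 0) + (if m = j then - y j else 0))"
      using ij by (intro sum.cong) (auto simp: l_def vec_eq_iff)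
    also have "\<dots> = y i - y j" using ij by (simp add: sum.distrib)
    finally have "l i = 0" using ij by (intro ind[of l i]) auto
    thus False by (simp add: l_def)
  qed
  have "vec.independent (y ` {..<k})"
    unfolding vec.independent_explicit
  proof (intro conjI allI impI ballI)
    fix c v assume c: "(\<Sum>v\<in>y ` {..<k}. c v *s v) = 0" and v: "v \<in> y ` {..<k}"
    have "(\<Sum>j<k. c (y j) *s y j) = 0" using c by (simp add: sum.reindex[OF inj])
    thus "c v = 0" using v ind[of "\<lambda>j. c (y j)"] by auto
  qed simp
  hence "card (y ` {..<k}) \<le> vec.dim W" using y by (intro vec.independent_card_le_dim) auto
  thus ?thesis by (simp add: card_image[OF inj])
qed

lemma dim_le_CARD: "vec.dim (W :: (complex^'n) set) \<le> CARD('n)"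
proof -
  have "vec.dim W \<le> vec.dim (UNIV :: (complex^'n) set)" by (rule vec.dim_subset) simp
  also have "\<dots> \<le> card (UNIV :: 'n set)"
    by (rule dim_le_card_functionals[of _ _ "\<lambda>a. axis a 1"]) (auto simp: vec_eq_iff)
  finally show ?thesis .
qed

text \<open>Indexing a basis by the coordinate type makes \<open>\<chi> i. b i\<close> a square
  matrix, to which determinants apply. M marks the members that span N; that all of them span is
  expressed by a trivial common kernel.\<close>

lemma ex_adapted_basis:
  fixes N :: "(complex^'n) set"
  assumes "vec.subspace N"
  shows "\<exists>(b::'n \<Rightarrow> complex^'n) M. (\<forall>i\<in>M. b i \<in> N) \<and> N = vec.span (b ` M) \<and>
     (\<forall>v. (\<forall>i. pairing (b i) v = 0) \<longrightarrow> v = 0)"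
proof -
  obtain B where B: "B \<subseteq> N" "vec.independent B" "N \<subseteq> vec.span B" by (rule vec.basis_exists)
  obtain B' where B': "B \<subseteq> B'" "vec.independent B'" "UNIV \<subseteq> vec.span B'"
    using vec.maximal_independent_subset_extend[OF subset_UNIV B(2)] by auto
  have fin: "finite B'" using B'(2) by (rule vec.finiteI_independent)
  have "card B' = vec.dim (UNIV :: (complex^'n) set)"
    using B' by (intro vec.basis_card_eq_dim) auto
  also have "\<dots> = CARD('n)"
  proof (rule antisym[OF dim_le_CARD])
    have "CARD('n) \<le> vec.dim (UNIV :: (complex^'n) set)"
    proof (rule card_le_dim_family[of _ _ "\<lambda>i. axis (coord_at i) 1 :: complex^'n"])
      fix l i assume s: "(\<Sum>j<CARD('n). l j *s (axis (coord_at j) 1 :: complex^'n)) = 0" and i: "i < CARD('n)"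
      have "0 = (\<Sum>j<CARD('n). l j *s (axis (coord_at j) 1 :: complex^'n)) $ coord_at i" by (simp add: s)
      also have "\<dots> = (\<Sum>j<CARD('n). if j = i then l j else 0)"
        unfolding sum_component
        by (intro sum.cong refl) (use i in \<open>auto simp: axis_def dest: index_coord_at\<close>, metis index_coord_at)
      finally show "l i = 0" using i by simp
    qed auto
    thus "CARD('n) \<le> vec.dim (UNIV :: (complex^'n) set)" .
  qed
  finally have "\<exists>b. bij_betw b (UNIV :: 'n set) B'"
    using fin by (intro finite_same_card_bij) auto
  then obtain b where b: "bij_betw b (UNIV :: 'n set) B'" by blast
  define M where "M = b -` B"
  have bM: "b ` M = B" using b B'(1) by (auto simp: M_def bij_betw_def)
  show ?thesis
  proof (intro exI[of _ b] exI[of _ M] conjI ballI allI impI)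
    fix i assume "i \<in> M" thus "b i \<in> N" using B(1) by (auto simp: M_def)
  next
    show "N = vec.span (b ` M)" using B assms by (simp add: bM vec.span_minimal subset_antisym)
  next
    fix v assume v: "\<forall>i. pairing (b i) v = 0"
    have "vec.span B' \<subseteq> {x. pairing x v = 0}"
    proof (rule vec.span_minimal)
      show "B' \<subseteq> {x. pairing x v = 0}" using v b by (auto simp: bij_betw_def)
    qed (auto simp: vec.subspace_def pairing_add_left pairing_scale_left)
    hence "pairing (axis i 1) v = 0" for i using B'(3) by blast
    thus "v = 0" by (simp add: vec_eq_iff)
  qed
qed

lemma det_nz_solve:
  fixes A :: "complex^'n^'n"
  assumes "det A \<noteq> 0"
  shows "\<exists>v. A *v v = y" and "A *v v = 0 \<Longrightarrow> v = 0"
proof -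
  have "invertible A" using assms by (simp add: invertible_det_nz)
  then obtain B where B: "A ** B = mat 1" "B ** A = mat 1" by (auto simp: invertible_def)
  show "\<exists>v. A *v v = y" by (rule exI[of _ "B *v y"]) (simp add: matrix_vector_mul_assoc B)
  show "v = 0" if "A *v v = 0"
  proof -
    have "v = B *v (A *v v)" by (simp add: matrix_vector_mul_assoc B)
    thus ?thesis by (simp add: that)
  qed
qed

lemma det_nz_iff_ker:
  fixes A :: "complex^'n^'n"
  assumes "\<And>v. A *v v = 0 \<Longrightarrow> v = 0"
  shows "det A \<noteq> 0"
proof -
  have "\<exists>B. B ** A = mat 1" using assms by (simp add: matrix_left_invertible_ker)
  hence "invertible A" by (simp add: invertible_left_inverse)
  thus ?thesis by (simp add: invertible_det_nz)
qed

lemma double_annihilator: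
  fixes N :: "(complex^'n) set"
  assumes "vec.subspace N" and x: "\<And>v. (\<And>w. w \<in> N \<Longrightarrow> pairing w v = 0) \<Longrightarrow> pairing x v = 0"
  shows "x \<in> N"
proof -
  obtain b :: "'n \<Rightarrow> complex^'n" and M where b: "\<forall>i\<in>M. b i \<in> N" "N = vec.span (b ` M)"
     "\<And>v. (\<forall>i. pairing (b i) v = 0) \<Longrightarrow> v = 0"
    using ex_adapted_basis[OF assms(1)] by blast
  define A where "A = (\<chi> i. b i)"
  have dA: "det A \<noteq> 0" unfolding A_def by (rule det_nz_iff_ker) (use b(3) in \<open>auto simp: mult_rows vec_eq_iff\<close>)
  hence "det (transpose A) \<noteq> 0" by (simp add: det_transpose)
  then obtain c where c: "transpose A *v c = x" using det_nz_solve by blast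
  have xs: "x = (\<Sum>i\<in>UNIV. c $ i *s b i)"
    by (simp add: c[symmetric] vec_eq_iff matrix_vector_mult_def transpose_def A_def mult.commute)
  have "c $ i = 0" if i: "i \<notin> M" for i
  proof -
    \<comment> \<open>The vector dual to b i: for i outside M it annihilates N, so the hypothesis on
      x forces the coefficient of b i to be zero.\<close>
    obtain v where v: "A *v v = axis i 1" using det_nz_solve[OF dA] by blast
    have bv: "pairing (b j) v = (if j = i then 1 else 0)" for j
      using v by (auto simp: A_def mult_rows vec_eq_iff axis_def)
    have "N \<subseteq> {w. pairing w v = 0}"
      unfolding b(2)
      by (rule vec.span_minimal) (use i in \<open>auto simp: bv vec.subspace_def pairing_add_left pairing_scale_left\<close>)
    hence "pairing x v = 0" by (intro x) auto
    thus "c $ i = 0" by (simp add: xs pairing_sum_left pairing_scale_left bv if_distrib cong: if_cong)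
  qed
  hence "x = (\<Sum>i\<in>M. c $ i *s b i)" unfolding xs by (intro sum.mono_neutral_right) auto
  also have "\<dots> \<in> N" using b(1) assms(1) by (intro vec.subspace_sum vec.subspace_scale) auto
  finally show ?thesis .
qed

lemma tangent_subspace: "vec.subspace (tangent_space Y p)"
  by (auto simp: vec.subspace_def tangent_space_def poly_dir_deriv pairing_add_right pairing_scale_right)

lemma grad_add: "is_poly f \<Longrightarrow> is_poly g \<Longrightarrow> grad (\<lambda>x. f x + g x) x = grad f x + grad g x"
  by (simp add: grad_def vec_eq_iff dir_deriv_add[OF is_poly_rational_on is_poly_rational_on open_UNIV UNIV_I])

lemma grad_cmult: "is_poly f \<Longrightarrow> grad (\<lambda>x. c * f x) x = c *s grad f x"
  by (simp add: grad_def vec_eq_iff dir_deriv_mult[OF is_poly_rational_on is_poly_rational_on open_UNIV UNIV_I] is_poly.const mult.commute)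

lemma grad_const [simp]: "grad (\<lambda>x. c) x = 0"
  by (simp add: grad_def vec_eq_iff)

definition conormal :: "(complex^'n) set \<Rightarrow> complex^'n \<Rightarrow> (complex^'n) set" where
  "conormal Y p = {grad f p | f. is_poly f \<and> (\<forall>y\<in>Y. f y = 0)}"

lemma conormal_subspace: "vec.subspace (conormal Y p)"
  unfolding vec.subspace_def
proof (intro conjI ballI allI)
  show "0 \<in> conormal Y p" unfolding conormal_def
    by (rule CollectI, rule exI[of _ "\<lambda>x. 0"]) (auto intro: is_poly.const)
next
  fix x y assume "x \<in> conormal Y p" "y \<in> conormal Y p"
  then obtain f g where "x = grad f p" "y = grad g p" "is_poly f" "is_poly g" "\<forall>y\<in>Y. f y = 0" "\<forall>y\<in>Y. g y = 0"
    by (auto simp: conormal_def)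
  thus "x + y \<in> conormal Y p" unfolding conormal_def
    by (intro CollectI exI[of _ "\<lambda>x. f x + g x"]) (auto simp: grad_add intro: is_poly.add)
next
  fix c x assume "x \<in> conormal Y p"
  then obtain f where "x = grad f p" "is_poly f" "\<forall>y\<in>Y. f y = 0" by (auto simp: conormal_def)
  thus "c *s x \<in> conormal Y p" unfolding conormal_def
    by (intro CollectI exI[of _ "\<lambda>x. c * f x"]) (auto simp: grad_cmult intro: is_poly.mult is_poly.const)
qed

lemma tangent_conormal: "v \<in> tangent_space Y p \<longleftrightarrow> (\<forall>w\<in>conormal Y p. pairing w v = 0)"
  by (auto simp: tangent_space_def conormal_def poly_dir_deriv)

text \<open>Vanishing on the tangent space is a condition at p only; double annihilation turns it
  into one polynomial vanishing on Y with the prescribed gradient at p, and this polynomial has a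
  gradient at all other points as well.\<close>

lemma conormalI:
  assumes "\<And>v. v \<in> tangent_space Y p \<Longrightarrow> pairing x v = 0"
  shows "x \<in> conormal Y p"
  by (rule double_annihilator[OF conormal_subspace]) (use assms tangent_conormal in blast)

lemma grad_linear: "grad (\<lambda>x. pairing b x) p = b"
proof -
  have "dir_deriv (pairing b) p v = pairing b v" for v
    unfolding dir_deriv_def pairing_add_right pairing_scale_right
    by (rule DERIV_imp_deriv) (auto intro!: derivative_eq_intros)
  thus ?thesis by (simp add: grad_def vec_eq_iff)
qed

lemma is_poly_pairing: "is_poly (\<lambda>x. pairing b x)"
  unfolding pairing_def by (intro is_poly_intros)

text \<open>The functions indexed by M are equations of Y whose gradients at p form a basis of the
  conormal space; the others are linear forms that complete it. The determinant records where the
  whole system stays nondegenerate.\<close>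

lemma ex_chart:
  fixes Y :: "(complex^'n) set"
  shows "\<exists>(G::'n \<Rightarrow> complex^'n \<Rightarrow> complex) M. (\<forall>i. is_poly (G i)) \<and> (\<forall>i\<in>M. \<forall>y\<in>Y. G i y = 0) \<and>
     det (\<chi> i. grad (G i) p) \<noteq> 0 \<and> vec.dim (tangent_space Y p) = card (- M)"
proof -
  obtain b :: "'n \<Rightarrow> complex^'n" and M where b: "\<forall>i\<in>M. b i \<in> conormal Y p" "conormal Y p = vec.span (b ` M)"
     "\<And>v. (\<forall>i. pairing (b i) v = 0) \<Longrightarrow> v = 0"
    using ex_adapted_basis[OF conormal_subspace, of Y p] by blast
  have "\<exists>f. is_poly f \<and> grad f p = b i \<and> (i \<in> M \<longrightarrow> (\<forall>y\<in>Y. f y = 0))" for i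
  proof (cases "i \<in> M")
    case True thus ?thesis using b(1) by (auto simp: conormal_def) metis
  next
    case False thus ?thesis by (intro exI[of _ "pairing (b i)"]) (auto simp: is_poly_pairing grad_linear)
  qed
  then obtain G where G: "\<And>i. is_poly (G i)" "\<And>i. grad (G i) p = b i" "\<And>i. i \<in> M \<Longrightarrow> \<forall>y\<in>Y. G i y = 0"
    by metis
  define A where "A = (\<chi> i. b i)"
  have dA: "det A \<noteq> 0" unfolding A_def by (rule det_nz_iff_ker) (use b(3) in \<open>auto simp: mult_rows vec_eq_iff\<close>)
  have T: "v \<in> tangent_space Y p \<longleftrightarrow> (\<forall>i\<in>M. pairing (b i) v = 0)" for v
  proof
    assume "v \<in> tangent_space Y p" thus "\<forall>i\<in>M. pairing (b i) v = 0" using b(1) by (auto simp: tangent_conormal)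
  next
    assume v: "\<forall>i\<in>M. pairing (b i) v = 0"
    have "conormal Y p \<subseteq> {w. pairing w v = 0}" unfolding b(2)
      by (rule vec.span_minimal) (use v in \<open>auto simp: vec.subspace_def pairing_add_left pairing_scale_left\<close>)
    thus "v \<in> tangent_space Y p" by (auto simp: tangent_conormal)
  qed
  have le: "vec.dim (tangent_space Y p) \<le> card (- M)"
    by (rule dim_le_card_functionals[OF tangent_subspace, where g = b]) (use b(3) T in blast)
  have "card (- M) \<le> vec.dim (tangent_space Y p)"
  proof -
    obtain h where h: "bij_betw h {..<card (- M)} (- M)"
      using ex_bij_betw_nat_finite[of "- M"] by (auto simp: atLeast0LessThan)
    have "\<exists>v. \<forall>j. pairing (b j) v = (if j = i then 1 else 0)" for i
      using det_nz_solve(1)[OF dA, of "axis i 1"] by (auto simp: A_def mult_rows vec_eq_iff axis_def)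
    then obtain v where v: "\<And>i j. pairing (b j) (v i) = (if j = i then 1 else 0)" by metis
    show ?thesis
    proof (rule card_le_dim_family[OF tangent_subspace, of _ "\<lambda>i. v (h i)"])
      fix i assume "i < card (- M)"
      hence "h i \<notin> M" using h by (auto simp: bij_betw_def)
      thus "v (h i) \<in> tangent_space Y p" by (auto simp: T v)
    next
      fix l i assume s: "(\<Sum>j<card (- M). l j *s v (h j)) = 0" and i: "i < card (- M)"
      have "0 = pairing (b (h i)) (\<Sum>j<card (- M). l j *s v (h j))" by (simp add: s)
      also have "\<dots> = (\<Sum>j<card (- M). if j = i then l j else 0)"
        unfolding pairing_sum_right pairing_scale_right v
        by (intro sum.cong refl) (use h i in \<open>auto simp: bij_betw_def inj_on_def\<close>)
      finally show "l i = 0" using i by simp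
    qed
  qed
  with le G dA show ?thesis
    by (intro exI[of _ G] exI[of _ M]) (auto simp: A_def)
qed

text \<open>At another point the gradients indexed by M are still independent conormal vectors, but
  there may be more of them, hence only an inequality.\<close>

lemma chart_dim:
  fixes G :: "'n \<Rightarrow> complex^'n \<Rightarrow> complex"
  assumes "\<And>i. is_poly (G i)" "\<And>i y. i \<in> M \<Longrightarrow> y \<in> Y \<Longrightarrow> G i y = 0" "det (\<chi> i. grad (G i) q) \<noteq> 0"
  shows "vec.dim (tangent_space Y q) \<le> card (- M)"
proof (rule dim_le_card_functionals[OF tangent_subspace, where g = "\<lambda>i. grad (G i) q"])
  fix v assume v: "v \<in> tangent_space Y q" "\<And>a. a \<in> - M \<Longrightarrow> pairing (grad (G a) q) v = 0"
  have "pairing (grad (G a) q) v = 0" for a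
  proof (cases "a \<in> M")
    case True
    hence "grad (G a) q \<in> conormal Y q" using assms(1,2) unfolding conormal_def by blast
    thus ?thesis using v(1) by (simp add: tangent_conormal)
  qed (use v in auto)
  hence "(\<chi> i. grad (G i) q) *v v = 0" by (simp add: mult_rows vec_eq_iff)
  thus "v = 0" using det_nz_solve(2)[OF assms(3)] by blast
qed

lemma tangent_dim_semicontinuous:
  fixes Y :: "(complex^'n) set"
  shows "\<exists>\<mu>. is_poly \<mu> \<and> \<mu> p \<noteq> 0 \<and> (\<forall>q. \<mu> q \<noteq> 0 \<longrightarrow> vec.dim (tangent_space Y q) \<le> vec.dim (tangent_space Y p))"
proof -
  obtain G :: "'n \<Rightarrow> complex^'n \<Rightarrow> complex" and M where G: "\<forall>i. is_poly (G i)" "\<forall>i\<in>M. \<forall>y\<in>Y. G i y = 0"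
     "det (\<chi> i. grad (G i) p) \<noteq> 0" "vec.dim (tangent_space Y p) = card (- M)"
    using ex_chart by blast
  show ?thesis
  proof (intro exI[of _ "\<lambda>q. det (\<chi> i. grad (G i) q)"] conjI allI impI)
    show "is_poly (\<lambda>q. det (\<chi> i. grad (G i) q))"
      by (rule is_poly_det) (use G in \<open>simp add: is_poly_grad\<close>)
  qed (use G chart_dim[of G M Y] in auto)
qed

section \<open>Zariski topology and dimension\<close>

lemma zclosed_zero_set: "is_poly f \<Longrightarrow> zclosed {x. f x = 0}"
  unfolding zclosed_def by (intro exI[of _ "{f}"]) auto

lemma zopen_basic: "is_poly f \<Longrightarrow> zopen {x. f x \<noteq> 0}"
  using zclosed_zero_set[of f] by (simp add: zopen_def Collect_neg_eq[symmetric])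

lemma zopen_basic_subset:
  assumes "zopen U" "u \<in> U"
  shows "\<exists>f. is_poly f \<and> f u \<noteq> 0 \<and> {x. f x \<noteq> 0} \<subseteq> U"
proof -
  obtain P where P: "\<forall>f\<in>P. is_poly f" "- U = {x. \<forall>f\<in>P. f x = 0}"
    using assms(1) by (auto simp: zopen_def zclosed_def)
  have "u \<notin> - U" using assms(2) by simp
  then obtain f where "f \<in> P" "f u \<noteq> 0" unfolding P(2) by auto
  moreover have "{x. f x \<noteq> 0} \<subseteq> U" using P(2) \<open>f \<in> P\<close> by blast
  ultimately show ?thesis using P(1) by blast
qed

lemma zopen_open: "zopen U \<Longrightarrow> open U"
proof -
  assume "zopen U"
  then obtain P where P: "\<forall>f\<in>P. is_poly f" "- U = {x. \<forall>f\<in>P. f x = 0}"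
    by (auto simp: zopen_def zclosed_def)
  have "closed {x. f x = 0}" if "f \<in> P" for f
    using is_poly_continuous[of f UNIV] P(1) that
    by (intro closed_Collect_eq) auto
  moreover have "- U = (\<Inter>f\<in>P. {x. f x = 0})" using P(2) by auto
  ultimately have "closed (- U)" by (auto intro: closed_INT)
  thus "open U" by (simp add: closed_def)
qed

lemma zclosed_Inter: "(\<And>A. A \<in> \<A> \<Longrightarrow> zclosed A) \<Longrightarrow> zclosed (\<Inter>\<A>)"
proof -
  assume a: "\<And>A. A \<in> \<A> \<Longrightarrow> zclosed A"
  define P where "P = {f. is_poly f \<and> (\<exists>A\<in>\<A>. \<forall>x\<in>A. f x = 0)}"
  have "\<Inter>\<A> = {x. \<forall>f\<in>P. f x = 0}"
  proof (intro equalityI subsetI CollectI ballI)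
    fix x f assume "x \<in> \<Inter>\<A>" "f \<in> P" thus "f x = 0" by (auto simp: P_def)
  next
    fix x assume x: "x \<in> {x. \<forall>f\<in>P. f x = 0}"
    show "x \<in> \<Inter>\<A>"
    proof
      fix A assume A: "A \<in> \<A>"
      then obtain Q where Q: "\<forall>f\<in>Q. is_poly f" "A = {x. \<forall>f\<in>Q. f x = 0}"
        using a by (auto simp: zclosed_def)
      have "\<forall>f\<in>Q. \<forall>x\<in>A. f x = 0" using Q(2) by simp
      hence "Q \<subseteq> P" using Q(1) A unfolding P_def by blast
      thus "x \<in> A" using x Q(2) by blast
    qed
  qed
  thus "zclosed (\<Inter>\<A>)" unfolding zclosed_def by (intro exI[of _ P]) (auto simp: P_def)
qed

lemma zclosed_zclosure: "zclosed (zclosure S)"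
  unfolding zclosure_def by (rule zclosed_Inter) auto

lemma zclosure_superset: "S \<subseteq> zclosure S"
  by (auto simp: zclosure_def)

lemma zclosure_minimal: "zclosed A \<Longrightarrow> S \<subseteq> A \<Longrightarrow> zclosure S \<subseteq> A"
  by (auto simp: zclosure_def)

lemma zclosure_mono: "S \<subseteq> T \<Longrightarrow> zclosure S \<subseteq> zclosure T"
  by (auto simp: zclosure_def)

lemma zclosure_vanish: "is_poly f \<Longrightarrow> (\<And>x. x \<in> S \<Longrightarrow> f x = 0) \<Longrightarrow> y \<in> zclosure S \<Longrightarrow> f y = 0"
  using zclosure_minimal[OF zclosed_zero_set, of f S] by auto

lemma zclosed_separate:
  assumes "zclosed Z" "x \<notin> Z"
  shows "\<exists>f. is_poly f \<and> (\<forall>z\<in>Z. f z = 0) \<and> f x \<noteq> 0"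
  using assms by (auto simp: zclosed_def)

lemma irreducible_mult:
  assumes Y: "irreducible_variety Y" and f: "is_poly f" "is_poly g" and "\<And>y. y \<in> Y \<Longrightarrow> f y * g y = 0"
  shows "(\<forall>y\<in>Y. f y = 0) \<or> (\<forall>y\<in>Y. g y = 0)"
proof -
  have "Y \<subseteq> {x. f x = 0} \<union> {x. g x = 0}" using assms(4) by auto
  hence "Y \<subseteq> {x. f x = 0} \<or> Y \<subseteq> {x. g x = 0}"
    using Y zclosed_zero_set[OF f(1)] zclosed_zero_set[OF f(2)] by (auto simp: irreducible_variety_def)
  thus ?thesis by auto
qed

lemma irreducible_common_nonzero:
  assumes "irreducible_variety Y" "is_poly f" "is_poly g" "a \<in> Y" "f a \<noteq> 0" "b \<in> Y" "g b \<noteq> 0"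
  shows "\<exists>y\<in>Y. f y \<noteq> 0 \<and> g y \<noteq> 0"
  using irreducible_mult[OF assms(1-3)] assms(4-7) by force

lemma irreducible_finite_nonzero:
  assumes Y: "irreducible_variety Y" and "finite A" and "\<And>a. a \<in> A \<Longrightarrow> is_poly (f a) \<and> (\<exists>y\<in>Y. f a y \<noteq> 0)"
  shows "\<exists>y\<in>Y. \<forall>a\<in>A. f a y \<noteq> 0"
proof -
  have "\<exists>y\<in>Y. (\<Prod>a\<in>A. f a y) \<noteq> 0"
    using assms(2,3)
  proof (induction A)
    case empty then show ?case using Y by (auto simp: irreducible_variety_def)
  next
    case (insert a A)
    then obtain x y where "x \<in> Y" "f a x \<noteq> 0" "y \<in> Y" "(\<Prod>a\<in>A. f a y) \<noteq> 0" by blast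
    thus ?case using irreducible_common_nonzero[OF Y, of "f a" "\<lambda>y. \<Prod>a\<in>A. f a y" x y] insert
      by (auto intro: is_poly_prod)
  qed
  thus ?thesis using assms(2) by auto
qed

lemma is_poly_peval: "vars_below N p \<Longrightarrow> (\<And>i. i < N \<Longrightarrow> is_poly (\<lambda>x. H x i)) \<Longrightarrow> is_poly (\<lambda>x. peval (H x) p)"
  by (induction p) (auto intro: is_poly_intros)

lemma integral_on_irreducible:
  assumes "irreducible_variety Y" "\<And>i. i < N \<Longrightarrow> is_poly (\<lambda>x. H x i)"
  shows "integral_on Y H N"
  unfolding integral_on_def
proof (intro conjI allI impI)
  show "Y \<noteq> {}" using assms(1) by (simp add: irreducible_variety_def)
  fix p q assume pq: "vars_below N p" "vars_below N q" "vanishes Y H (Mul p q)"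
  have "is_poly (\<lambda>x. peval (H x) p)" "is_poly (\<lambda>x. peval (H x) q)" using is_poly_peval[of N _ H] assms(2) pq(1,2) by auto
  from irreducible_mult[OF assms(1) this] pq(3) show "vanishes Y H p \<or> vanishes Y H q" by (simp add: vanishes_def)
qed

text \<open>Derivations at x of the algebra generated by the first N functions.\<close>
definition tangent_at :: "'a set \<Rightarrow> ('a \<Rightarrow> nat \<Rightarrow> complex) \<Rightarrow> nat \<Rightarrow> 'a \<Rightarrow> (nat \<Rightarrow> complex) \<Rightarrow> bool" where
  "tangent_at S H N x b \<longleftrightarrow> (\<forall>p. vars_below N p \<longrightarrow> vanishes S H p \<longrightarrow> deps (peval (\<lambda>i. Dual (H x i) (b i)) p) = 0)"

lemma tangD: "tangent_at S H N x b \<Longrightarrow> vars_below N p \<Longrightarrow> vanishes S H p \<Longrightarrow> deps (peval (\<lambda>i. Dual (H x i) (b i)) p) = 0"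
  by (simp add: tangent_at_def)

lemma deps_linear:
  "deps (peval (\<lambda>i. Dual (a i) (\<Sum>j<m. c j * b j i)) p) = (\<Sum>j<m. c j * deps (peval (\<lambda>i. Dual (a i) (b j i)) p))"
proof (induction p)
  case (Mul p q)
  have "(\<Sum>j<m. c j * deps (peval (\<lambda>i. Dual (a i) (b j i)) (Mul p q))) =
      peval a p * (\<Sum>j<m. c j * deps (peval (\<lambda>i. Dual (a i) (b j i)) q))
      + (\<Sum>j<m. c j * deps (peval (\<lambda>i. Dual (a i) (b j i)) p)) * peval a q"
    by (simp add: dre_peval sum.distrib[symmetric] sum_distrib_left sum_distrib_right algebra_simps)
  thus ?case using Mul by (simp add: dre_peval)
next
  case (Add p q)
  then show ?case by (simp add: sum.distrib distrib_left)
qed simp_all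

lemma deps_zero: "vars_below k p \<Longrightarrow> (\<And>i. i < k \<Longrightarrow> deps (\<rho> i) = 0) \<Longrightarrow> deps (peval \<rho> p) = 0"
  by (induction p) auto

lemma tangent_at_linear:
  assumes "\<And>j. j < m \<Longrightarrow> tangent_at S H N x (b j)"
  shows "tangent_at S H N x (\<lambda>i. \<Sum>j<m. c j * b j i)"
  unfolding tangent_at_def deps_linear
proof (intro allI impI sum.neutral ballI)
  fix p j assume "vars_below N p" "vanishes S H p" "j \<in> {..<m}"
  thus "c j * deps (peval (\<lambda>i. Dual (H x i) (b j i)) p) = 0" using tangD[OF assms[of j]] by simp
qed

text \<open>Prescribing unit vectors in \<open>generic_tangent\<close> yields derivations dual to
  the k independent functions.\<close>

lemma generic_tangent_basis:
  assumes "integral_on S H N" "\<And>i. i < k \<Longrightarrow> transc S H i" "k \<le> N"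
  shows "\<exists>\<delta>. vars_below N \<delta> \<and> \<not> vanishes S H \<delta> \<and> (\<forall>x\<in>S. peval (H x) \<delta> \<noteq> 0 \<longrightarrow>
     (\<exists>b. (\<forall>j. tangent_at S H N x (b j)) \<and> (\<forall>j. \<forall>i<k. b j i = (if i = j then 1 else 0))))"
proof -
  have "\<exists>\<delta>. vars_below N \<delta> \<and> \<not> vanishes S H \<delta> \<and> (\<forall>x\<in>S. peval (H x) \<delta> \<noteq> 0 \<longrightarrow>
     (\<forall>w. \<exists>\<tau>. gen_point S H N \<tau> \<and> (\<forall>i<N. dre (\<tau> i) = H x i) \<and> (\<forall>i<k. deps (\<tau> i) = w i)))"
    by (rule generic_tangent) (use assms in auto)
  then obtain \<delta> where \<delta>: "vars_below N \<delta>" "\<not> vanishes S H \<delta>" "\<forall>x\<in>S. peval (H x) \<delta> \<noteq> 0 \<longrightarrow>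
     (\<forall>w. \<exists>\<tau>. gen_point S H N \<tau> \<and> (\<forall>i<N. dre (\<tau> i) = H x i) \<and> (\<forall>i<k. deps (\<tau> i) = w i))"
    by (elim exE conjE)
  have "\<exists>b. (\<forall>j. tangent_at S H N x (b j)) \<and> (\<forall>j. \<forall>i<k. b j i = (if i = j then 1 else 0))"
    if x: "x \<in> S" "peval (H x) \<delta> \<noteq> 0" for x
  proof -
    have "\<exists>b. tangent_at S H N x b \<and> (\<forall>i<k. b i = (if i = j then 1 else 0))" for j
    proof -
      obtain \<tau> where \<tau>: "gen_point S H N \<tau>" "\<forall>i<N. dre (\<tau> i) = H x i" "\<forall>i<k. deps (\<tau> i) = (if i = j then 1 else 0)"
        using \<delta>(3)[rule_format, OF x, of "\<lambda>i. if i = j then 1 else 0"] by (elim exE conjE)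
      have "tangent_at S H N x (\<lambda>i. deps (\<tau> i))"
        unfolding tangent_at_def
      proof (intro allI impI)
        fix p assume p: "vars_below N p" "vanishes S H p"
        have "peval (\<lambda>i. Dual (H x i) (deps (\<tau> i))) p = peval \<tau> p"
          by (rule peval_cong[OF p(1)]) (use \<tau>(2) in \<open>auto simp: dual_eq_iff\<close>)
        thus "deps (peval (\<lambda>i. Dual (H x i) (deps (\<tau> i))) p) = 0" using \<tau>(1) p by (simp add: gen_point_def)
      qed
      thus ?thesis using \<tau>(3) by (intro exI[of _ "\<lambda>i. deps (\<tau> i)"] conjI)
    qed
    hence "\<exists>b. \<forall>j. tangent_at S H N x (b j) \<and> (\<forall>i<k. b j i = (if i = j then 1 else 0))"
      by (intro choice allI)
    thus ?thesis by (auto simp only: all_conj_distrib)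
  qed
  with \<delta>(1,2) show ?thesis by (intro exI[of _ \<delta>] conjI ballI impI)
qed

section \<open>Algebraic independence, chains and tangent dimension\<close>

definition alg_indep :: "(complex^'n) set \<Rightarrow> nat \<Rightarrow> (nat \<Rightarrow> complex^'n \<Rightarrow> complex) \<Rightarrow> bool" where
  "alg_indep Y k f \<longleftrightarrow> (\<forall>i<k. is_poly (f i)) \<and> (\<forall>i<k. transc Y (\<lambda>x i. f i x) i)"

lemma alg_indep_le_tangent_dim:
  fixes Y :: "(complex^'n) set"
  assumes Y: "irreducible_variety Y" and f: "alg_indep Y k f" and p: "p \<in> Y"
  shows "k \<le> vec.dim (tangent_space Y p)"
proof -
  \<comment> \<open>The functions f, followed by all coordinates: the coordinate part of a
    derivation is an honest vector, extracted by \<open>vec_at k\<close>.\<close>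
  define H where "H x i = (if i < k then f i x else x $ coord_at (i - k))" for x :: "complex^'n" and i
  let ?N = "k + CARD('n)"
  have pH: "is_poly (\<lambda>x. H x i)" for i
    using f by (cases "i < k") (auto simp: H_def alg_indep_def intro: is_poly.coord)
  have dm: "integral_on Y H ?N" by (rule integral_on_irreducible[OF Y pH])
  have vH: "vec_at k (H x) = x" for x by (simp add: vec_eq_iff H_def)
  have tr: "transc Y H i" if "i < k" for i
    by (rule transc_cong[of Y i "\<lambda>x i. f i x"]) (use f that in \<open>auto simp: alg_indep_def H_def\<close>)
  obtain \<delta> where \<delta>: "vars_below ?N \<delta>" "\<not> vanishes Y H \<delta>" "\<And>x. x \<in> Y \<Longrightarrow> peval (H x) \<delta> \<noteq> 0 \<Longrightarrow>
     (\<exists>b. (\<forall>j. tangent_at Y H ?N x (b j)) \<and> (\<forall>j. \<forall>i<k. b j i = (if i = j then 1 else 0)))"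
    using generic_tangent_basis[of Y H ?N k, OF dm tr] by auto
  obtain \<mu> where \<mu>: "is_poly \<mu>" "\<mu> p \<noteq> 0"
     "\<And>q. \<mu> q \<noteq> 0 \<Longrightarrow> vec.dim (tangent_space Y q) \<le> vec.dim (tangent_space Y p)"
    using tangent_dim_semicontinuous by blast
  obtain y where "y \<in> Y" "peval (H y) \<delta> \<noteq> 0" using \<delta>(2) by (auto simp: vanishes_def)
  then obtain x where x: "x \<in> Y" "peval (H x) \<delta> \<noteq> 0" "\<mu> x \<noteq> 0"
    using irreducible_common_nonzero[OF Y is_poly_peval[OF \<delta>(1), of H, OF pH] \<mu>(1) _ _ p \<mu>(2)] by blast
  obtain b where b: "\<And>j. tangent_at Y H ?N x (b j)" "\<And>j i. i < k \<Longrightarrow> b j i = (if i = j then 1 else 0)"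
    using \<delta>(3)[OF x(1,2)] by blast
  have df: "dir_deriv (f i) x (vec_at k (b j)) = (if i = j then 1 else 0)" if i: "i < k" for i j
  proof -
    have pf: "is_poly (f i)" using f i by (simp add: alg_indep_def)
    \<comment> \<open>Slot i minus f i of the coordinate slots vanishes on Y, which equates
      component i of the derivation with the derivative of f i along its vector.\<close>
    let ?p = "Add (Var i) (Mul (Cst (-1)) (pexp_at k (f i)))"
    have "vars_below ?N ?p" using i vars_below_pexp_at[OF pf] by simp
    moreover have "vanishes Y H ?p" using i by (auto simp: vanishes_def peval_pexp_at[OF pf] vH) (simp add: H_def)
    ultimately have "deps (peval (\<lambda>l. Dual (H x l) (b j l)) ?p) = 0" by (rule tangD[OF b(1)])
    hence "b j i - dir_deriv (f i) (vec_at k (H x)) (vec_at k (b j)) = 0"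
      by (simp add: deps_pexp_at[OF pf])
    thus ?thesis using b(2)[OF i] by (simp add: vH)
  qed
  have "k \<le> vec.dim (tangent_space Y x)"
  proof (rule card_le_dim_family[OF tangent_subspace, of _ "\<lambda>j. vec_at k (b j)"])
    fix j assume "j < k"
    show "vec_at k (b j) \<in> tangent_space Y x"
      unfolding tangent_space_def
    proof (intro CollectI allI impI)
      fix g assume g: "is_poly g \<and> (\<forall>y\<in>Y. g y = 0)"
      have "vars_below ?N (pexp_at k g)" using g vars_below_pexp_at by blast
      moreover have "vanishes Y H (pexp_at k g)" using g by (auto simp: vanishes_def peval_pexp_at vH)
      ultimately have "deps (peval (\<lambda>l. Dual (H x l) (b j l)) (pexp_at k g)) = 0" by (rule tangD[OF b(1)])
      thus "dir_deriv g x (vec_at k (b j)) = 0" using g by (simp add: deps_pexp_at vH)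
    qed
  next
    fix l i assume s: "(\<Sum>j<k. l j *s (vec_at k (b j) :: complex^'n)) = 0" and i: "i < k"
    have pf: "is_poly (f i)" using f i by (simp add: alg_indep_def)
    have "0 = dir_deriv (f i) x (\<Sum>j<k. l j *s vec_at k (b j))" by (simp add: s poly_dir_deriv[OF pf])
    also have "\<dots> = (\<Sum>j<k. l j * dir_deriv (f i) x (vec_at k (b j)))"
      by (simp add: poly_dir_deriv[OF pf] pairing_sum_right pairing_scale_right)
    also have "\<dots> = l i" using i by (simp add: df if_distrib cong: if_cong)
    finally show "l i = 0" by simp
  qed
  with \<mu>(3)[OF x(3)] show ?thesis by simp
qed

lemma transc_vanish:
  assumes "S \<noteq> {}" "\<And>i. i < k \<Longrightarrow> transc S H i" "vars_below k p" "vanishes S H p"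
  shows "peval (\<rho> :: nat \<Rightarrow> complex) p = 0"
  using gen_point_trans[OF assms(1,2)] assms(3,4) unfolding gen_point_def by blast

text \<open>Restricted to Z, the coefficients of a relation vanish on Z; as polynomials in functions
  independent on Z they are then zero for all values, in particular on Y.\<close>

lemma alg_indep_mono:
  assumes "Z \<noteq> {}" "Z \<subseteq> Y" and f: "alg_indep Z k f"
  shows "alg_indep Y k f"
  unfolding alg_indep_def
proof (intro conjI allI impI)
  let ?H = "\<lambda>x i. f i x"
  fix i assume i: "i < k"
  show "is_poly (f i)" using f i by (simp add: alg_indep_def)
  show "transc Y ?H i" unfolding transc_def
  proof (intro allI impI)
    fix d q j assume r: "relation Y ?H i d q" and j: "j < d"
    have "relation Z ?H i d q" using r assms(2) by (auto simp: relation_def)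
    hence "vanishes Z ?H (q j)" using f i j by (auto simp: alg_indep_def transc_def)
    moreover have "vars_below i (q j)" using r j by (simp add: relation_def)
    ultimately have "peval (?H x) (q j) = 0" for x
      using transc_vanish[OF assms(1), of i ?H "q j"] f i by (auto simp: alg_indep_def)
    thus "vanishes Y ?H (q j)" by (simp add: vanishes_def)
  qed
qed

text \<open>Divide a nontrivial relation by the largest possible power of the last variable.\<close>
lemma relation_constant_term:
  assumes dm: "integral_on S H (Suc k)" and nz: "\<not> vanishes S H (Var k)"
    and r: "relation S H k d q" and j: "j < d" "\<not> vanishes S H (q j)"
  shows "\<exists>c s. vars_below k c \<and> vars_below (Suc k) s \<and> \<not> vanishes S H c \<and> (\<forall>x\<in>S. peval (H x) c = H x k * peval (H x) s)"
proof -
  define m where "m = (LEAST j. j < d \<and> \<not> vanishes S H (q j))"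
  have m: "m < d" "\<not> vanishes S H (q m)" unfolding m_def using LeastI[of "\<lambda>j. j < d \<and> \<not> vanishes S H (q j)" j] j by auto
  have lt: "vanishes S H (q i)" if "i < m" for i
    using not_less_Least[of i "\<lambda>j. j < d \<and> \<not> vanishes S H (q j)"] that m by (auto simp: m_def[symmetric])
  define s where "s = psum (\<lambda>i. Mul (q (Suc (m + i))) (ppow (Var k) i)) (d - Suc m)"
  have vq: "vars_below k (q i)" if "i < d" for i using r that by (simp add: relation_def)
  have vs: "vars_below (Suc k) s" unfolding s_def by (intro vars_below_psum) (auto intro!: vars_below_ppow vars_below_mono[OF vq])
  have "(\<Sum>i<d. peval (H x) (q i) * H x k ^ i) = H x k ^ m * (peval (H x) (q m) + H x k * peval (H x) s)" if x: "x \<in> S" for x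
  proof -
    have "(\<Sum>i<d. peval (H x) (q i) * H x k ^ i) = (\<Sum>i\<in>{m..<d}. peval (H x) (q i) * H x k ^ i)"
      using lt x by (intro sum.mono_neutral_right) (auto simp: vanishes_def)
    also have "\<dots> = peval (H x) (q m) * H x k ^ m + (\<Sum>i\<in>{Suc m..<d}. peval (H x) (q i) * H x k ^ i)"
      using m(1) by (rule sum.atLeast_Suc_lessThan)
    also have "(\<Sum>i\<in>{Suc m..<d}. peval (H x) (q i) * H x k ^ i) =
        (\<Sum>i<d - Suc m. peval (H x) (q (Suc (m + i))) * H x k ^ (Suc (m + i)))"
      by (rule sum.reindex_bij_witness[of _ "\<lambda>i. Suc (m + i)" "\<lambda>i. i - Suc m"]) auto
    finally show ?thesis by (simp add: s_def sum_distrib_left power_add algebra_simps)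
  qed
  hence z: "vanishes S H (Mul (ppow (Var k) m) (Add (q m) (Mul (Var k) s)))"
    using r by (simp add: vanishes_def relation_def)
  have v: "vars_below (Suc k) (ppow (Var k) m)" "vars_below (Suc k) (Add (q m) (Mul (Var k) s))"
    using vs vars_below_mono[OF vq[OF m(1)], of "Suc k"] by (auto intro: vars_below_ppow)
  have "\<not> vanishes S H (ppow (Var k) m)" using dm nz by (intro integral_on_ppow) auto
  hence "vanishes S H (Add (q m) (Mul (Var k) s))" using dm z v unfolding integral_on_def by blast
  hence "\<forall>x\<in>S. peval (H x) (q m) = H x k * peval (H x) (Mul (Cst (-1)) s)"
    by (simp add: vanishes_def eq_neg_iff_add_eq_0)
  moreover have "vars_below (Suc k) (Mul (Cst (-1)) s)" using vs by simp
  ultimately show ?thesis using vq[OF m(1)] m(2) by blast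
qed

text \<open>A polynomial h that vanishes on Z but not on Y is transcendental over f on Y. Otherwise
  a nonzero polynomial c in f is a multiple of h on Y, so c vanishes on Z, against the independence
  of f there.\<close>

lemma alg_indep_extend:
  assumes Z: "irreducible_variety Z" and Y: "irreducible_variety Y" and ZY: "Z \<subset> Y" and f: "alg_indep Z k f"
  shows "\<exists>g. alg_indep Y (Suc k) g"
proof -
  have ne: "Z \<noteq> {}" using Z by (simp add: irreducible_variety_def)
  obtain y where "y \<in> Y" "y \<notin> Z" using ZY by auto
  then obtain h where h: "is_poly h" "\<forall>z\<in>Z. h z = 0" "h y \<noteq> 0"
    using zclosed_separate[of Z y] Z by (auto simp: irreducible_variety_def)
  define g where "g = f(k := h)"
  let ?H = "\<lambda>x i. g i x"
  have pg: "is_poly (g i)" if "i < Suc k" for i using f h(1) that by (auto simp: g_def alg_indep_def)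
  have fY: "alg_indep Y k f" using alg_indep_mono[OF ne _ f] ZY by blast
  have gf: "g j = f j" if "j \<le> i" "i < k" for i j using that by (simp add: g_def)
  have tY: "transc Y ?H i" if "i < k" for i
  proof (rule transc_cong[of Y i "\<lambda>x i. f i x"])
    show "transc Y (\<lambda>x i. f i x) i" using fY that by (simp add: alg_indep_def)
  qed (simp add: gf[OF _ that])
  have tZ: "transc Z ?H i" if "i < k" for i
  proof (rule transc_cong[of Z i "\<lambda>x i. f i x"])
    show "transc Z (\<lambda>x i. f i x) i" using f that by (simp add: alg_indep_def)
  qed (simp add: gf[OF _ that])
  have "transc Y ?H k"
    unfolding transc_def
  proof (intro allI impI, rule ccontr)
    fix d q j assume r: "relation Y ?H k d q" and j: "j < d" "\<not> vanishes Y ?H (q j)"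
    have dm: "integral_on Y ?H (Suc k)" by (rule integral_on_irreducible[OF Y pg])
    have "\<not> vanishes Y ?H (Var k)" using h \<open>y \<in> Y\<close> by (auto simp: vanishes_def g_def)
    from relation_constant_term[OF dm this r j] obtain c s where c: "vars_below k c" "\<not> vanishes Y ?H c"
      "\<forall>x\<in>Y. peval (?H x) c = ?H x k * peval (?H x) s"
      by auto
    have "vanishes Z ?H c" using c(3) h(2) ZY by (auto simp: vanishes_def g_def)
    hence "peval (?H x) c = 0" for x using transc_vanish[of Z k ?H c, OF ne tZ c(1)] by simp
    thus False using c(2) by (simp add: vanishes_def)
  qed
  hence "alg_indep Y (Suc k) g" using tY pg unfolding alg_indep_def by (simp add: less_Suc_eq)
  thus ?thesis by blast
qed

text \<open>The set whose supremum is \<open>zdim\<close>. A supremum of natural numbers is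
  informative only for a bounded set, so chains must be bounded before \<open>zdim\<close> can be
  used.\<close>

definition chains :: "(complex^'n) set \<Rightarrow> nat set" where
  "chains Y = {n. \<exists>Z :: nat \<Rightarrow> (complex^'n) set.
      (\<forall>i\<le>n. irreducible_variety (Z i)) \<and> (\<forall>i<n. Z i \<subset> Z (Suc i)) \<and> Z n \<subseteq> Y}"

text \<open>Each strict inclusion of the chain contributes one independent function.\<close>

lemma chain_le_tangent_dim:
  assumes Y: "irreducible_variety Y" and p: "p \<in> Y" and n: "n \<in> chains Y"
  shows "n \<le> vec.dim (tangent_space Y p)"
proof -
  obtain Z where Z: "\<And>i. i \<le> n \<Longrightarrow> irreducible_variety (Z i)" "\<And>i. i < n \<Longrightarrow> Z i \<subset> Z (Suc i)" "Z n \<subseteq> Y"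
    using n by (auto simp: chains_def)
  have "i \<le> n \<Longrightarrow> \<exists>f. alg_indep (Z i) i f" for i
  proof (induction i)
    case 0 show ?case by (rule exI[of _ "\<lambda>_ _. 0"]) (simp add: alg_indep_def)
  next
    case (Suc i)
    thus ?case using alg_indep_extend[OF Z(1)[of i] Z(1)[of "Suc i"] Z(2)[of i]] by auto
  qed
  then obtain f where "alg_indep (Z n) n f" by blast
  hence "alg_indep Y n f" using Z(1)[of n] Z(3) by (intro alg_indep_mono[of "Z n" Y]) (auto simp: irreducible_variety_def)
  thus ?thesis by (rule alg_indep_le_tangent_dim[OF Y _ p])
qed

lemma zdim_le_tangent_dim:
  assumes Y: "irreducible_variety Y" and p: "p \<in> Y"
  shows "zdim Y \<le> vec.dim (tangent_space Y p)"
proof -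
  have "0 \<in> chains Y" using Y by (auto simp: chains_def intro!: exI[of _ "\<lambda>_. Y"])
  hence "Sup (chains Y) \<le> vec.dim (tangent_space Y p)"
    by (intro cSup_least) (auto intro: chain_le_tangent_dim[OF Y p])
  thus ?thesis by (simp add: zdim_def chains_def)
qed

lemma chain_le_zdim:
  assumes Y: "irreducible_variety Y" and n: "n \<in> chains Y"
  shows "n \<le> zdim Y"
proof -
  obtain p where p: "p \<in> Y" using Y by (auto simp: irreducible_variety_def)
  have "n \<le> Sup (chains Y)"
    by (rule cSup_upper[OF n]) (use chain_le_tangent_dim[OF Y p] in \<open>auto simp: bdd_above_def\<close>)
  thus ?thesis by (simp add: zdim_def chains_def)
qed

lemma dir_deriv_peval:
  "dir_deriv (\<lambda>x. peval (\<lambda>i. x $ c i) p) x v = deps (peval (\<lambda>i. Dual (x $ c i) (v $ c i)) p)"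
  unfolding dir_deriv_def
  using DERIV_imp_deriv[OF dual_has_deriv[of "\<lambda>i. Dual (x $ c i) (v $ c i)" p]] by simp

text \<open>Take a largest independent list of coordinates. Every coordinate a is then algebraic
  over it, and where the derivative of its relation is nonzero, a tangent vector with zero
  components along the list has zero component a.\<close>

lemma ex_transcendence_coords:
  fixes Y :: "(complex^'n) set"
  assumes Y: "irreducible_variety Y"
  shows "\<exists>k c p. alg_indep Y k (\<lambda>i x. x $ c i) \<and> p \<in> Y \<and> vec.dim (tangent_space Y p) \<le> k"
proof -
  obtain y where y: "y \<in> Y" using Y by (auto simp: irreducible_variety_def)
  define K where "K k \<longleftrightarrow> (\<exists>c :: nat \<Rightarrow> 'n. alg_indep Y k (\<lambda>i x. x $ c i))" for k
  have bd: "k \<le> CARD('n)" if "K k" for k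
  proof -
    obtain c :: "nat \<Rightarrow> 'n" where "alg_indep Y k (\<lambda>i x. x $ c i)" using \<open>K k\<close> by (auto simp: K_def)
    from alg_indep_le_tangent_dim[OF Y this y] dim_le_CARD[of "tangent_space Y y"] show ?thesis by linarith
  qed
  have "K 0" by (auto simp: K_def alg_indep_def)
  then obtain k where k: "K k" "\<And>k'. K k' \<Longrightarrow> k' \<le> k"
    using Nat.ex_has_greatest_nat[of K 0 "CARD('n)"] bd by auto
  then obtain c :: "nat \<Rightarrow> 'n" where c: "alg_indep Y k (\<lambda>i x. x $ c i)" by (auto simp: K_def)
  \<comment> \<open>The chosen coordinates, with the coordinate a under test in slot k.\<close>
  define H where "H a x i = x $ (c(k := a)) i" for a and x :: "complex^'n" and i
  have tr: "transc Y (H a) i" if "i < k" for a i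
    by (rule transc_cong[of Y i "\<lambda>x i. x $ c i"]) (use c that in \<open>auto simp: alg_indep_def H_def\<close>)
  have ntr: "\<not> transc Y (H a) k" for a
  proof
    assume t: "transc Y (H a) k"
    have "alg_indep Y (Suc k) (\<lambda>i x. x $ (c(k := a)) i)"
      using tr[of _ a] t by (auto simp: alg_indep_def less_Suc_eq H_def[abs_def] intro: is_poly.coord)
    hence "K (Suc k)" by (auto simp: K_def)
    thus False using k(2) by fastforce
  qed
  have "\<exists>e q. min_relation Y (H a) k e q" for a using ex_min_relation[OF ntr[of a]] by metis
  then obtain e q where m: "\<And>a. min_relation Y (H a) k (e a) (q a)" by metis
  define P where "P a x = (\<Sum>i<e a. of_nat (Suc i) * peval (H a x) (q a (Suc i)) * H a x k ^ i)" for a x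
  have vq: "vars_below k (q a i)" if "i < Suc (e a)" for a i using m[of a] that by (auto simp: min_relation_def relation_def)
  have pH: "is_poly (\<lambda>x. H a x i)" for a i by (auto simp: H_def intro: is_poly.coord)
  have "is_poly (P a) \<and> (\<exists>y\<in>Y. P a y \<noteq> 0)" for a
    using min_relation_deriv[OF m[of a]] unfolding P_def
    by (auto intro!: is_poly_intros is_poly_peval[OF vq] pH)
  then obtain p where p: "p \<in> Y" "\<And>a. P a p \<noteq> 0"
    using irreducible_finite_nonzero[OF Y, of UNIV P] by auto
  have "vec.dim (tangent_space Y p) \<le> card (c ` {..<k})"
  proof (rule dim_le_card_functionals[OF tangent_subspace, where g = "\<lambda>a. axis a 1"])
    fix v assume v: "v \<in> tangent_space Y p" "\<And>a. a \<in> c ` {..<k} \<Longrightarrow> pairing (axis a 1) v = 0"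
    have "v $ a = 0" for a
    proof -
      let ?R = "psum (\<lambda>i. Mul (q a i) (ppow (Var k) i)) (Suc (e a))"
      let ?d = "\<lambda>i. Dual (p $ (c(k := a)) i) (v $ (c(k := a)) i)"
      have vR: "vars_below (Suc k) ?R" by (intro vars_below_psum) (auto intro!: vars_below_ppow vars_below_mono[OF vq])
      have "is_poly (\<lambda>x. peval (\<lambda>i. x $ (c(k := a)) i) ?R)"
        by (rule is_poly_peval[OF vR]) (auto intro: is_poly.coord)
      moreover have "\<forall>y\<in>Y. peval (\<lambda>i. y $ (c(k := a)) i) ?R = 0"
      proof
        fix y assume "y \<in> Y"
        hence "(\<Sum>i<Suc (e a). peval (H a y) (q a i) * H a y k ^ i) = 0"
          using m[of a] by (auto simp: min_relation_def relation_def)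
        thus "peval (\<lambda>i. y $ (c(k := a)) i) ?R = 0"
          by (simp add: H_def[abs_def] del: sum.lessThan_Suc psum.simps)
      qed
      ultimately have "dir_deriv (\<lambda>x. peval (\<lambda>i. x $ (c(k := a)) i) ?R) p v = 0"
        using v(1) unfolding tangent_space_def by blast
      hence "0 = deps (peval ?d ?R)" unfolding dir_deriv_peval by simp
      also have "\<dots> = (\<Sum>i<Suc (e a). deps (peval ?d (q a i) * ?d k ^ i))"
        by (simp del: sum.lessThan_Suc psum.simps)
      \<comment> \<open>The coefficients of the relation do not move along v, because v has no
        component along the chosen coordinates; only the last variable contributes.\<close>
      also have "\<dots> = (\<Sum>i<Suc (e a). peval (H a p) (q a i) * (of_nat i * p $ a ^ (i - 1) * v $ a))"
      proof (intro sum.cong refl)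
        fix i assume i: "i \<in> {..<Suc (e a)}"
        have "deps (peval ?d (q a i)) = 0" by (rule deps_zero[OF vq]) (use i v(2) in auto)
        thus "deps (peval ?d (q a i) * ?d k ^ i) = peval (H a p) (q a i) * (of_nat i * p $ a ^ (i - 1) * v $ a)"
          by (simp add: deps_power dre_peval H_def[abs_def])
      qed
      also have "\<dots> = P a p * v $ a"
        unfolding sum.lessThan_Suc_shift P_def sum_distrib_right by (simp add: algebra_simps H_def[of a p k])
      finally show ?thesis using p(2)[of a] by simp
    qed
    thus "v = 0" by (simp add: vec_eq_iff)
  qed
  also have "\<dots> \<le> k" using card_image_le[of "{..<k}" c] by simp
  finally show ?thesis using c p(1) by blast
qed

section \<open>Dominant parametrizations\<close>

lemma cancel_middle: "(x::complex) + d * f = a \<Longrightarrow> f * d + b = a \<Longrightarrow> x = b"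
  by (auto simp: algebra_simps)

lemma rational_on_peval: "vars_below N p \<Longrightarrow> (\<And>i. i < N \<Longrightarrow> rational_on D (\<lambda>x. H x i)) \<Longrightarrow> rational_on D (\<lambda>x. peval (H x) p)"
  by (induction p) (auto intro: rational_on.const rational_on.add rational_on.mult)

lemma open_basic: "is_poly \<delta> \<Longrightarrow> open {x. \<delta> x \<noteq> 0}"
  by (intro zopen_open zopen_basic)

text \<open>Two points of the slice are joined by a line inside u + W. On it both numerators and
  \<delta> are polynomials in one variable, none of them identically zero, so a common nonzero
  exists.\<close>

lemma affine_slice_domain:
  fixes \<delta> :: "complex^'n \<Rightarrow> complex"
  assumes \<delta>: "is_poly \<delta>" and W: "vec.subspace W" and S: "S = {x. x - u \<in> W \<and> \<delta> x \<noteq> 0}"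
    and r: "rational_on {x. \<delta> x \<noteq> 0} f" "rational_on {x. \<delta> x \<noteq> 0} g"
    and x: "x \<in> S" "f x \<noteq> 0" and y: "y \<in> S" "g y \<noteq> 0"
  shows "\<exists>z\<in>S. f z \<noteq> 0 \<and> g z \<noteq> 0"
proof -
  obtain a b where ab: "is_poly a" "is_poly b" "\<And>x. \<delta> x \<noteq> 0 \<Longrightarrow> b x \<noteq> 0 \<and> f x = a x / b x"
    using rational_on_numden[OF r(1)] by auto
  obtain c d where cd: "is_poly c" "is_poly d" "\<And>x. \<delta> x \<noteq> 0 \<Longrightarrow> d x \<noteq> 0 \<and> g x = c x / d x"
    using rational_on_numden[OF r(2)] by auto
  obtain P where P: "\<And>s. a (x + s *s (y - x)) = poly P s" using poly_on_line[OF ab(1)] by blast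
  obtain Q where Q: "\<And>s. c (x + s *s (y - x)) = poly Q s" using poly_on_line[OF cd(1)] by blast
  obtain R where R: "\<And>s. \<delta> (x + s *s (y - x)) = poly R s" using poly_on_line[OF \<delta>] by blast
  have "poly P 0 \<noteq> 0" using P[of 0] x ab(3)[of x] S by auto
  moreover have "poly Q 1 \<noteq> 0" using Q[of 1] y cd(3)[of y] S by auto
  moreover have "poly R 0 \<noteq> 0" using R[of 0] x S by auto
  ultimately obtain s where s: "poly P s \<noteq> 0" "poly Q s \<noteq> 0" "poly R s \<noteq> 0"
    using poly_common_nonzero by blast
  let ?z = "x + s *s (y - x)"
  have "?z - u = (x - u) + s *s ((y - u) - (x - u))" by simp
  also have "\<dots> \<in> W"
  proof -
    have xu: "x - u \<in> W" and yu: "y - u \<in> W" using x y S by auto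
    show ?thesis by (rule vec.subspace_add[OF W xu vec.subspace_scale[OF W vec.subspace_diff[OF W yu xu]]])
  qed
  finally have "?z \<in> S" using s R S by simp
  moreover have "f ?z \<noteq> 0" "g ?z \<noteq> 0" using s ab(3)[of ?z] cd(3)[of ?z] P[of s] Q[of s] R[of s] by auto
  ultimately show ?thesis by blast
qed

lemma integral_on_affine_slice:
  fixes \<delta> :: "complex^'n \<Rightarrow> complex"
  assumes \<delta>: "is_poly \<delta>" and W: "vec.subspace W" and S: "S = {x. x - u \<in> W \<and> \<delta> x \<noteq> 0}" and ne: "S \<noteq> {}"
    and H: "\<And>i. i < N \<Longrightarrow> rational_on {x. \<delta> x \<noteq> 0} (\<lambda>x. H x i)"
  shows "integral_on S H N"
  unfolding integral_on_def
proof (intro conjI allI impI ne)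
  fix p q assume pq: "vars_below N p" "vars_below N q" "vanishes S H (Mul p q)"
  have r: "rational_on {x. \<delta> x \<noteq> 0} (\<lambda>x. peval (H x) p)" "rational_on {x. \<delta> x \<noteq> 0} (\<lambda>x. peval (H x) q)"
    using rational_on_peval[of N _ _ H] H pq(1,2) by auto
  show "vanishes S H p \<or> vanishes S H q"
  proof (rule ccontr)
    assume "\<not> (vanishes S H p \<or> vanishes S H q)"
    then obtain x y where "x \<in> S" "peval (H x) p \<noteq> 0" "y \<in> S" "peval (H y) q \<noteq> 0" by (auto simp: vanishes_def)
    from affine_slice_domain[OF \<delta> W S r this] pq(3) show False by (auto simp: vanishes_def)
  qed
qed

text \<open>The tangent argument with a slice in place of a variety and rational functions in place
  of polynomials: functions independent on the slice have independent differentials along W at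
  general points.\<close>

lemma rational_on_tangent_basis:
  fixes \<delta> :: "complex^'n \<Rightarrow> complex"
  assumes \<delta>: "is_poly \<delta>" and W: "vec.subspace W" and S: "S = {x. x - u \<in> W \<and> \<delta> x \<noteq> 0}" and ne: "S \<noteq> {}"
    and f: "\<And>i. i < k \<Longrightarrow> rational_on {x. \<delta> x \<noteq> 0} (f i)"
    and tr: "\<And>i. i < k \<Longrightarrow> transc S (\<lambda>x i. f i x) i"
  shows "\<exists>\<gamma>. rational_on {x. \<delta> x \<noteq> 0} \<gamma> \<and> (\<exists>x\<in>S. \<gamma> x \<noteq> 0) \<and> (\<forall>x\<in>S. \<gamma> x \<noteq> 0 \<longrightarrow>
    (\<exists>v. (\<forall>j. v j \<in> W) \<and> (\<forall>j. \<forall>i<k. dir_deriv (f i) x (v j) = (if i = j then 1 else 0))))"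
proof -
  define D where "D = {x. \<delta> x \<noteq> 0}"
  have oD: "open D" unfolding D_def by (rule open_basic[OF \<delta>])
  note f = f[folded D_def]
  define H where "H x i = (if i < k then f i x else x $ coord_at (i - k))" for x :: "complex^'n" and i
  let ?N = "k + CARD('n)"
  have rH: "rational_on D (\<lambda>x. H x i)" for i
    using f by (cases "i < k") (auto simp: H_def intro: rational_on.coord)
  have vH: "vec_at k (H x) = x" for x by (simp add: vec_eq_iff H_def)
  have dm: "integral_on S H ?N" by (rule integral_on_affine_slice[OF \<delta> W S ne]) (use rH D_def in auto)
  have trH: "transc S H i" if "i < k" for i
    by (rule transc_cong[of S i "\<lambda>x i. f i x"]) (use tr that in \<open>auto simp: H_def\<close>)
  have "\<exists>\<delta>. vars_below ?N \<delta> \<and> \<not> vanishes S H \<delta> \<and> (\<forall>x\<in>S. peval (H x) \<delta> \<noteq> 0 \<longrightarrow>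
     (\<exists>b. (\<forall>j. tangent_at S H ?N x (b j)) \<and> (\<forall>j. \<forall>i<k. b j i = (if i = j then 1 else 0))))"
    by (rule generic_tangent_basis[OF dm]) (use trH in auto)
  then obtain \<epsilon> where \<epsilon>: "vars_below ?N \<epsilon>" "\<not> vanishes S H \<epsilon>" "\<forall>x\<in>S. peval (H x) \<epsilon> \<noteq> 0 \<longrightarrow>
     (\<exists>b. (\<forall>j. tangent_at S H ?N x (b j)) \<and> (\<forall>j. \<forall>i<k. b j i = (if i = j then 1 else 0)))"
    by (elim exE conjE)
  have main: "\<exists>v. (\<forall>j. v j \<in> W) \<and> (\<forall>j. \<forall>i<k. dir_deriv (f i) x (v j) = (if i = j then 1 else 0))"
    if x: "x \<in> S" "peval (H x) \<epsilon> \<noteq> 0" for x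
  proof -
    have xD: "x \<in> D" using x(1) S by (simp add: D_def)
    obtain b where b: "\<forall>j. tangent_at S H ?N x (b j)" "\<forall>j. \<forall>i<k. b j i = (if i = j then 1 else 0)"
      using \<epsilon>(3)[rule_format, OF x] by (elim exE conjE)
    have W': "vec_at k (b j) \<in> W" for j
    proof (rule double_annihilator[OF W])
      fix l assume l: "\<And>w. w \<in> W \<Longrightarrow> pairing w l = 0"
      \<comment> \<open>For l annihilating W this affine function vanishes on S, so the derivation
        kills it; hence l annihilates the vector of the derivation.\<close>
      define g where "g = (\<lambda>x. pairing l x + - pairing l u)"
      have g: "is_poly g" unfolding g_def by (intro is_poly.add is_poly.const is_poly_pairing)
      have "vanishes S H (pexp_at k g)"
        unfolding vanishes_def peval_pexp_at[OF g] vH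
      proof
        fix y assume "y \<in> S"
        hence "pairing (y - u) l = 0" using l S by blast
        thus "g y = 0" by (simp add: g_def pairing_diff_left pairing_commute[of l])
      qed
      hence "deps (peval (\<lambda>i. Dual (H x i) (b j i)) (pexp_at k g)) = 0"
        using tangD[OF b(1)[rule_format] vars_below_pexp_at[OF g]] by simp
      hence "pairing (grad g x) (vec_at k (b j)) = 0"
        by (simp add: deps_pexp_at[OF g] vH poly_dir_deriv[OF g])
      moreover have "grad g x = l"
        unfolding g_def by (subst grad_add) (auto simp: is_poly_pairing is_poly.const grad_linear)
      ultimately show "pairing (vec_at k (b j)) l = 0" by (simp add: pairing_commute)
    qed
    have "dir_deriv (f i) x (vec_at k (b j)) = (if i = j then 1 else 0)" if i: "i < k" for i j
    proof -
      let ?v = "vec_at k (b j) :: complex^'n"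
      obtain a q where aq: "is_poly a" "is_poly q" "\<forall>x\<in>D. q x \<noteq> 0 \<and> f i x = a x / q x"
        using rational_on_numden[OF f[OF i]] by blast
      \<comment> \<open>As f i is not an expression in the coordinates, the identity f i * q = a
        with polynomials a and q takes its place. It is differentiated both formally and
        analytically, and the results are compared.\<close>
      let ?p = "Add (Mul (Var i) (pexp_at k q)) (Mul (Cst (-1)) (pexp_at k a))"
      have "vars_below ?N ?p" using i vars_below_pexp_at[OF aq(1)] vars_below_pexp_at[OF aq(2)] by simp
      moreover have "vanishes S H ?p"
        unfolding vanishes_def
      proof
        fix y assume "y \<in> S"
        hence "y \<in> D" using S by (simp add: D_def)
        thus "peval (H y) ?p = 0" using aq(3) i by (simp add: peval_pexp_at[OF aq(1)] peval_pexp_at[OF aq(2)] vH) (simp add: H_def)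
      qed
      ultimately have "deps (peval (\<lambda>l. Dual (H x l) (b j l)) ?p) = 0"
        using tangD[OF b(1)[rule_format]] by blast
      hence 1: "f i x * dir_deriv q x ?v + b j i * q x = dir_deriv a x ?v"
        using i by (simp add: deps_pexp_at[OF aq(1)] deps_pexp_at[OF aq(2)] vH dre_peval peval_pexp_at[OF aq(2)]) (simp add: H_def)
      have "dir_deriv (\<lambda>x. f i x * q x) x ?v = dir_deriv a x ?v"
        by (rule dir_deriv_cong_open[OF oD xD]) (use aq(3) in auto)
      hence "dir_deriv (f i) x ?v * q x + dir_deriv q x ?v * f i x = dir_deriv a x ?v"
        by (simp add: dir_deriv_mult[OF f[OF i] is_poly_rational_on[OF aq(2)] oD xD])
      hence "dir_deriv (f i) x ?v * q x = b j i * q x" by (rule cancel_middle) (rule 1)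
      thus ?thesis using aq(3) xD b(2) i by simp
    qed
    thus ?thesis using W' by (intro exI[of _ "\<lambda>j. vec_at k (b j)"]) auto
  qed
  show ?thesis
  proof (intro exI[of _ "\<lambda>x. peval (H x) \<epsilon>"] conjI ballI impI)
    show "rational_on {x. \<delta> x \<noteq> 0} (\<lambda>x. peval (H x) \<epsilon>)"
      by (rule rational_on_peval[OF \<epsilon>(1)]) (use rH D_def in auto)
    show "\<exists>x\<in>S. peval (H x) \<epsilon> \<noteq> 0" using \<epsilon>(2) by (auto simp: vanishes_def)
  qed (rule main)
qed

lemma card_le_dim_dual_family:
  fixes v :: "nat \<Rightarrow> complex^'n"
  assumes "vec.subspace W" "\<And>j. j < k \<Longrightarrow> v j \<in> W"
    and "\<And>i j. i < k \<Longrightarrow> j < k \<Longrightarrow> pairing (g i) (v j) = (if i = j then 1 else 0)"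
  shows "k \<le> vec.dim W"
proof (rule card_le_dim_family[OF assms(1,2)])
  fix l i assume s: "(\<Sum>j<k. l j *s v j) = 0" and i: "i < k"
  have "0 = pairing (g i) (\<Sum>j<k. l j *s v j)" by (simp add: s)
  also have "\<dots> = (\<Sum>j<k. if j = i then l j else 0)"
    unfolding pairing_sum_right pairing_scale_right by (intro sum.cong) (use i assms(3) in auto)
  finally show "l i = 0" using i by simp
qed auto

definition jacobian :: "(complex^'n \<Rightarrow> complex^'m) \<Rightarrow> complex^'n \<Rightarrow> complex^'n \<Rightarrow> complex^'m" where
  "jacobian \<Psi> x v = (\<chi> i. dir_deriv (\<lambda>y. \<Psi> y $ i) x v)"

lemma jacobian_nth [simp]: "jacobian \<Psi> x v $ i = dir_deriv (\<lambda>y. \<Psi> y $ i) x v"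
  by (simp add: jacobian_def)

text \<open>Dominance enters here: a relation that holds after composition with \<psi> holds on all
  of Y.\<close>

lemma transc_pullback:
  fixes f :: "nat \<Rightarrow> complex^'n \<Rightarrow> complex"
  assumes f: "\<And>j. j \<le> i \<Longrightarrow> is_poly (f j)" and tr: "transc Y (\<lambda>x i. f i x) i" and im: "\<psi> ` S \<subseteq> Y"
    and dense: "\<And>g. is_poly g \<Longrightarrow> (\<And>x. x \<in> S \<Longrightarrow> g (\<psi> x) = 0) \<Longrightarrow> \<forall>y\<in>Y. g y = 0"
  shows "transc S (\<lambda>x i. f i (\<psi> x)) i"
  unfolding transc_def
proof (intro allI impI)
  fix d q j assume r: "relation S (\<lambda>x i. f i (\<psi> x)) i d q" and j: "j < d"
  have "relation Y (\<lambda>x i. f i x) i d q"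
    unfolding relation_def
  proof (intro conjI)
    show "\<forall>j<d. vars_below i (q j)" using r by (simp add: relation_def)
    have "is_poly (\<lambda>y. \<Sum>j<d. peval (\<lambda>i. f i y) (q j) * f i y ^ j)"
      using r f by (intro is_poly_sum is_poly.mult is_poly_power is_poly_peval[of i]) (auto simp: relation_def)
    thus "\<forall>y\<in>Y. (\<Sum>j<d. peval (\<lambda>i. f i y) (q j) * f i y ^ j) = 0"
      by (rule dense) (use r in \<open>simp add: relation_def\<close>)
  qed
  hence "vanishes Y (\<lambda>x i. f i x) (q j)" using tr j by (simp add: transc_def)
  thus "vanishes S (\<lambda>x i. f i (\<psi> x)) (q j)" using im by (auto simp: vanishes_def)
qed

text \<open>A polynomial vanishing on Z is zero along the image of the line through x in direction
  v; only this line has to map into Z.\<close>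

lemma jacobian_tangent:
  fixes \<Psi> :: "complex^'n \<Rightarrow> complex^'n"
  assumes D: "open D" "\<And>i. rational_on D (\<lambda>x. \<Psi> x $ i)" and x: "x \<in> D"
    and Z: "\<And>s. x + s *s v \<in> D \<Longrightarrow> \<Psi> (x + s *s v) \<in> Z"
  shows "jacobian \<Psi> x v \<in> tangent_space Z (\<Psi> x)"
  unfolding tangent_space_def
proof (intro CollectI allI impI)
  fix g assume g: "is_poly g \<and> (\<forall>y\<in>Z. g y = 0)"
  have "eventually (\<lambda>s. g (\<Psi> (x + s *s v)) = 0) (nhds 0)"
    using open_line_nhds[OF D(1) x, of v] by eventually_elim (use Z g in auto)
  hence "dir_deriv (\<lambda>y. g (\<Psi> y)) x v = dir_deriv (\<lambda>y. 0) x v"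
    unfolding dir_deriv_def by (rule deriv_cong_ev) simp
  moreover have "dir_deriv (\<lambda>y. g (\<Psi> y)) x v = dir_deriv g (\<Psi> x) (jacobian \<Psi> x v)"
    unfolding jacobian_def by (rule chain_rule[OF _ D(2,1) x]) (use g in simp)
  ultimately show "dir_deriv g (\<Psi> x) (jacobian \<Psi> x v) = 0" by simp
qed

lemma jacobian_linear:
  assumes "open D" "\<And>i. rational_on D (\<lambda>x. \<Psi> x $ i)" "x \<in> D"
  shows "jacobian \<Psi> x (\<Sum>j\<in>A. l j *s v j) = (\<Sum>j\<in>A. l j *s jacobian \<Psi> x (v j))"
  by (simp add: vec_eq_iff dir_deriv_grad[OF assms(2,1,3)] pairing_sum_right pairing_scale_right)

text \<open>The domain is a principal open set, hence an affine slice with W the whole space;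
  dominance is stated through polynomials, the form in which it is used.\<close>

locale parametrization =
  fixes C :: "(complex^'n) set" and \<delta> :: "complex^'n \<Rightarrow> complex" and \<Psi> :: "complex^'n \<Rightarrow> complex^'n" and D
  assumes C: "irreducible_variety C" and \<delta>: "is_poly \<delta>" and D_def: "D = {x. \<delta> x \<noteq> 0}" and D_ne: "D \<noteq> {}"
    and rational_on: "\<And>i. rational_on D (\<lambda>x. \<Psi> x $ i)" and image: "\<And>x. x \<in> D \<Longrightarrow> \<Psi> x \<in> C"
    and dense: "\<And>g. is_poly g \<Longrightarrow> (\<And>x. x \<in> D \<Longrightarrow> g (\<Psi> x) = 0) \<Longrightarrow> \<forall>y\<in>C. g y = 0"
begin

lemma open_D: "open D"
  unfolding D_def by (rule open_basic[OF \<delta>])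

lemma D_slice: "D = {x. x - 0 \<in> UNIV \<and> \<delta> x \<noteq> 0}"
  by (simp add: D_def)

lemma D_common_nonzero:
  assumes "rational_on D f" "rational_on D g" "x \<in> D" "f x \<noteq> 0" "y \<in> D" "g y \<noteq> 0"
  shows "\<exists>z\<in>D. f z \<noteq> 0 \<and> g z \<noteq> 0"
  using affine_slice_domain[OF \<delta> vec.subspace_UNIV D_slice, of f g x y] assms D_def by blast

text \<open>The chain consists of the closures of the images of a flag of affine slices through u.\<close>
lemma slice_chain:
  assumes c: "alg_indep C k (\<lambda>i x. x $ c i)" and u: "u \<in> D"
    and v: "\<And>i j. i < k \<Longrightarrow> dir_deriv (\<lambda>x. \<Psi> x $ c i) u (v j) = (if i = j then 1 else 0)"
  shows "k \<in> chains C"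
proof -
  define W where "W i = vec.span (v ` {..<i})" for i :: nat
  define S where "S i = {x. x - u \<in> W i \<and> \<delta> x \<noteq> 0}" for i
  define Z where "Z i = zclosure (\<Psi> ` S i)" for i
  have W: "vec.subspace (W i)" for i unfolding W_def by (rule vec.subspace_span)
  have uS: "u \<in> S i" for i using u W vec.subspace_0[OF W] by (simp add: S_def D_def)
  have SD: "S i \<subseteq> D" for i by (auto simp: S_def D_def)
  have vanish: "is_poly g \<Longrightarrow> (\<And>x. x \<in> S i \<Longrightarrow> g (\<Psi> x) = 0) \<Longrightarrow> \<forall>y\<in>Z i. g y = 0" for g i
    unfolding Z_def using zclosure_vanish[of g "\<Psi> ` S i"] by blast
  have domS: "\<exists>z\<in>S i. f z \<noteq> 0 \<and> g z \<noteq> 0"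
    if "rational_on D f" "rational_on D g" "x \<in> S i" "f x \<noteq> 0" "y \<in> S i" "g y \<noteq> 0" for f g x y i
    using affine_slice_domain[OF \<delta> W S_def, of f g x _ y] that D_def by blast
  have irr: "irreducible_variety (Z i)" for i
    unfolding irreducible_variety_def
  proof (intro conjI allI impI)
    show "zclosed (Z i)" unfolding Z_def by (rule zclosed_zclosure)
    show "Z i \<noteq> {}" using zclosure_superset[of "\<Psi> ` S i"] uS unfolding Z_def by blast
    fix A B assume AB: "zclosed A \<and> zclosed B \<and> Z i \<subseteq> A \<union> B"
    show "Z i \<subseteq> A \<or> Z i \<subseteq> B"
    proof (rule ccontr)
      assume "\<not> (Z i \<subseteq> A \<or> Z i \<subseteq> B)"
      hence "\<not> \<Psi> ` S i \<subseteq> A" "\<not> \<Psi> ` S i \<subseteq> B" using AB zclosure_minimal unfolding Z_def by blast+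
      then obtain x y where xy: "x \<in> S i" "\<Psi> x \<notin> A" "y \<in> S i" "\<Psi> y \<notin> B" by blast
      obtain f where f: "is_poly f" "\<forall>z\<in>A. f z = 0" "f (\<Psi> x) \<noteq> 0" using zclosed_separate AB xy by blast
      obtain g where g: "is_poly g" "\<forall>z\<in>B. g z = 0" "g (\<Psi> y) \<noteq> 0" using zclosed_separate AB xy by blast
      obtain z where z: "z \<in> S i" "f (\<Psi> z) \<noteq> 0" "g (\<Psi> z) \<noteq> 0"
        using domS[OF is_poly_rational_on_comp[OF f(1) rational_on] is_poly_rational_on_comp[OF g(1) rational_on] xy(1) f(3) xy(3) g(3)] by blast
      have "\<Psi> z \<in> Z i" using z(1) zclosure_superset[of "\<Psi> ` S i"] by (auto simp: Z_def)
      thus False using AB f(2) g(2) z by blast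
    qed
  qed
  have kn: "k \<le> CARD('n)"
    using alg_indep_le_tangent_dim[OF C c image[OF u]] dim_le_CARD[of "tangent_space C (\<Psi> u)"] by linarith
  \<comment> \<open>As the closure of the image of a slice spanned by i directions, Z i has tangent
    dimension at most i at a general point. If it were equal to Z (Suc i), the directions v 0, ...,
    v i would produce i + 1 independent tangent vectors there.\<close>
  have strict: "Z i \<subset> Z (Suc i)" if i: "i < k" for i
  proof
    have "W i \<subseteq> W (Suc i)" unfolding W_def by (rule vec.span_mono) auto
    thus "Z i \<subseteq> Z (Suc i)" unfolding Z_def by (intro zclosure_mono) (auto simp: S_def)
    show "Z i \<noteq> Z (Suc i)"
    proof
      assume "Z i = Z (Suc i)"
      hence eq: "Z (Suc i) = Z i" by simp
      obtain k' c' p where K: "alg_indep (Z i) k' (\<lambda>i x. x $ c' i)" "p \<in> Z i" "vec.dim (tangent_space (Z i) p) \<le> k'"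
        using ex_transcendence_coords[OF irr[of i]] by blast
      have tr: "transc (S i) (\<lambda>x l. \<Psi> x $ c' l) m" if "m < k'" for m
      proof (rule transc_pullback[of m "\<lambda>l x. x $ c' l" "Z i" \<Psi> "S i"])
        show "transc (Z i) (\<lambda>x l. x $ c' l) m" using K(1) that by (simp add: alg_indep_def)
        show "\<Psi> ` S i \<subseteq> Z i" using zclosure_superset[of "\<Psi> ` S i"] by (simp add: Z_def)
      qed (use vanish[of _ i] in \<open>auto intro: is_poly.coord\<close>)
      have "S i \<noteq> {}" using uS by blast
      from rational_on_tangent_basis[OF \<delta> W S_def this, of k' "\<lambda>l x. \<Psi> x $ c' l"] tr rational_on
      obtain x w where x: "x \<in> S i" and w: "\<And>j. w j \<in> W i"
        "\<And>j l. l < k' \<Longrightarrow> dir_deriv (\<lambda>x. \<Psi> x $ c' l) x (w j) = (if l = j then 1 else 0)"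
        unfolding D_def by blast
      have "x \<in> D" using x SD by blast
      \<comment> \<open>Transcendence coordinates of Z i pull back to independent functions on the
        slice, with dual directions inside W i.\<close>
      have "k' \<le> vec.dim (W i)"
        by (rule card_le_dim_dual_family[OF W, where v = w and g = "\<lambda>l. grad (\<lambda>x. \<Psi> x $ c' l) x"])
           (use w dir_deriv_grad[OF rational_on open_D \<open>x \<in> D\<close>] in auto)
      also have "\<dots> \<le> card (v ` {..<i})" unfolding W_def by (rule vec.dim_le_card) auto
      also have "\<dots> \<le> i" using card_image_le[of "{..<i}" v] by simp
      finally have k'i: "k' \<le> i" .
      obtain \<mu> where \<mu>: "is_poly \<mu>" "\<mu> p \<noteq> 0" "\<And>q. \<mu> q \<noteq> 0 \<Longrightarrow> vec.dim (tangent_space (Z i) q) \<le> i"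
        using tangent_dim_semicontinuous[of p "Z i"] K(3) k'i by (meson order.trans)
      have "\<exists>x\<in>S (Suc i). \<mu> (\<Psi> x) \<noteq> 0" using vanish[OF \<mu>(1), of "Suc i"] K(2) \<mu>(2) eq by blast
      then obtain y where y: "y \<in> S (Suc i)" "\<mu> (\<Psi> y) \<noteq> 0" by blast
      \<comment> \<open>The minor of the Jacobian for the coordinates c 0, ..., c i and the
        directions v 0, ..., v i, padded by the identity to full size. At u it is the identity, so
        its determinant is generically nonzero.\<close>
      define A where "A x = (\<chi> a b. if index a \<le> i \<and> index b \<le> i then dir_deriv (\<lambda>x. \<Psi> x $ c (index a)) x (v (index b))
           else if a = b then 1 else 0 :: complex^'n^'n)" for x
      have "A u = mat 1" unfolding A_def mat_def
        using v i inj_index by (auto simp: vec_eq_iff inj_def)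
      hence "det (A u) \<noteq> 0" by (simp add: det_I)
      moreover have "rational_on D (\<lambda>x. det (A x))"
      proof (rule rational_on_det)
        fix a b show "rational_on D (\<lambda>x. A x $ a $ b)"
          by (cases "index a \<le> i \<and> index b \<le> i") (auto simp: A_def intro: rational_on.const rational_on_dir_deriv[OF rational_on open_D])
      qed
      ultimately obtain z where z: "z \<in> S (Suc i)" "det (A z) \<noteq> 0" "\<mu> (\<Psi> z) \<noteq> 0"
        using domS[OF _ is_poly_rational_on_comp[OF \<mu>(1) rational_on] uS _ y] by blast
      have zD: "z \<in> D" using z SD by blast
      have "Suc i \<le> vec.dim (tangent_space (Z i) (\<Psi> z))"
      proof (rule card_le_dim_family[OF tangent_subspace, of _ "\<lambda>j. jacobian \<Psi> z (v j)"])
        fix j assume j: "j < Suc i"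
        have vj: "v j \<in> W (Suc i)" unfolding W_def using j by (intro vec.span_base) auto
        show "jacobian \<Psi> z (v j) \<in> tangent_space (Z i) (\<Psi> z)"
        proof (rule jacobian_tangent[OF open_D rational_on zD])
          fix s assume s: "z + s *s v j \<in> D"
          have "(z - u) + s *s v j \<in> W (Suc i)"
            using z(1) vj by (intro vec.subspace_add[OF W] vec.subspace_scale[OF W]) (auto simp: S_def)
          hence "z + s *s v j \<in> S (Suc i)" using s by (simp add: S_def D_def algebra_simps)
          thus "\<Psi> (z + s *s v j) \<in> Z i" using zclosure_superset[of "\<Psi> ` S (Suc i)"] unfolding eq[symmetric] by (auto simp: Z_def)
        qed
      next
        fix l m assume l: "(\<Sum>j<Suc i. l j *s jacobian \<Psi> z (v j)) = 0" and m: "m < Suc i"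
        define lv where "lv = (\<chi> b::'n. if index b \<le> i then l (index b) else 0)"
        have "A z *v lv = 0"
        proof -
          have "(A z *v lv) $ a = 0" for a
          proof (cases "index a \<le> i")
            case True
            have "(A z *v lv) $ a = (\<Sum>b\<in>UNIV. A z $ a $ b * lv $ b)" by (simp add: matrix_vector_mult_def)
            also have "\<dots> = (\<Sum>b\<in>(UNIV::'n set). if index b \<le> i then dir_deriv (\<lambda>x. \<Psi> x $ c (index a)) z (v (index b)) * l (index b) else 0)"
              by (rule sum.cong[OF refl]) (use True in \<open>auto simp: A_def lv_def\<close>)
            also have "\<dots> = (\<Sum>j<CARD('n). if j \<le> i then dir_deriv (\<lambda>x. \<Psi> x $ c (index a)) z (v j) * l j else 0)"
              using bij_index by (rule sum.reindex_bij_betw)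
            also have "\<dots> = (\<Sum>j<Suc i. dir_deriv (\<lambda>x. \<Psi> x $ c (index a)) z (v j) * l j)"
              using i kn by (intro sum.mono_neutral_cong_right) auto
            also have "\<dots> = (\<Sum>j<Suc i. l j *s jacobian \<Psi> z (v j)) $ c (index a)" by (simp add: mult.commute)
            also have "\<dots> = 0" by (simp only: l zero_index)
            finally show ?thesis .
          next
            case False
            have "(A z *v lv) $ a = (\<Sum>b\<in>UNIV. A z $ a $ b * lv $ b)" by (simp add: matrix_vector_mult_def)
            also have "\<dots> = (\<Sum>b\<in>UNIV. if a = b then lv $ b else 0)"
              by (rule sum.cong[OF refl]) (use False in \<open>auto simp: A_def\<close>)
            finally show ?thesis using False by (simp add: lv_def)
          qed
          thus ?thesis by (simp add: vec_eq_iff)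
        qed
        hence "lv = 0" by (rule det_nz_solve(2)[OF z(2)])
        hence "lv $ (coord_at m) = 0" by simp
        moreover have "index (coord_at m :: 'n) = m" using m i kn by (intro index_coord_at) simp
        ultimately show "l m = 0" using m by (simp add: lv_def)
      qed
      with \<mu>(3)[OF z(3)] show False by simp
    qed
  qed
  have "Z k \<subseteq> C" unfolding Z_def
    using C image SD by (intro zclosure_minimal) (auto simp: irreducible_variety_def)
  thus ?thesis using irr strict unfolding chains_def by blast
qed

text \<open>The number k of transcendence coordinates bounds the tangent dimension from above at
  general points, hence also \<open>zdim C\<close>, while \<open>slice_chain\<close> bounds
  \<open>zdim C\<close> from below by k. So general image points are smooth, and k dual directions
  make d\<Psi> onto the tangent space.\<close>

lemma generic_submersion:
  "\<exists>\<gamma>. rational_on D \<gamma> \<and> (\<exists>x\<in>D. \<gamma> x \<noteq> 0) \<and> (\<forall>x\<in>D. \<gamma> x \<noteq> 0 \<longrightarrow>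
     \<Psi> x \<in> smooth_points C \<and> tangent_space C (\<Psi> x) = range (jacobian \<Psi> x))"
proof -
  obtain k c p where K: "alg_indep C k (\<lambda>i x. x $ c i)" "p \<in> C" "vec.dim (tangent_space C p) \<le> k"
    using ex_transcendence_coords[OF C] by blast
  have tr: "transc D (\<lambda>x l. \<Psi> x $ c l) m" if "m < k" for m
  proof (rule transc_pullback[of m "\<lambda>l x. x $ c l" C \<Psi> D])
    show "transc C (\<lambda>x l. x $ c l) m" using K(1) that by (simp add: alg_indep_def)
    show "\<Psi> ` D \<subseteq> C" using image by auto
  qed (use dense in \<open>auto intro: is_poly.coord\<close>)
  from rational_on_tangent_basis[OF \<delta> vec.subspace_UNIV D_slice D_ne, of k "\<lambda>l x. \<Psi> x $ c l"] tr rational_on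
  obtain \<gamma> where \<gamma>: "rational_on D \<gamma>" "\<exists>x\<in>D. \<gamma> x \<noteq> 0" "\<And>x. x \<in> D \<Longrightarrow> \<gamma> x \<noteq> 0 \<Longrightarrow>
      \<exists>v. \<forall>j. \<forall>i<k. dir_deriv (\<lambda>x. \<Psi> x $ c i) x (v j) = (if i = j then 1 else 0)"
    unfolding D_def by blast
  obtain \<mu> where \<mu>: "is_poly \<mu>" "\<mu> p \<noteq> 0" "\<And>q. \<mu> q \<noteq> 0 \<Longrightarrow> vec.dim (tangent_space C q) \<le> k"
    using tangent_dim_semicontinuous[of p C] K(3) by (meson order.trans)
  have "\<exists>x\<in>D. \<mu> (\<Psi> x) \<noteq> 0" using dense[OF \<mu>(1)] K(2) \<mu>(2) by blast
  then obtain x0 where x0: "x0 \<in> D" "\<mu> (\<Psi> x0) \<noteq> 0" by blast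
  have r\<mu>: "rational_on D (\<lambda>x. \<mu> (\<Psi> x))" by (rule is_poly_rational_on_comp[OF \<mu>(1) rational_on])
  have zd: "zdim C = k"
  proof (rule antisym)
    show "zdim C \<le> k" using zdim_le_tangent_dim[OF C K(2)] K(3) by simp
    obtain u where "u \<in> D" "\<gamma> u \<noteq> 0" using \<gamma>(2) by blast
    with \<gamma>(3)[OF this] slice_chain[OF K(1)] have "k \<in> chains C" by blast
    thus "k \<le> zdim C" by (rule chain_le_zdim[OF C])
  qed
  have main: "\<Psi> x \<in> smooth_points C \<and> tangent_space C (\<Psi> x) = range (jacobian \<Psi> x)"
    if x: "x \<in> D" and nz: "\<gamma> x * \<mu> (\<Psi> x) \<noteq> 0" for x
  proof -
    let ?T = "tangent_space C (\<Psi> x)"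
    obtain v where v: "\<And>j i. i < k \<Longrightarrow> dir_deriv (\<lambda>x. \<Psi> x $ c i) x (v j) = (if i = j then 1 else 0)"
      using \<gamma>(3)[OF x] nz by auto
    have le: "vec.dim ?T \<le> k" using \<mu>(3) nz by simp
    have jT: "jacobian \<Psi> x w \<in> ?T" for w
      by (rule jacobian_tangent[OF open_D rational_on x]) (rule image)
    have "vec.dim ?T = k"
      using le alg_indep_le_tangent_dim[OF C K(1) image[OF x]] by simp
    hence "\<Psi> x \<in> smooth_points C" using zd image[OF x] by (simp add: smooth_points_def)
    moreover have "?T \<subseteq> range (jacobian \<Psi> x)"
    proof
      fix t assume t: "t \<in> ?T"
      \<comment> \<open>Corrected to have zero components along the chosen coordinates; if nonzero,
        it would be one independent tangent vector too many.\<close>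
      define t' where "t' = t - (\<Sum>j<k. t $ c j *s jacobian \<Psi> x (v j))"
      have t'T: "t' \<in> ?T" unfolding t'_def
        by (intro vec.subspace_diff vec.subspace_sum vec.subspace_scale tangent_subspace t jT)
      have t'0: "t' $ c i = 0" if "i < k" for i
        using that by (simp add: t'_def v if_distrib cong: if_cong)
      have "t' = 0"
      proof (rule ccontr)
        assume nz': "t' \<noteq> 0"
        have "Suc k \<le> vec.dim ?T"
        proof (rule card_le_dim_family[OF tangent_subspace, of _ "\<lambda>j. if j < k then jacobian \<Psi> x (v j) else t'"])
          fix l i assume s: "(\<Sum>j<Suc k. l j *s (if j < k then jacobian \<Psi> x (v j) else t')) = 0" and i: "i < Suc k"
          have s': "(\<Sum>j<k. l j *s jacobian \<Psi> x (v j)) + l k *s t' = 0" using s by simp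
          have li: "l i = 0" if i: "i < k" for i
          proof -
            have "0 = ((\<Sum>j<k. l j *s jacobian \<Psi> x (v j)) + l k *s t') $ c i" by (simp add: s')
            also have "\<dots> = l i" using i by (simp add: t'0 v if_distrib cong: if_cong)
            finally show ?thesis by simp
          qed
          hence "l k *s t' = 0" using s' by simp
          hence "l k = 0" using nz' by (simp add: vector_mul_eq_0)
          thus "l i = 0" using li i by (auto simp: less_Suc_eq)
        qed (use jT t'T in auto)
        thus False using le by simp
      qed
      hence "t = (\<Sum>j<k. t $ c j *s jacobian \<Psi> x (v j))" by (simp add: t'_def)
      also have "\<dots> = jacobian \<Psi> x (\<Sum>j<k. t $ c j *s v j)" by (rule jacobian_linear[OF open_D rational_on x, symmetric])
      finally show "t \<in> range (jacobian \<Psi> x)" by blast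
    qed
    ultimately show ?thesis using jT by auto
  qed
  show ?thesis
  proof (intro exI[of _ "\<lambda>x. \<gamma> x * \<mu> (\<Psi> x)"] conjI ballI impI)
    show "rational_on D (\<lambda>x. \<gamma> x * \<mu> (\<Psi> x))" by (rule rational_on.mult[OF \<gamma>(1) r\<mu>])
    show "\<exists>x\<in>D. \<gamma> x * \<mu> (\<Psi> x) \<noteq> 0" using D_common_nonzero[OF \<gamma>(1) r\<mu> _ _ x0] \<gamma>(2) by force
  qed (use main in auto)
qed

end

section \<open>Lines in the fibres\<close>

text \<open>Polynomials are Lipschitz on balls; applied to the vector field in the Gronwall
  estimate.\<close>

lemma is_poly_lipschitz:
  assumes "is_poly f"
  shows "\<exists>L\<ge>0. \<forall>a b. norm a \<le> R \<longrightarrow> norm b \<le> R \<longrightarrow> norm (f a - f b) \<le> L * norm (a - b)"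
  using assms
proof (induction rule: is_poly.induct)
  case (const c) show ?case by (intro exI[of _ 0]) auto
next
  case (coord i)
  show ?case
    by (intro exI[of _ 1] conjI allI impI) (auto simp: vector_minus_component[symmetric] intro: Finite_Cartesian_Product.norm_nth_le simp del: vector_minus_component)
next
  case (add f g)
  then obtain L M where LM: "L \<ge> 0" "\<And>a b. norm a \<le> R \<Longrightarrow> norm b \<le> R \<Longrightarrow> norm (f a - f b) \<le> L * norm (a - b)"
    "M \<ge> 0" "\<And>a b. norm a \<le> R \<Longrightarrow> norm b \<le> R \<Longrightarrow> norm (g a - g b) \<le> M * norm (a - b)" by blast
  show ?case
  proof (intro exI[of _ "L + M"] conjI allI impI)
    fix a b :: "complex^'a" assume ab: "norm a \<le> R" "norm b \<le> R"
    have "norm (f a + g a - (f b + g b)) = norm ((f a - f b) + (g a - g b))" by (simp add: algebra_simps)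
    also have "\<dots> \<le> norm (f a - f b) + norm (g a - g b)" by (rule norm_triangle_ineq)
    also have "\<dots> \<le> (L + M) * norm (a - b)" using LM(2)[OF ab] LM(4)[OF ab] by (simp add: algebra_simps)
    finally show "norm (f a + g a - (f b + g b)) \<le> (L + M) * norm (a - b)" .
  qed (use LM in simp)
next
  case (mult f g)
  then obtain L M where LM: "L \<ge> 0" "\<And>a b. norm a \<le> R \<Longrightarrow> norm b \<le> R \<Longrightarrow> norm (f a - f b) \<le> L * norm (a - b)"
    "M \<ge> 0" "\<And>a b. norm a \<le> R \<Longrightarrow> norm b \<le> R \<Longrightarrow> norm (g a - g b) \<le> M * norm (a - b)" by blast
  have bd: "\<exists>B\<ge>0. \<forall>a. norm a \<le> R \<longrightarrow> norm (h a) \<le> B" if "is_poly h" for h :: "complex^'a \<Rightarrow> complex"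
  proof -
    have "compact (h ` cball 0 R)"
      by (intro compact_continuous_image is_poly_continuous that compact_cball)
    hence "bounded (h ` cball 0 R)" by (rule compact_imp_bounded)
    then obtain B where B: "B > 0" "\<forall>y\<in>h ` cball 0 R. norm y \<le> B" by (auto simp: bounded_pos)
    thus ?thesis by (intro exI[of _ B]) auto
  qed
  obtain A where A: "A \<ge> 0" "\<And>a. norm a \<le> R \<Longrightarrow> norm (f a) \<le> A" using bd[OF mult.hyps(1)] by blast
  obtain B where B: "B \<ge> 0" "\<And>a. norm a \<le> R \<Longrightarrow> norm (g a) \<le> B" using bd[OF mult.hyps(2)] by blast
  show ?case
  proof (intro exI[of _ "A * M + L * B"] conjI allI impI)
    fix a b :: "complex^'a" assume ab: "norm a \<le> R" "norm b \<le> R"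
    have "norm (f a * g a - f b * g b) = norm (f a * (g a - g b) + (f a - f b) * g b)" by (simp add: algebra_simps)
    also have "\<dots> \<le> norm (f a) * norm (g a - g b) + norm (f a - f b) * norm (g b)"
      by (metis norm_mult norm_triangle_ineq)
    also have "\<dots> \<le> A * (M * norm (a - b)) + (L * norm (a - b)) * B"
      using LM A B ab by (intro add_mono mult_mono) auto
    finally show "norm (f a * g a - f b * g b) \<le> (A * M + L * B) * norm (a - b)" by (simp add: algebra_simps)
  qed (use LM A B in simp)
qed

lemma rational_on_has_deriv_at:
  assumes "rational_on D f" "open D" "u + s *s v \<in> D"
  shows "((\<lambda>s. f (u + s *s v)) has_field_derivative dir_deriv f (u + s *s v) v) (at s)"
proof -
  have "((\<lambda>h. f ((u + s *s v) + h *s v)) has_field_derivative dir_deriv f (u + s *s v) v) (at 0)"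
    by (rule rational_on_has_deriv[OF assms])
  moreover have "(\<lambda>h. f ((u + s *s v) + h *s v)) = (\<lambda>h. f (u + (h + s) *s v))"
    by (intro ext arg_cong[of _ _ f]) (simp add: vec_eq_iff algebra_simps)
  ultimately show ?thesis
    using DERIV_shift[of "\<lambda>s. f (u + s *s v)" "dir_deriv f (u + s *s v) v" 0 s] by simp
qed

lemma continuous_on_line: "continuous_on A (\<lambda>s::complex. u + s *s v)"
proof -
  have "(\<lambda>s::complex. u + s *s v) = (\<lambda>s. \<chi> i. u $ i + s * v $ i)"
    by (simp add: vec_eq_iff fun_eq_iff)
  thus ?thesis by (simp only:) (intro continuous_on_vec_lambda continuous_intros)
qed

lemma continuous_on_vecI: "(\<And>i. continuous_on A (\<lambda>x. f x $ i)) \<Longrightarrow> continuous_on A f"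
  using continuous_on_vec_lambda[of A "\<lambda>i x. f x $ i"] by simp

text \<open>A Gronwall-type argument: along the line \<open>u + s v\<close> the derivative of \<open>\<Psi>\<close> is bounded by
  the distance to the value at \<open>s = 0\<close>.\<close>
lemma locally_constant_on_line:
  fixes \<Psi> :: "complex^'n \<Rightarrow> complex^'n" and V :: "complex^'n \<Rightarrow> complex^'n"
  assumes D: "open D" and r: "\<And>i. rational_on D (\<lambda>x. \<Psi> x $ i)" and u: "u \<in> D"
    and V: "\<And>i. is_poly (\<lambda>p. V p $ i)" and kill: "\<And>x. x \<in> D \<Longrightarrow> jacobian \<Psi> x (V (\<Psi> x)) = 0"
  shows "\<exists>\<epsilon>>0. \<forall>s. norm s < \<epsilon> \<longrightarrow> u + s *s V (\<Psi> u) \<in> D \<and> \<Psi> (u + s *s V (\<Psi> u)) = \<Psi> u"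
proof -
  define v where "v = V (\<Psi> u)"
  define y where "y s = u + s *s v" for s :: complex
  have y0: "y 0 = u" by (simp add: y_def)
  have cy: "continuous_on A y" for A unfolding y_def by (rule continuous_on_line)
  have "open (y -` D)" by (rule open_vimage[OF D cy])
  moreover have "0 \<in> y -` D" using u y0 by simp
  ultimately obtain e0 where e0: "e0 > 0" "cball 0 e0 \<subseteq> y -` D" using open_contains_cball by blast
  have yD: "y s \<in> D" if "norm s \<le> e0" for s using e0(2) that by auto
  have c\<Psi>: "continuous_on D \<Psi>" by (rule continuous_on_vecI[OF rational_on_continuous[OF r D]])
  have c\<Psi>y: "continuous_on (cball 0 e0) (\<lambda>s. \<Psi> (y s))"
    by (rule continuous_on_compose2[OF c\<Psi> cy]) (use yD in auto)
  have "bounded ((\<lambda>s. \<Psi> (y s)) ` cball 0 e0)"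
    by (intro compact_imp_bounded compact_continuous_image c\<Psi>y compact_cball)
  then obtain R where "\<forall>z\<in>(\<lambda>s. \<Psi> (y s)) ` cball 0 e0. norm z \<le> R" unfolding bounded_iff by blast
  hence R: "norm (\<Psi> (y s)) \<le> R" if "norm s \<le> e0" for s using that by simp
  have "\<forall>j. \<exists>L\<ge>0. \<forall>a b. norm a \<le> R \<longrightarrow> norm b \<le> R \<longrightarrow> norm (V a $ j - V b $ j) \<le> L * norm (a - b)"
    using is_poly_lipschitz[OF V] by blast
  then obtain L where L: "\<And>j. L j \<ge> 0"
    "\<And>j a b. norm a \<le> R \<Longrightarrow> norm b \<le> R \<Longrightarrow> norm (V a $ j - V b $ j) \<le> L j * norm (a - b)" by metis
  have "\<exists>K\<ge>0. \<forall>s. norm s \<le> e0 \<longrightarrow> norm (dir_deriv (\<lambda>x. \<Psi> x $ i) (y s) (axis j 1)) \<le> K" for i j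
  proof -
    have "continuous_on (cball 0 e0) (\<lambda>s. dir_deriv (\<lambda>x. \<Psi> x $ i) (y s) (axis j 1))"
      by (rule continuous_on_compose2[OF rational_on_continuous[OF rational_on_dir_deriv[OF r D] D] cy]) (use yD in auto)
    hence "bounded ((\<lambda>s. dir_deriv (\<lambda>x. \<Psi> x $ i) (y s) (axis j 1)) ` cball 0 e0)"
      by (intro compact_imp_bounded compact_continuous_image compact_cball)
    then obtain K where "K > 0" "\<forall>z\<in>(\<lambda>s. dir_deriv (\<lambda>x. \<Psi> x $ i) (y s) (axis j 1)) ` cball 0 e0. norm z \<le> K"
      by (auto simp: bounded_pos)
    thus ?thesis by (intro exI[of _ K]) auto
  qed
  then obtain K where K: "\<And>i j. K i j \<ge> 0"
    "\<And>i j s. norm s \<le> e0 \<Longrightarrow> norm (dir_deriv (\<lambda>x. \<Psi> x $ i) (y s) (axis j 1)) \<le> K i j" by metis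
  \<comment> \<open>K bounds the partial derivatives of \<Psi> and L the variation of V, so Q times
    the largest deviation bounds the speed of \<Psi>. The radius e is chosen to make Q e <
    1.\<close>
  define Q where "Q = (\<Sum>i\<in>UNIV. \<Sum>j\<in>UNIV. K i j * L j)"
  have Q0: "Q \<ge> 0" unfolding Q_def using K L by (intro sum_nonneg mult_nonneg_nonneg)
  define e where "e = min e0 (1 / (2 * (Q + 1)))"
  have e: "e > 0" "e \<le> e0" using e0 Q0 by (auto simp: e_def)
  have eQ: "Q * e < 1"
  proof -
    have "Q * e \<le> Q * (1 / (2 * (Q + 1)))" using Q0 by (intro mult_left_mono) (auto simp: e_def)
    also have "\<dots> < 1" using Q0 by (simp add: field_simps)
    finally show ?thesis .
  qed
  define E where "E s = norm (\<Psi> (y s) - \<Psi> u)" for s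
  have "continuous_on (cball 0 e) E" unfolding E_def
    by (intro continuous_intros continuous_on_subset[OF c\<Psi>y]) (use e in auto)
  then obtain m where m: "m \<in> cball 0 e" "\<And>s. s \<in> cball 0 e \<Longrightarrow> E s \<le> E m"
    using continuous_attains_sup[of "cball 0 e" E] e(1) by auto
  have comp: "norm (\<Psi> (y m) $ i - \<Psi> u $ i) \<le> (\<Sum>j\<in>UNIV. K i j * L j) * E m * e" for i
  proof -
    have "norm (\<Psi> (y m) $ i - \<Psi> (y 0) $ i) \<le> ((\<Sum>j\<in>UNIV. K i j * L j) * E m) * norm (m - 0)"
    proof (rule field_differentiable_bound[of "cball 0 e"
        "\<lambda>s. \<Psi> (y s) $ i" "\<lambda>s. dir_deriv (\<lambda>x. \<Psi> x $ i) (y s) v"])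
      fix s :: complex assume s: "s \<in> cball 0 e"
      hence s0: "norm s \<le> e0" using e by auto
      show "((\<lambda>s. \<Psi> (y s) $ i) has_field_derivative dir_deriv (\<lambda>x. \<Psi> x $ i) (y s) v) (at s within cball 0 e)"
        unfolding y_def
        by (rule has_field_derivative_at_within[OF rational_on_has_deriv_at[OF r D]]) (use yD[OF s0] in \<open>simp add: y_def\<close>)
      \<comment> \<open>The direction V (\<Psi> (y s)) contributes nothing, so v may be replaced by
        its difference from it, which is small when \<Psi> (y s) is close to \<Psi> u.\<close>
      have "jacobian \<Psi> (y s) (V (\<Psi> (y s))) $ i = 0" using kill[OF yD[OF s0]] by simp
      hence "dir_deriv (\<lambda>x. \<Psi> x $ i) (y s) v = pairing (grad (\<lambda>x. \<Psi> x $ i) (y s)) (v - V (\<Psi> (y s)))"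
        by (simp add: dir_deriv_grad[OF r D yD[OF s0]] pairing_diff_right)
      also have "norm \<dots> \<le> (\<Sum>j\<in>UNIV. norm (grad (\<lambda>x. \<Psi> x $ i) (y s) $ j * (v - V (\<Psi> (y s))) $ j))"
        unfolding pairing_def by (rule norm_sum)
      also have "\<dots> \<le> (\<Sum>j\<in>UNIV. K i j * (L j * E m))"
      proof (rule sum_mono)
        fix j
        have "norm (V (\<Psi> u) $ j - V (\<Psi> (y s)) $ j) \<le> L j * norm (\<Psi> u - \<Psi> (y s))"
          using R[of 0] R[OF s0] e0 by (intro L(2)) (auto simp: y0)
        also have "\<dots> \<le> L j * E m" using m(2)[OF s] L(1)
          by (intro mult_left_mono) (auto simp: E_def norm_minus_commute)
        finally have "norm ((v - V (\<Psi> (y s))) $ j) \<le> L j * E m" by (simp add: v_def)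
        moreover have "norm (grad (\<lambda>x. \<Psi> x $ i) (y s) $ j) \<le> K i j"
          using K(2)[OF s0] by (simp add: grad_def)
        ultimately show "norm (grad (\<lambda>x. \<Psi> x $ i) (y s) $ j * (v - V (\<Psi> (y s))) $ j) \<le> K i j * (L j * E m)"
          unfolding norm_mult using K(1) by (intro mult_mono) auto
      qed
      also have "\<dots> = (\<Sum>j\<in>UNIV. K i j * L j) * E m" by (simp add: sum_distrib_right mult.assoc)
      finally show "norm (dir_deriv (\<lambda>x. \<Psi> x $ i) (y s) v) \<le> (\<Sum>j\<in>UNIV. K i j * L j) * E m" .
    qed (use m(1) e in auto)
    also have "\<dots> \<le> ((\<Sum>j\<in>UNIV. K i j * L j) * E m) * e"
      using m(1) K(1) L(1) by (intro mult_left_mono mult_nonneg_nonneg sum_nonneg) (auto simp: E_def)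
    finally show ?thesis by (simp add: y0)
  qed
  \<comment> \<open>The largest deviation E m is at most Q e < 1 times itself, hence zero.\<close>
  have "E m \<le> (\<Sum>i\<in>UNIV. norm ((\<Psi> (y m) - \<Psi> u) $ i))" unfolding E_def norm_vec_def by (rule L2_set_le_sum) simp
  also have "\<dots> \<le> (\<Sum>i\<in>UNIV. (\<Sum>j\<in>UNIV. K i j * L j) * E m * e)"
    by (intro sum_mono) (use comp in simp)
  also have "\<dots> = (Q * e) * E m" unfolding Q_def by (simp only: sum_distrib_right[symmetric] mult.assoc mult.commute[of e])
  finally have "E m * (1 - Q * e) \<le> 0" by (simp add: algebra_simps)
  hence "E m \<le> 0" using eQ by (simp add: mult_le_0_iff)
  hence "E s = 0" if "norm s \<le> e" for s using m(2)[of s] that by (simp add: E_def)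
  thus ?thesis using e yD by (intro exI[of _ e]) (auto simp: E_def y_def v_def)
qed

text \<open>The equation with denominators cleared is a polynomial in s with infinitely many roots
  near 0, so it holds at s = 1 too. Intermediate points of the line may leave D.\<close>

lemma constant_on_line:
  fixes \<Psi> :: "complex^'n \<Rightarrow> complex^'n" and V :: "complex^'n \<Rightarrow> complex^'n"
  assumes D: "open D" and r: "\<And>i. rational_on D (\<lambda>x. \<Psi> x $ i)" and u: "u \<in> D"
    and V: "\<And>i. is_poly (\<lambda>p. V p $ i)" and kill: "\<And>x. x \<in> D \<Longrightarrow> jacobian \<Psi> x (V (\<Psi> x)) = 0"
    and uD: "u + V (\<Psi> u) \<in> D"
  shows "\<Psi> (u + V (\<Psi> u)) = \<Psi> u"
proof -
  let ?v = "V (\<Psi> u)"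
  obtain e where e: "e > 0" "\<And>s. norm s < e \<Longrightarrow> u + s *s ?v \<in> D \<and> \<Psi> (u + s *s ?v) = \<Psi> u"
    using locally_constant_on_line[OF D r u V kill] by blast
  have "\<Psi> (u + ?v) $ i = \<Psi> u $ i" for i
  proof -
    obtain a q where aq: "is_poly a" "is_poly q" "\<And>x. x \<in> D \<Longrightarrow> q x \<noteq> 0 \<and> \<Psi> x $ i = a x / q x"
      using rational_on_numden[OF r] by blast
    obtain P where P: "\<And>s. a (u + s *s ?v) + - (\<Psi> u $ i) * q (u + s *s ?v) = poly P s"
      using poly_on_line[of "\<lambda>x. a x + - (\<Psi> u $ i) * q x" u ?v] aq is_poly.add is_poly.mult is_poly.const by blast
    have aq': "a x + - (\<Psi> x $ i) * q x = 0" if "x \<in> D" for x using aq(3)[OF that] by simp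
    have "poly P s = 0" if "norm s < e" for s
      using P[of s] aq'[of "u + s *s ?v"] e(2)[OF that] by simp
    hence "ball 0 e \<subseteq> {s. poly P s = 0}" by auto
    moreover have "infinite (ball (0::complex) e)" using uncountable_ball[OF e(1)] countable_finite by blast
    ultimately have "P = 0" using poly_roots_finite[of P] finite_subset by blast
    hence "a (u + ?v) = \<Psi> u $ i * q (u + ?v)" using P[of 1] by simp
    thus ?thesis using aq(3)[OF uD] by simp
  qed
  thus ?thesis by (simp add: vec_eq_iff)
qed

section \<open>Candidate maps are maximum likelihood estimators\<close>

lemma pairing_const_deriv:
  fixes \<Psi> :: "complex^'n \<Rightarrow> complex^'n"
  assumes D: "open D" and r: "\<And>i. rational_on D (\<lambda>x. \<Psi> x $ i)" and c: "\<And>u. u \<in> D \<Longrightarrow> pairing u (\<Psi> u) = c" and u: "u \<in> D"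
  shows "pairing w (\<Psi> u) + pairing u (jacobian \<Psi> u w) = 0"
proof -
  have "((\<lambda>s. \<Sum>i\<in>UNIV. (u + s *s w) $ i * \<Psi> (u + s *s w) $ i) has_field_derivative
      (\<Sum>i\<in>UNIV. w $ i * \<Psi> u $ i + u $ i * dir_deriv (\<lambda>x. \<Psi> x $ i) u w)) (at 0)"
  proof (rule DERIV_sum)
    fix i
    have "((\<lambda>s. (u + s *s w) $ i) has_field_derivative w $ i) (at 0)"
      by (auto intro!: derivative_eq_intros)
    from DERIV_mult[OF this rational_on_has_deriv[OF r[of i] D u, of w]]
    show "((\<lambda>s. (u + s *s w) $ i * \<Psi> (u + s *s w) $ i) has_field_derivative
       w $ i * \<Psi> u $ i + u $ i * dir_deriv (\<lambda>x. \<Psi> x $ i) u w) (at 0)" by (simp add: algebra_simps)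
  qed
  hence "deriv (\<lambda>s. \<Sum>i\<in>UNIV. (u + s *s w) $ i * \<Psi> (u + s *s w) $ i) 0 = pairing w (\<Psi> u) + pairing u (jacobian \<Psi> u w)"
    by (simp add: DERIV_imp_deriv pairing_def sum.distrib)
  moreover have "deriv (\<lambda>s. \<Sum>i\<in>UNIV. (u + s *s w) $ i * \<Psi> (u + s *s w) $ i) 0 = deriv (\<lambda>s. c) 0"
  proof (rule deriv_cong_ev)
    show "eventually (\<lambda>s. (\<Sum>i\<in>UNIV. (u + s *s w) $ i * \<Psi> (u + s *s w) $ i) = c) (nhds 0)"
      using open_line_nhds[OF D u, of w]
      by eventually_elim (rule c[unfolded pairing_def])
  qed simp
  ultimately show ?thesis by simp
qed

text \<open>D is taken so small that (b) and the nonvanishing of F along \<Psi> hold at each of its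
  points.\<close>

locale mle_candidate = parametrization C \<delta> \<Psi> D
  for C :: "(complex^'n) set" and \<delta> \<Psi> D +
  fixes F :: "complex^'n \<Rightarrow> complex" and d :: nat
  assumes F: "is_poly F" and F_hom: "\<And>t x. F (t *s x) = t ^ d * F x"
    and inv: "\<And>u t. u \<in> D \<Longrightarrow> t \<noteq> 0 \<Longrightarrow> t *s u \<in> D \<Longrightarrow> \<Psi> (t *s u) = inverse t *s \<Psi> u"
    and F_nz: "\<And>u. u \<in> D \<Longrightarrow> F (\<Psi> u) \<noteq> 0"
    and logder: "\<And>u w. u \<in> D \<Longrightarrow> dir_deriv (\<lambda>x. F (\<Psi> x)) u w / F (\<Psi> u) = - pairing w (\<Psi> u)"
begin

lemma F_deriv: "u \<in> D \<Longrightarrow> dir_deriv (\<lambda>x. F (\<Psi> x)) u w = - F (\<Psi> u) * pairing w (\<Psi> u)"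
  using logder[of u w] F_nz[of u] by (simp add: field_simps)

lemma rational_on_F: "rational_on D (\<lambda>x. F (\<Psi> x))"
  by (rule is_poly_rational_on_comp[OF F rational_on])

text \<open>Differentiate along (1 + s) u: by (a) the function F(\<Psi>) is homogeneous of degree
  -d, and (b) in direction u reads -u(\<Psi>(u)).\<close>

lemma euler_pairing:
  assumes u: "u \<in> D"
  shows "pairing u (\<Psi> u) = of_nat d"
proof -
  have ev1: "eventually (\<lambda>s::complex. s \<in> - {-1}) (nhds 0)" by (rule eventually_nhds_in_open) auto
  have "eventually (\<lambda>s. F (\<Psi> (u + s *s u)) = inverse (1 + s) ^ d * F (\<Psi> u)) (nhds 0)"
    using open_line_nhds[OF open_D u, of u] ev1
  proof eventually_elim
    case (elim s)
    have "1 + s \<noteq> 0" using elim(2) by (metis ComplD add.inverse_unique singletonI)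
    moreover have e: "u + s *s u = (1 + s) *s u" by (simp add: vec_eq_iff algebra_simps)
    ultimately have "\<Psi> (u + s *s u) = inverse (1 + s) *s \<Psi> u" using inv[OF u, of "1 + s"] elim(1) by simp
    thus ?case by (simp add: F_hom)
  qed
  hence "dir_deriv (\<lambda>x. F (\<Psi> x)) u u = deriv (\<lambda>s. inverse (1 + s) ^ d * F (\<Psi> u)) 0"
    unfolding dir_deriv_def by (rule deriv_cong_ev) simp
  also have "\<dots> = - of_nat d * F (\<Psi> u)"
    by (rule DERIV_imp_deriv) (auto intro!: derivative_eq_intros)
  finally show ?thesis using F_deriv[OF u, of u] F_nz[OF u] by simp
qed

lemma pairing_deriv: "u \<in> D \<Longrightarrow> pairing w (\<Psi> u) + pairing u (jacobian \<Psi> u w) = 0"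
  by (rule pairing_const_deriv[OF open_D rational_on]) (auto intro: euler_pairing)

text \<open>By (b) the derivative of log F along d\<Psi> w is -w(\<Psi>(u)); differentiating the
  constant u(\<Psi>(u)) identifies this with u(d\<Psi> w).\<close>

lemma critical:
  assumes u: "u \<in> D"
  shows "dir_deriv F (\<Psi> u) (jacobian \<Psi> u w) / F (\<Psi> u) = pairing u (jacobian \<Psi> u w)"
proof -
  have "dir_deriv (\<lambda>x. F (\<Psi> x)) u w = dir_deriv F (\<Psi> u) (jacobian \<Psi> u w)"
    unfolding jacobian_def by (rule chain_rule[OF F rational_on open_D u])
  thus ?thesis using logder[OF u, of w] pairing_deriv[OF u, of w] by (simp add: add_eq_0_iff)
qed

text \<open>By (b) the Jacobian of \<open>\<Psi>\<close> is minus the Hessian of \<open>log (F \<circ> \<Psi>)\<close>.\<close>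
lemma jacobian_symmetric:
  assumes u: "u \<in> D"
  shows "pairing v (jacobian \<Psi> u w) = pairing w (jacobian \<Psi> u v)"
proof -
  let ?G = "\<lambda>x. F (\<Psi> x)"
  have rp: "rational_on D (\<lambda>x. pairing v (\<Psi> x))" for v
    unfolding pairing_def by (intro rational_on_sum rational_on.mult rational_on.const rational_on)
  have dp: "dir_deriv (\<lambda>x. pairing v (\<Psi> x)) u w = pairing v (jacobian \<Psi> u w)" for v w
  proof -
    have "((\<lambda>s. \<Sum>i\<in>UNIV. v $ i * \<Psi> (u + s *s w) $ i) has_field_derivative
      (\<Sum>i\<in>UNIV. v $ i * dir_deriv (\<lambda>x. \<Psi> x $ i) u w)) (at 0)"
      by (intro DERIV_sum DERIV_cmult rational_on_has_deriv[OF rational_on open_D u])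
    thus ?thesis unfolding dir_deriv_def[of "\<lambda>x. pairing v (\<Psi> x)"] by (simp add: DERIV_imp_deriv pairing_def)
  qed
  \<comment> \<open>Besides the Jacobian term there is only a product symmetric in v and w, so the
    symmetry of second derivatives passes to the Jacobian.\<close>
  have "dir_deriv (\<lambda>y. dir_deriv ?G y v) u w = - (- ?G u * pairing w (\<Psi> u) * pairing v (\<Psi> u)
      + pairing v (jacobian \<Psi> u w) * ?G u)" for v w
  proof -
    have "dir_deriv (\<lambda>y. dir_deriv ?G y v) u w = dir_deriv (\<lambda>y. (-1) * (?G y * pairing v (\<Psi> y))) u w"
      by (rule dir_deriv_cong_open[OF open_D u]) (simp add: F_deriv)
    also have "\<dots> = - dir_deriv (\<lambda>y. ?G y * pairing v (\<Psi> y)) u w"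
      by (subst dir_deriv_mult[OF rational_on.const rational_on.mult[OF rational_on_F rp] open_D u]) simp
    finally show ?thesis
      by (simp add: dir_deriv_mult[OF rational_on_F rp open_D u] F_deriv[OF u] dp)
  qed
  note e = this
  have "pairing v (jacobian \<Psi> u w) * ?G u = pairing w (jacobian \<Psi> u v) * ?G u"
    using dir_deriv_symmetric[OF rational_on_F open_D u, of v w] unfolding e by simp
  thus ?thesis using F_nz[OF u] by simp
qed

lemma jacobian_in_tangent: "u \<in> D \<Longrightarrow> jacobian \<Psi> u w \<in> tangent_space C (\<Psi> u)"
  by (rule jacobian_tangent[OF open_D rational_on]) (auto intro: image)

text \<open>The vector n is the gradient at \<Psi>(u) of one g vanishing on C. At every x in D, not
  only at u, \<open>grad g (\<Psi> x)\<close> is killed by d\<Psi>: it pairs to zero with the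
  tangent vectors d\<Psi> w, and symmetry moves it into the argument. So \<open>grad g\<close> can
  serve as the field of \<open>constant_on_line\<close>.\<close>

lemma fibre_linear:
  assumes u: "u \<in> D" and n: "n \<in> conormal C (\<Psi> u)" and uD: "u + n \<in> D"
  shows "\<Psi> (u + n) = \<Psi> u"
proof -
  obtain g where g: "is_poly g" "\<forall>y\<in>C. g y = 0" "n = grad g (\<Psi> u)" using n by (auto simp: conormal_def)
  have "jacobian \<Psi> x (grad g (\<Psi> x)) = 0" if x: "x \<in> D" for x
  proof -
    have "jacobian \<Psi> x (grad g (\<Psi> x)) $ i = 0" for i
    proof -
      have "jacobian \<Psi> x (grad g (\<Psi> x)) $ i = pairing (axis i 1) (jacobian \<Psi> x (grad g (\<Psi> x)))"
        by (simp only: pairing_axis)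
      also have "\<dots> = pairing (grad g (\<Psi> x)) (jacobian \<Psi> x (axis i 1))" by (rule jacobian_symmetric[OF x])
      also have "\<dots> = 0" using jacobian_in_tangent[OF x] g unfolding tangent_conormal conormal_def by blast
      finally show ?thesis .
    qed
    thus ?thesis by (simp add: vec_eq_iff)
  qed
  thus ?thesis using constant_on_line[OF open_D rational_on u is_poly_grad[OF g(1)]] uD g(3) by simp
qed

lemma critical_point_unique:
  assumes u: "u \<in> D" and p: "p \<in> crit_points F C u"
  shows "p = \<Psi> u"
proof -
  have pC: "p \<in> C" and Fp: "F p \<noteq> 0" and crit: "\<And>v. v \<in> tangent_space C p \<Longrightarrow> dir_deriv F p v / F p - pairing u v = 0"
    using p by (auto simp: crit_points_def smooth_points_def)
  define U0 where "U0 q = inverse (F q) *s grad F q" for q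
  have U0: "pairing (U0 q) v = dir_deriv F q v / F q" for q v
    by (simp add: U0_def pairing_scale_left poly_dir_deriv[OF F] divide_inverse mult.commute)
  have "u - U0 p \<in> conormal C p"
    by (rule conormalI) (use crit in \<open>simp add: pairing_diff_left U0\<close>)
  then obtain g where g: "is_poly g" "\<forall>y\<in>C. g y = 0" "u - U0 p = grad g p" by (auto simp: conormal_def)
  define U where "U q = U0 q + grad g q" for q
  have Up: "U p = u" using g(3) by (simp add: U_def algebra_simps)
  obtain \<gamma> where \<gamma>: "rational_on D \<gamma>" "\<exists>x\<in>D. \<gamma> x \<noteq> 0" "\<And>x. x \<in> D \<Longrightarrow> \<gamma> x \<noteq> 0 \<Longrightarrow>
     \<Psi> x \<in> smooth_points C \<and> tangent_space C (\<Psi> x) = range (jacobian \<Psi> x)"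
    using generic_submersion by blast
  \<comment> \<open>The point \<Psi>(x) is critical for x, so \<open>U0 (\<Psi> x) - x\<close> is
    conormal and \<open>U (\<Psi> x)\<close> differs from x by a conormal vector.\<close>
  have key: "\<Psi> (U (\<Psi> x)) = \<Psi> x" if x: "x \<in> D" "\<gamma> x \<noteq> 0" and UD: "U (\<Psi> x) \<in> D" for x
  proof -
    have "U0 (\<Psi> x) - x \<in> conormal C (\<Psi> x)"
    proof (rule conormalI)
      fix v assume "v \<in> tangent_space C (\<Psi> x)"
      then obtain w where "v = jacobian \<Psi> x w" using \<gamma>(3)[OF x] by blast
      thus "pairing (U0 (\<Psi> x) - x) v = 0" using critical[OF x(1), of w] by (simp add: pairing_diff_left U0)
    qed
    moreover have "grad g (\<Psi> x) \<in> conormal C (\<Psi> x)" using g by (auto simp: conormal_def)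
    ultimately have "U0 (\<Psi> x) - x + grad g (\<Psi> x) \<in> conormal C (\<Psi> x)"
      by (rule vec.subspace_add[OF conormal_subspace])
    from fibre_linear[OF x(1) this] UD show ?thesis by (simp add: U_def algebra_simps)
  qed
  let ?DF = "{q. F q \<noteq> 0}"
  have rU: "rational_on ?DF (\<lambda>q. U q $ i)" for i
    unfolding U_def U0_def
    by (simp, intro rational_on.add rational_on.mult rational_on.inv is_poly_rational_on F is_poly_grad g) auto
  have "p $ i = \<Psi> u $ i" for i
  proof -
    obtain a q where aq: "is_poly a" "is_poly q" "\<And>x. x \<in> D \<Longrightarrow> q x \<noteq> 0 \<and> \<Psi> x $ i = a x / q x"
      using rational_on_numden[OF rational_on] by blast
    \<comment> \<open>Coordinate i of the equation \<Psi>(U(y)) = y with the denominator cleared.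
      The factor \<delta>(U(y)) makes it hold trivially where U(y) leaves D; at y = p this factor is
      \<delta>(u), which is nonzero.\<close>
    define h where "h y = \<delta> (U y) * (a (U y) - y $ i * q (U y))" for y
    have "rational_on ?DF h" unfolding h_def
      by (intro rational_on.mult rational_on_diff is_poly_rational_on_comp[OF _ rU] \<delta> aq rational_on.coord)
    then obtain A B where AB: "is_poly A" "is_poly B" "\<And>y. F y \<noteq> 0 \<Longrightarrow> B y \<noteq> 0 \<and> h y = A y / B y"
      using rational_on_numden by blast
    have h0: "h (\<Psi> x) = 0" if x: "x \<in> D" "\<gamma> x \<noteq> 0" for x
    proof (cases "U (\<Psi> x) \<in> D")
      case True
      from key[OF x True] aq(3)[OF True] show ?thesis by (simp add: h_def field_simps)
    next
      case False thus ?thesis by (simp add: h_def D_def)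
    qed
    have A0: "A (\<Psi> x) = 0" if x: "x \<in> D" for x
    proof (rule ccontr)
      assume "A (\<Psi> x) \<noteq> 0"
      then obtain z where z: "z \<in> D" "A (\<Psi> z) \<noteq> 0" "\<gamma> z \<noteq> 0"
        using D_common_nonzero[OF is_poly_rational_on_comp[OF AB(1) rational_on] \<gamma>(1) x] \<gamma>(2) by blast
      show False using h0[OF z(1,3)] AB(3)[OF F_nz[OF z(1)]] z(2) by simp
    qed
    have "A p = 0" using dense[OF AB(1) A0] pC by blast
    hence "h p = 0" using AB(3)[OF Fp] by simp
    moreover have "\<delta> u \<noteq> 0" using u by (simp add: D_def)
    ultimately have "a u = p $ i * q u" by (simp add: h_def Up)
    thus ?thesis using aq(3)[OF u] by simp
  qed
  thus ?thesis by (simp add: vec_eq_iff)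
qed

lemma generic_critical_points:
  "\<exists>U. zopen U \<and> U \<noteq> {} \<and> U \<subseteq> D \<and> (\<forall>u\<in>U. crit_points F C u = {\<Psi> u})"
proof -
  obtain \<gamma> where \<gamma>: "rational_on D \<gamma>" "\<exists>x\<in>D. \<gamma> x \<noteq> 0" "\<And>x. x \<in> D \<Longrightarrow> \<gamma> x \<noteq> 0 \<Longrightarrow>
     \<Psi> x \<in> smooth_points C \<and> tangent_space C (\<Psi> x) = range (jacobian \<Psi> x)"
    using generic_submersion by blast
  obtain a b where ab: "is_poly a" "is_poly b" "\<And>x. x \<in> D \<Longrightarrow> b x \<noteq> 0 \<and> \<gamma> x = a x / b x"
    using rational_on_numden[OF \<gamma>(1)] by blast
  let ?U = "{x. \<delta> x * a x \<noteq> 0}"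
  have U: "x \<in> D \<and> \<gamma> x \<noteq> 0" if "x \<in> ?U" for x using that ab(3)[of x] by (auto simp: D_def)
  show ?thesis
  proof (intro exI[of _ ?U] conjI ballI)
    show "zopen ?U" by (intro zopen_basic is_poly.mult \<delta> ab)
    show "?U \<noteq> {}" using \<gamma>(2) ab(3) by (force simp: D_def)
    show "?U \<subseteq> D" using U by blast
    fix u assume "u \<in> ?U"
    hence u: "u \<in> D" "\<gamma> u \<noteq> 0" using U by auto
    have "\<Psi> u \<in> crit_points F C u"
      using \<gamma>(3)[OF u] F_nz[OF u(1)] critical[OF u(1)] by (auto simp: crit_points_def)
    thus "crit_points F C u = {\<Psi> u}" using critical_point_unique[OF u(1)] by blast
  qed
qed

end

lemma zopen_Int_UNIV_nonzero:
  fixes f g :: "complex^'n \<Rightarrow> complex"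
  assumes "is_poly f" "is_poly g" "f x \<noteq> 0" "g y \<noteq> 0"
  shows "\<exists>z. f z \<noteq> 0 \<and> g z \<noteq> 0"
proof -
  have "\<exists>z\<in>{x. x - 0 \<in> UNIV \<and> (1::complex) \<noteq> 0}. f z \<noteq> 0 \<and> g z \<noteq> 0"
    by (rule affine_slice_domain[OF is_poly.const[of 1] vec.subspace_UNIV refl, of f g x _ y])
       (use assms in \<open>auto intro: is_poly_rational_on\<close>)
  thus ?thesis by blast
qed

lemma candidate_is_mle:
  fixes C :: "(complex^'n) set"
  assumes C: "projective_cone C" and F: "homogeneous_poly F"
    and dr: "dominant_rational_map D \<Psi> C" and ih: "inv_homogeneous D \<Psi>" and lg: "log_gradient_condition F D \<Psi>"
  shows "\<exists>U. zopen U \<and> U \<noteq> {} \<and> U \<subseteq> D \<and> (\<forall>u\<in>U. crit_points F C u = {\<Psi> u})"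
proof -
  obtain U where U: "zopen U" "U \<noteq> {}" "U \<subseteq> D" "\<And>u. u \<in> U \<Longrightarrow> F (\<Psi> u) \<noteq> 0"
    "\<And>u w. u \<in> U \<Longrightarrow> dir_deriv (\<lambda>x. F (\<Psi> x)) u w / F (\<Psi> u) = - pairing w (\<Psi> u)"
    using lg unfolding log_gradient_condition_def by blast
  obtain u0 where u0: "u0 \<in> U" using U(2) by blast
  obtain \<delta> where \<delta>: "is_poly \<delta>" "\<delta> u0 \<noteq> 0" "{x. \<delta> x \<noteq> 0} \<subseteq> U" using zopen_basic_subset[OF U(1) u0] by blast
  define D1 where "D1 = {x. \<delta> x \<noteq> 0}"
  have D1D: "D1 \<subseteq> D" using \<delta>(3) U(3) by (simp add: D1_def)
  obtain d where d: "\<And>t x. F (t *s x) = t ^ d * F x" and pF: "is_poly F"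
    using F unfolding homogeneous_poly_def by blast
  have rat0: "rational_on D (\<lambda>x. \<Psi> x $ i)" for i
  proof -
    obtain p q where pq: "is_poly p" "is_poly q" "\<forall>u\<in>D. q u \<noteq> 0 \<and> \<Psi> u $ i = p u / q u"
      using dr unfolding dominant_rational_map_def rational_map_def by blast
    have "rational_on D (\<lambda>x. p x / q x)" using pq by (intro rational_on_divide is_poly_rational_on) auto
    thus ?thesis by (rule rational_on.cong) (use pq in auto)
  qed
  interpret mle_candidate C \<delta> \<Psi> D1 F d
  proof unfold_locales
    show "irreducible_variety C" using C by (simp add: projective_cone_def)
    show "is_poly \<delta>" by fact
    show "D1 = {x. \<delta> x \<noteq> 0}" by (rule D1_def)
    show "D1 \<noteq> {}" using \<delta>(2) by (auto simp: D1_def)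
    show "rational_on D1 (\<lambda>x. \<Psi> x $ i)" for i by (rule rational_on_subset[OF rat0 D1D])
    show "\<Psi> x \<in> C" if "x \<in> D1" for x using dr D1D that by (auto simp: dominant_rational_map_def)
    \<comment> \<open>Dominance survives the shrinking of the domain: a numerator that is nonzero
      somewhere on D is nonzero somewhere on D1, since nonempty principal open sets meet.\<close>
    show "\<forall>y\<in>C. g y = 0" if g: "is_poly g" "\<And>x. x \<in> D1 \<Longrightarrow> g (\<Psi> x) = 0" for g
    proof -
      obtain a b where ab: "is_poly a" "is_poly b" "\<forall>x\<in>D. b x \<noteq> 0 \<and> g (\<Psi> x) = a x / b x"
        using rational_on_numden[OF is_poly_rational_on_comp[OF g(1) rat0]] by blast
      have "g (\<Psi> x) = 0" if x: "x \<in> D" for x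
      proof (rule ccontr)
        assume "g (\<Psi> x) \<noteq> 0"
        hence "a x \<noteq> 0" using ab(3) x by auto
        then obtain z where z: "\<delta> z \<noteq> 0" "a z \<noteq> 0" using zopen_Int_UNIV_nonzero[OF \<delta>(1) ab(1) \<delta>(2)] by blast
        hence "z \<in> D1" by (simp add: D1_def)
        thus False using g(2)[of z] ab(3) D1D z by auto
      qed
      hence "g y = 0" if "y \<in> zclosure (\<Psi> ` D)" for y using zclosure_vanish[OF g(1) _ that] by blast
      thus ?thesis using dr by (simp add: dominant_rational_map_def)
    qed
    show "\<Psi> (t *s u) = inverse t *s \<Psi> u" if "u \<in> D1" "t \<noteq> 0" "t *s u \<in> D1" for u t
      using ih D1D that by (auto simp: inv_homogeneous_def)
  qed (use U \<delta> D1_def pF d in auto)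
  show ?thesis using generic_critical_points D1D by blast
qed

section \<open>Maximum likelihood degree one\<close>

text \<open>With t as its only root the polynomial would be a_e (X - t)^e, whose next coefficient is
  -e a_e t; \<open>ne\<close> excludes exactly this.\<close>

lemma poly_second_root:
  fixes a :: "nat \<Rightarrow> complex"
  assumes e: "e \<noteq> 0" and ae: "a e \<noteq> 0" and root: "(\<Sum>i<Suc e. a i * t ^ i) = 0"
    and ne: "of_nat e * a e * t + a (e - 1) \<noteq> 0"
  shows "\<exists>t'. t' \<noteq> t \<and> (\<Sum>i<Suc e. a i * t' ^ i) = 0"
proof (rule ccontr)
  assume no: "\<not> ?thesis"
  define P where "P = (\<Sum>i<Suc e. monom (a i) i)"
  have peval: "poly P s = (\<Sum>i<Suc e. a i * s ^ i)" for s
    by (simp add: P_def poly_sum poly_monom del: sum.lessThan_Suc)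
  have co: "coeff P i = (if i < Suc e then a i else 0)" for i
    by (simp add: P_def coeff_sum del: sum.lessThan_Suc)
  have P0: "P \<noteq> 0" using co[of e] ae by auto
  have deg: "degree P = e"
    by (rule antisym) (auto intro!: degree_le le_degree simp: co ae)
  obtain Q where Q: "P = [:- t, 1:] ^ order t P * Q" "\<not> [:- t, 1:] dvd Q"
    using order_decomp[OF P0] by blast
  have "poly Q s \<noteq> 0" for s
  proof
    assume "poly Q s = 0"
    moreover from this have "poly P s = 0" by (subst Q(1)) simp
    hence "s = t" using no peval by auto
    ultimately show False using Q(2) by (simp add: poly_eq_0_iff_dvd)
  qed
  hence "constant (poly Q)" using fundamental_theorem_of_algebra by blast
  hence "degree Q = 0" by (simp add: constant_degree)
  then obtain c where c: "Q = [:c:]" by (rule degree_eq_zeroE)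
  have "Q \<noteq> 0" using P0 Q(1) by auto
  hence o: "order t P = e"
    using deg arg_cong[OF Q(1), of degree] c by (simp add: degree_mult_eq degree_power_eq)
  have c1: "coeff ([:- t, 1:] ^ n) n = 1" for n
    using lead_coeff_power[of "[:- t, 1:]" n] by (simp add: degree_power_eq)
  have cn: "coeff ([:- t, 1:] ^ Suc n) n = - of_nat (Suc n) * t" for n
  proof (induction n)
    case (Suc n)
    have "coeff ([:- t, 1:] ^ Suc (Suc n)) (Suc n) = - t * coeff ([:- t, 1:] ^ Suc n) (Suc n) + coeff ([:- t, 1:] ^ Suc n) n"
      by (subst power_Suc) (simp add: mult_pCons_left del: power_Suc)
    also have "\<dots> = - of_nat (Suc (Suc n)) * t" unfolding Suc.IH c1 by (simp add: algebra_simps)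
    finally show ?case .
  qed simp
  obtain n where n: "e = Suc n" using e by (cases e) auto
  have P: "P = smult c ([:- t, 1:] ^ e)" using Q(1) o c by simp
  have "a e = c" using co[of e] P c1[of e] by simp
  moreover have "a (e - 1) = c * (- of_nat e * t)" using co[of n] P cn[of n] n by (simp del: power_Suc of_nat_Suc)
  ultimately show False using ne by (simp only:) (simp add: mult_ac)
qed

lemma tangentD: "v \<in> tangent_space Y p \<Longrightarrow> is_poly f \<Longrightarrow> \<forall>y\<in>Y. f y = 0 \<Longrightarrow> dir_deriv f p v = 0"
  by (simp add: tangent_space_def)

text \<open>Precomposition with scaling preserves the polynomials vanishing on C; the reverse
  inclusion is the same argument for the inverse factor.\<close>

lemma tangent_cone_scale:
  fixes C :: "(complex^'n) set"
  assumes cone: "\<And>t x. x \<in> C \<Longrightarrow> t *s x \<in> C" and s: "s \<noteq> 0"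
  shows "tangent_space C (s *s p) = tangent_space C p"
proof -
  have *: "dir_deriv (\<lambda>x. f (s *s x)) p v = s * dir_deriv f (s *s p) v"
    if f: "is_poly f" for f s p and v :: "complex^'n"
  proof -
    have "dir_deriv (\<lambda>x. f (s *s x)) p v = dir_deriv f (s *s p) (\<chi> i. dir_deriv (\<lambda>y. (s *s y) $ i) p v)"
      by (rule chain_rule[OF f _ open_UNIV UNIV_I]) (auto intro: rational_on.mult rational_on.const rational_on.coord)
    also have "(\<chi> i. dir_deriv (\<lambda>y. (s *s y) $ i) p v) = s *s v"
      by (simp add: vec_eq_iff dir_deriv_mult[OF rational_on.const rational_on.coord open_UNIV UNIV_I])
    finally show ?thesis by (simp add: poly_dir_deriv[OF f] pairing_scale_right)
  qed
  have psubst: "tangent_space C p \<subseteq> tangent_space C (s *s p)" if s: "s \<noteq> 0" for s p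
  proof
    fix v assume v: "v \<in> tangent_space C p"
    show "v \<in> tangent_space C (s *s p)" unfolding tangent_space_def
    proof (intro CollectI allI impI)
      fix f assume f: "is_poly f \<and> (\<forall>y\<in>C. f y = 0)"
      have "is_poly (\<lambda>x. f (s *s x))"
        by (rule is_poly_comp[of f "\<lambda>x. s *s x"]) (use f in \<open>simp_all add: is_poly.mult is_poly.const is_poly.coord\<close>)
      moreover have "\<forall>y\<in>C. f (s *s y) = 0" using f cone by simp
      ultimately have "dir_deriv (\<lambda>x. f (s *s x)) p v = 0" by (rule tangentD[OF v])
      thus "dir_deriv f (s *s p) v = 0" using *[of f s p v] f s by simp
    qed
  qed
  have "tangent_space C (s *s p) \<subseteq> tangent_space C (inverse s *s (s *s p))" by (rule psubst) (use s in simp)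
  also have "inverse s *s (s *s p) = p" using s by (simp add: vector_smult_assoc)
  finally show ?thesis using psubst[OF s, of p] by (rule subset_antisym)
qed

section \<open>Pairs (p, c) over a chart and the map \<Theta>\<close>

locale mld_one =
  fixes C :: "(complex^'n) set" and F :: "complex^'n \<Rightarrow> complex" and d :: nat and \<omega> :: "complex^'n \<Rightarrow> complex"
  assumes C: "irreducible_variety C" and cone: "\<And>t x. x \<in> C \<Longrightarrow> t *s x \<in> C"
    and F: "is_poly F" and F_hom: "\<And>t x. F (t *s x) = t ^ d * F x"
    and \<omega>: "is_poly \<omega>" and \<omega>_nz: "\<exists>u. \<omega> u \<noteq> 0"
    and unique: "\<And>u. \<omega> u \<noteq> 0 \<Longrightarrow> \<exists>p. crit_points F C u = {p}"
begin

definition charted :: "(complex^'n) \<Rightarrow> ('n \<Rightarrow> complex^'n \<Rightarrow> complex) \<Rightarrow> 'n set \<Rightarrow> bool" where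
  "charted p G M \<longleftrightarrow> p \<in> C \<and> F p \<noteq> 0 \<and> (\<forall>i. is_poly (G i)) \<and> (\<forall>i\<in>M. \<forall>y\<in>C. G i y = 0) \<and>
     det (\<chi> i. grad (G i) p) \<noteq> 0 \<and> zdim C = card (- M)"

text \<open>Any critical point will do: being smooth, it turns the tangent dimension
  \<open>card (- M)\<close> of its chart into \<open>zdim C\<close>.\<close>

lemma ex_charted: "\<exists>p G M. charted p G M"
proof -
  obtain u where "\<omega> u \<noteq> 0" using \<omega>_nz by blast
  then obtain p where "crit_points F C u = {p}" using unique by blast
  hence "p \<in> crit_points F C u" by simp
  hence p: "p \<in> C" "F p \<noteq> 0" "vec.dim (tangent_space C p) = zdim C"
    by (auto simp: crit_points_def smooth_points_def)
  with ex_chart[of C p] show ?thesis unfolding charted_def by metis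
qed

end

locale mld_chart = mld_one C F d \<omega>
  for C :: "(complex^'n) set" and F d \<omega> +
  fixes p0 :: "complex^'n" and G :: "'n \<Rightarrow> complex^'n \<Rightarrow> complex" and M :: "'n set"
  assumes charted: "charted p0 G M"
begin

lemma p0: "p0 \<in> C" "F p0 \<noteq> 0"
  and G: "is_poly (G i)"
  and G_van: "i \<in> M \<Longrightarrow> y \<in> C \<Longrightarrow> G i y = 0"
  and zdim: "zdim C = card (- M)"
  using charted unfolding charted_def by auto

definition \<mu> :: "complex^'n \<Rightarrow> complex" where "\<mu> q = det (\<chi> i. grad (G i) q)"
definition h :: "complex^'n \<Rightarrow> complex" where "h q = F q * \<mu> q"
text \<open>A trivial bundle of coefficient vectors supported in M, over the points of C where F and
  the chart determinant are nonzero. Its dimension \<open>card (- M) + card M\<close> equals that of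
  the target of \<Theta>.\<close>

definition S :: "((complex^'n) \<times> (complex^'n)) set" where
  "S = {x. fst x \<in> C \<and> h (fst x) \<noteq> 0 \<and> (\<forall>i. i \<notin> M \<longrightarrow> snd x $ i = 0)}"
definition \<Theta> :: "(complex^'n) \<times> (complex^'n) \<Rightarrow> complex^'n" where
  "\<Theta> x = inverse (F (fst x)) *s grad F (fst x) + (\<Sum>i\<in>UNIV. snd x $ i *s grad (G i) (fst x))"

lemma h_poly: "is_poly h" and h_p0: "h p0 \<noteq> 0" and h_F: "h q \<noteq> 0 \<Longrightarrow> F q \<noteq> 0" and h_\<mu>: "h q \<noteq> 0 \<Longrightarrow> \<mu> q \<noteq> 0"
proof -
  have "is_poly \<mu>" unfolding \<mu>_def[abs_def]
    by (rule is_poly_det) (simp add: is_poly_grad G)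
  thus "is_poly h" unfolding h_def[abs_def] by (intro is_poly.mult F)
  show "h p0 \<noteq> 0" using charted by (simp add: h_def \<mu>_def charted_def)
qed (auto simp: h_def)

text \<open>The chart bounds the tangent dimension from above and \<open>zdim C\<close> from below,
  so all points of C with h nonzero are smooth.\<close>

lemma tangent_dim:
  assumes "q \<in> C" "h q \<noteq> 0"
  shows "vec.dim (tangent_space C q) = card (- M)"
proof (rule antisym)
  show "vec.dim (tangent_space C q) \<le> card (- M)"
    using h_\<mu>[OF assms(2)] unfolding \<mu>_def by (intro chart_dim[of G]) (auto intro: G G_van)
  show "card (- M) \<le> vec.dim (tangent_space C q)"
    using zdim_le_tangent_dim[OF C assms(1)] by (simp add: zdim)
qed

lemma conormal_G: "i \<in> M \<Longrightarrow> grad (G i) q \<in> conormal C q"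
  unfolding conormal_def using G G_van by blast

lemma conormal_span:
  assumes q: "q \<in> C" "h q \<noteq> 0" and n: "n \<in> conormal C q"
  shows "\<exists>c. (\<forall>i. i \<notin> M \<longrightarrow> c $ i = 0) \<and> n = (\<Sum>i\<in>UNIV. c $ i *s grad (G i) q)"
proof -
  let ?A = "\<chi> i. grad (G i) q"
  have dA: "det ?A \<noteq> 0" using h_\<mu>[OF q(2)] by (simp add: \<mu>_def)
  hence "det (transpose ?A) \<noteq> 0" by (simp add: det_transpose)
  then obtain c where c: "transpose ?A *v c = n" using det_nz_solve(1) by blast
  have n_sum: "n = (\<Sum>i\<in>UNIV. c $ i *s grad (G i) q)"
    by (simp add: c[symmetric] vec_eq_iff matrix_vector_mult_def transpose_def mult.commute)
  have "c $ i = 0" if i: "i \<notin> M" for i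
  proof (rule ccontr)
    assume ci: "c $ i \<noteq> 0"
    \<comment> \<open>With c i nonzero, the conormal vector n expresses \<open>grad (G i) q\<close>
      on the tangent space through the other gradients, so one functional fewer would separate
      tangent vectors.\<close>
    have "vec.dim (tangent_space C q) \<le> card (- M - {i})"
    proof (rule dim_le_card_functionals[OF tangent_subspace, where g = "\<lambda>i. grad (G i) q"])
      fix v assume v: "v \<in> tangent_space C q" "\<And>a. a \<in> - M - {i} \<Longrightarrow> pairing (grad (G a) q) v = 0"
      have z: "pairing (grad (G a) q) v = 0" if "a \<noteq> i" for a
        using v that conormal_G[of a q] by (cases "a \<in> M") (auto simp: tangent_conormal)
      have "0 = pairing n v" using v(1) n by (simp add: tangent_conormal)
      also have "\<dots> = (\<Sum>a\<in>UNIV. if a = i then c $ i * pairing (grad (G i) q) v else 0)"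
        unfolding n_sum pairing_sum_left pairing_scale_left by (intro sum.cong) (auto simp: z)
      finally have "pairing (grad (G i) q) v = 0" using ci by simp
      hence "?A *v v = 0" using z by (simp add: mult_rows vec_eq_iff) metis
      thus "v = 0" by (rule det_nz_solve(2)[OF dA])
    qed
    also have "\<dots> < card (- M)" using i by (intro psubset_card_mono) auto
    finally show False using tangent_dim[OF q] by simp
  qed
  thus ?thesis using n_sum by blast
qed

lemma S_critical:
  assumes x: "x \<in> S"
  shows "fst x \<in> crit_points F C (\<Theta> x)"
proof -
  let ?p = "fst x"
  have p: "?p \<in> C" "h ?p \<noteq> 0" and c: "\<And>i. i \<notin> M \<Longrightarrow> snd x $ i = 0" using x by (auto simp: S_def)
  have "dir_deriv F ?p v / F ?p - pairing (\<Theta> x) v = 0" if v: "v \<in> tangent_space C ?p" for v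
  proof -
    have "snd x $ i * pairing (grad (G i) ?p) v = 0" for i
      using c[of i] conormal_G[of i ?p] v by (cases "i \<in> M") (auto simp: tangent_conormal)
    hence "(\<Sum>i\<in>UNIV. snd x $ i * pairing (grad (G i) ?p) v) = 0" by (intro sum.neutral ballI)
    hence "pairing (\<Theta> x) v = inverse (F ?p) * pairing (grad F ?p) v"
      by (simp only: \<Theta>_def pairing_add_left pairing_scale_left pairing_sum_left add_0_right)
    thus ?thesis by (simp add: poly_dir_deriv[OF F] divide_inverse mult.commute)
  qed
  thus ?thesis using p tangent_dim[OF p] zdim h_F[OF p(2)] by (auto simp: crit_points_def smooth_points_def)
qed

lemma conormal_in_image:
  assumes q: "q \<in> C" "h q \<noteq> 0" and n: "n \<in> conormal C q"
  shows "\<exists>x\<in>S. fst x = q \<and> \<Theta> x = inverse (F q) *s grad F q + n"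
proof -
  obtain c where c: "\<forall>i. i \<notin> M \<longrightarrow> c $ i = 0" "n = (\<Sum>i\<in>UNIV. c $ i *s grad (G i) q)"
    using conormal_span[OF assms] by blast
  thus ?thesis using q by (intro bexI[of _ "(q, c)"]) (auto simp: \<Theta>_def S_def)
qed

text \<open>The critical point p of a general u may have h p = 0, so u need not be a value of
  \<Theta>. With g fixed by u and p, the function k(grad F / F + grad g) is zero on the part of C
  where h is nonzero, hence by irreducibility also at p.\<close>

lemma \<Theta>_dense:
  assumes k: "is_poly k" and z: "\<And>x. x \<in> S \<Longrightarrow> k (\<Theta> x) = 0"
  shows "k u = 0"
proof -
  have main: "k u = 0" if u: "\<omega> u \<noteq> 0" for u
  proof -
    obtain p where "crit_points F C u = {p}" using unique[OF u] by blast
    hence "p \<in> crit_points F C u" by simp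
    hence p: "p \<in> C" "F p \<noteq> 0" "\<And>v. v \<in> tangent_space C p \<Longrightarrow> dir_deriv F p v / F p - pairing u v = 0"
      by (auto simp: crit_points_def smooth_points_def)
    define U0 where "U0 q = inverse (F q) *s grad F q" for q
    have "u - U0 p \<in> conormal C p"
      by (rule conormalI) (use p(3) in \<open>simp add: pairing_diff_left U0_def pairing_scale_left poly_dir_deriv[OF F] divide_inverse mult.commute\<close>)
    then obtain g where g: "is_poly g" "\<forall>y\<in>C. g y = 0" "u - U0 p = grad g p" by (auto simp: conormal_def)
    have Up: "U0 p + grad g p = u" using g(3) by (simp add: algebra_simps)
    have "rational_on {q. F q \<noteq> 0} (\<lambda>q. k (U0 q + grad g q))"
      by (rule is_poly_rational_on_comp[OF k])
         (simp add: U0_def, intro rational_on.add rational_on.mult rational_on.inv is_poly_rational_on F is_poly_grad g, auto)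
    then obtain A B where AB: "is_poly A" "is_poly B" "\<And>q. F q \<noteq> 0 \<Longrightarrow> B q \<noteq> 0 \<and> k (U0 q + grad g q) = A q / B q"
      using rational_on_numden by blast
    have "A q * h q = 0" if q: "q \<in> C" for q
    proof (cases "h q = 0")
      case False
      have "grad g q \<in> conormal C q" using g by (auto simp: conormal_def)
      then obtain x where "x \<in> S" "\<Theta> x = U0 q + grad g q" using conormal_in_image[OF q False] unfolding U0_def by blast
      hence "k (U0 q + grad g q) = 0" using z by metis
      thus ?thesis using AB(3)[OF h_F[OF False]] by simp
    qed simp
    hence "\<forall>y\<in>C. A y = 0" using irreducible_mult[OF C AB(1) h_poly] h_p0 p0(1) by blast
    thus ?thesis using AB(3)[OF p(2)] p(1) Up by simp
  qed
  show ?thesis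
  proof (rule ccontr)
    assume "k u \<noteq> 0"
    with \<omega>_nz obtain y where "k y \<noteq> 0" "\<omega> y \<noteq> 0" using zopen_Int_UNIV_nonzero[OF k \<omega>] by blast
    thus False using main by blast
  qed
qed

text \<open>The conditions on p and on c are separate because \<open>regular_domain\<close> moves c
  and p one after the other.\<close>

definition regular :: "((complex^'n) \<times> (complex^'n) \<Rightarrow> complex) \<Rightarrow> bool" where
  "regular f \<longleftrightarrow> (\<forall>c. rational_on {p. h p \<noteq> 0} (\<lambda>p. f (p, c))) \<and> (\<forall>p. h p \<noteq> 0 \<longrightarrow> is_poly (\<lambda>c. f (p, c)))"

lemma regular_const: "regular (\<lambda>x. c)"
  by (auto simp: regular_def intro: rational_on.const is_poly.const)

lemma regular_add: "regular f \<Longrightarrow> regular g \<Longrightarrow> regular (\<lambda>x. f x + g x)"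
  by (auto simp: regular_def intro: rational_on.add is_poly.add)

lemma regular_mult: "regular f \<Longrightarrow> regular g \<Longrightarrow> regular (\<lambda>x. f x * g x)"
  by (auto simp: regular_def intro: rational_on.mult is_poly.mult)

lemma regular_sum: "finite A \<Longrightarrow> (\<And>i. i \<in> A \<Longrightarrow> regular (f i)) \<Longrightarrow> regular (\<lambda>x. \<Sum>i\<in>A. f i x)"
  by (induction A rule: finite_induct) (auto intro: regular_const regular_add)

lemma regular_fst: "rational_on {p. h p \<noteq> 0} f \<Longrightarrow> regular (\<lambda>x. f (fst x))"
  by (auto simp: regular_def intro: is_poly.const)

lemma regular_snd: "regular (\<lambda>x. snd x $ i)"
  by (auto simp: regular_def intro: rational_on.const is_poly.coord)

lemma regular_inv_h: "regular (\<lambda>x. inverse (h (fst x)))"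
  by (intro regular_fst rational_on.inv is_poly_rational_on h_poly) auto

lemma regular_\<Theta>: "regular (\<lambda>x. \<Theta> x $ i)"
  unfolding \<Theta>_def
  by (simp, intro regular_add regular_sum regular_mult regular_fst[of "\<lambda>p. inverse (F p) * grad F p $ i"] regular_snd
      regular_fst[of "\<lambda>p. grad (G _) p $ i"] rational_on.mult rational_on.inv is_poly_rational_on F is_poly_grad G) (auto dest: h_F)

lemma regular_peval: "vars_below N p \<Longrightarrow> (\<And>i. i < N \<Longrightarrow> regular (\<lambda>x. H x i)) \<Longrightarrow> regular (\<lambda>x. peval (H x) p)"
  by (induction p) (auto intro: regular_const regular_add regular_mult)

text \<open>With both base points fixed, c is moved along a line to a value good for both functions;
  with this c kept, irreducibility of C supplies a common base point.\<close>

lemma regular_domain: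
  assumes f: "regular f" and g: "regular g" and x: "x \<in> S" "f x \<noteq> 0" and y: "y \<in> S" "g y \<noteq> 0"
  shows "\<exists>z\<in>S. f z \<noteq> 0 \<and> g z \<noteq> 0"
proof -
  obtain p a where xp: "x = (p, a)" by (cases x)
  obtain q b where yq: "y = (q, b)" by (cases y)
  have hp: "h p \<noteq> 0" "p \<in> C" and hq: "h q \<noteq> 0" "q \<in> C" using x y by (auto simp: S_def xp yq)
  obtain P where P: "\<And>s. f (p, a + s *s (b - a)) = poly P s"
    using f hp poly_on_line[of "\<lambda>c. f (p, c)" a "b - a"] unfolding regular_def by blast
  obtain Q where Q: "\<And>s. g (q, a + s *s (b - a)) = poly Q s"
    using g hq poly_on_line[of "\<lambda>c. g (q, c)" a "b - a"] unfolding regular_def by blast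
  have "poly P 0 \<noteq> 0" using P[of 0] x by (simp add: xp)
  moreover have "poly Q 1 \<noteq> 0" using Q[of 1] y by (simp add: yq)
  ultimately obtain s where s: "poly P s \<noteq> 0" "poly Q s \<noteq> 0" using poly_common_nonzero[of P 0 Q 1 1 0] by auto
  define c where "c = a + s *s (b - a)"
  have cM: "c $ i = 0" if "i \<notin> M" for i using x y that by (simp add: c_def S_def xp yq)
  have fg: "f (p, c) \<noteq> 0" "g (q, c) \<noteq> 0" using s P[of s] Q[of s] by (auto simp: c_def)
  obtain A B where AB: "is_poly A" "is_poly B" "\<And>q. h q \<noteq> 0 \<Longrightarrow> B q \<noteq> 0 \<and> f (q, c) = A q / B q"
    using f rational_on_numden[of "{p. h p \<noteq> 0}" "\<lambda>p. f (p, c)"] unfolding regular_def by blast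
  obtain A' B' where AB': "is_poly A'" "is_poly B'" "\<And>q. h q \<noteq> 0 \<Longrightarrow> B' q \<noteq> 0 \<and> g (q, c) = A' q / B' q"
    using g rational_on_numden[of "{p. h p \<noteq> 0}" "\<lambda>p. g (p, c)"] unfolding regular_def by blast
  have "A p \<noteq> 0" "A' q \<noteq> 0" using AB(3)[OF hp(1)] AB'(3)[OF hq(1)] fg by auto
  then obtain w where w: "w \<in> C" "A w \<noteq> 0" "A' w \<noteq> 0"
    using irreducible_common_nonzero[OF C AB(1) AB'(1)] hp hq by blast
  then obtain z where z: "z \<in> C" "A z * A' z \<noteq> 0" "h z \<noteq> 0"
    using irreducible_common_nonzero[OF C is_poly.mult[OF AB(1) AB'(1)] h_poly, of w p] hp by auto
  have "(z, c) \<in> S" using z cM by (auto simp: S_def)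
  moreover have "f (z, c) \<noteq> 0" "g (z, c) \<noteq> 0" using AB(3)[OF z(3)] AB'(3)[OF z(3)] z(2) by auto
  ultimately show ?thesis by blast
qed

lemma S_ne: "S \<noteq> {}"
proof -
  have "(p0, 0) \<in> S" using p0 h_p0 by (simp add: S_def)
  thus ?thesis by blast
qed

lemma \<Theta>_nonzero: "is_poly k \<Longrightarrow> k u \<noteq> 0 \<Longrightarrow> \<exists>x\<in>S. k (\<Theta> x) \<noteq> 0"
  using \<Theta>_dense by blast

end

section \<open>Functions on the bundle and the equations they satisfy\<close>

context mld_chart
begin

text \<open>Layout of the variables: the n coordinates of \<open>\<Theta>\<close>, one distinguished function f,
  the coordinates of p and of c, and the inverse of h.\<close>
definition slot :: "((complex^'n) \<times> (complex^'n) \<Rightarrow> complex) \<Rightarrow> (complex^'n) \<times> (complex^'n) \<Rightarrow> nat \<Rightarrow> complex" where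
  "slot f x i = (if i < CARD('n) then \<Theta> x $ coord_at i else if i = CARD('n) then f x
     else if i < 2 * CARD('n) + 1 then fst x $ coord_at (i - (CARD('n) + 1))
     else if i < 3 * CARD('n) + 1 then snd x $ coord_at (i - (2 * CARD('n) + 1)) else inverse (h (fst x)))"

lemma index_lt: "index (a :: 'n) < CARD('n)" by simp

lemma slot_vec [simp]:
  "vec_at 0 (slot f x) = \<Theta> x" "vec_at (Suc CARD('n)) (slot f x) = fst x" "vec_at (Suc (2 * CARD('n))) (slot f x) = snd x"
proof -
  have "index a < CARD('n)" for a :: 'n by simp
  note * = this
  show "vec_at 0 (slot f x) = \<Theta> x" by (simp add: vec_eq_iff slot_def)
  show "vec_at (Suc CARD('n)) (slot f x) = fst x"
    unfolding vec_eq_iff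
  proof
    fix a :: 'n
    show "vec_at (Suc CARD('n)) (slot f x) $ a = fst x $ a" using *[of a] by (simp add: slot_def)
  qed
  show "vec_at (Suc (2 * CARD('n))) (slot f x) = snd x"
    unfolding vec_eq_iff
  proof
    fix a :: 'n
    show "vec_at (Suc (2 * CARD('n))) (slot f x) $ a = snd x $ a" using *[of a] by (simp add: slot_def)
  qed
qed

lemma slot_snd [simp]: "slot f x (Suc (2 * CARD('n) + index (a :: 'n))) = snd x $ a"
  using index_lt[of a] by (simp add: slot_def less_SucI)

lemma slot_fst [simp]: "slot f x (Suc (CARD('n) + index (a :: 'n))) = fst x $ a"
  using index_lt[of a] by (simp add: slot_def less_SucI)

lemma slot_simps [simp]:
  "slot f x CARD('n) = f x" "slot f x (Suc (3 * CARD('n))) = inverse (h (fst x))"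
  by (simp_all add: slot_def)

lemma slot_change: "i \<noteq> CARD('n) \<Longrightarrow> slot f x i = slot g x i"
  by (simp add: slot_def)

lemma regular_slot: "regular f \<Longrightarrow> regular (\<lambda>x. slot f x i)"
  using regular_fst[of "\<lambda>p. p $ coord_at (i - (CARD('n) + 1))"]
  unfolding slot_def
  by (cases "i < CARD('n)"; cases "i = CARD('n)"; cases "i < 2 * CARD('n) + 1"; cases "i < 3 * CARD('n) + 1")
     (simp_all add: regular_\<Theta> rational_on.coord regular_snd regular_inv_h)

lemma integral_on_slot:
  assumes f: "regular f"
  shows "integral_on S (slot f) k"
  unfolding integral_on_def
proof (intro conjI allI impI S_ne)
  fix p q assume pq: "vars_below k p" "vars_below k q" "vanishes S (slot f) (Mul p q)"
  have r: "regular (\<lambda>x. peval (slot f x) p)" "regular (\<lambda>x. peval (slot f x) q)"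
    using regular_peval[of k _ "slot f"] regular_slot[OF f] pq(1,2) by auto
  show "vanishes S (slot f) p \<or> vanishes S (slot f) q"
  proof (rule ccontr)
    assume "\<not> ?thesis"
    then obtain x y where "x \<in> S" "peval (slot f x) p \<noteq> 0" "y \<in> S" "peval (slot f y) q \<noteq> 0" by (auto simp: vanishes_def)
    from regular_domain[OF r this] pq(3) show False by (auto simp: vanishes_def)
  qed
qed

text \<open>By density, a relation among the coordinates of \<Theta> on S is a polynomial identity
  on the whole space.\<close>

lemma transc_\<Theta>:
  assumes i: "i < CARD('n)"
  shows "transc S (slot f) i"
  unfolding transc_def
proof (intro allI impI)
  fix m q j assume r: "relation S (slot f) i m q" and j: "j < m"
  have vq: "vars_below i (q j)" if "j < m" for j using r that by (simp add: relation_def)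
  define a where "a j y = peval (\<lambda>l. y $ coord_at l) (q j)" for j and y :: "complex^'n"
  have pa: "is_poly (a j)" if "j < m" for j unfolding a_def
    by (rule is_poly_peval[OF vq[OF that]]) (auto intro: is_poly.coord)
  have ea: "peval (slot f x) (q j) = a j (\<Theta> x)" if "j < m" for j x
    unfolding a_def by (rule peval_cong[OF vq[OF that]]) (use i in \<open>simp add: slot_def\<close>)
  have k: "(\<Sum>j<m. a j y * y $ coord_at i ^ j) = 0" for y
  proof (rule \<Theta>_dense[of "\<lambda>y. \<Sum>j<m. a j y * y $ coord_at i ^ j"])
    show "is_poly (\<lambda>y. \<Sum>j<m. a j y * y $ coord_at i ^ j)"
      by (intro is_poly_sum is_poly.mult is_poly_power is_poly.coord pa) auto
    fix x assume "x \<in> S"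
    hence "(\<Sum>j<m. peval (slot f x) (q j) * slot f x i ^ j) = 0" using r by (simp add: relation_def)
    thus "(\<Sum>j<m. a j (\<Theta> x) * \<Theta> x $ coord_at i ^ j) = 0" using ea i by (simp add: slot_def)
  qed
  have "a j y = 0" for y
  proof -
    \<comment> \<open>The coefficients involve only coordinates before i, so moving coordinate i
      alone gives a polynomial in t that vanishes everywhere.\<close>
    define y' where "y' t = (\<chi> b. if b = coord_at i then t else y $ b)" for t
    have ay: "a l (y' t) = a l y" if "l < m" for l t
      unfolding a_def
    proof (rule peval_cong[OF vq[OF that]])
      fix s assume s: "s < i"
      have "(coord_at s :: 'n) \<noteq> coord_at i"
      proof
        assume "(coord_at s :: 'n) = coord_at i"
        hence "index (coord_at s :: 'n) = index (coord_at i :: 'n)" by simp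
        thus False using s i by (simp add: index_coord_at)
      qed
      thus "y' t $ coord_at s = y $ coord_at s" by (simp add: y'_def)
    qed
    define P where "P = (\<Sum>l<m. monom (a l y) l)"
    have "poly P t = 0" for t
    proof -
      have yi: "y' t $ coord_at i = t" by (simp add: y'_def)
      have "poly P t = (\<Sum>l<m. a l y * t ^ l)" by (simp add: P_def poly_sum poly_monom)
      also have "\<dots> = (\<Sum>l<m. a l (y' t) * y' t $ coord_at i ^ l)"
        by (intro sum.cong refl) (simp add: ay yi)
      finally show ?thesis using k by simp
    qed
    hence "P = 0" using poly_all_0_iff_0 by blast
    moreover have "coeff P j = a j y" using j by (simp add: P_def coeff_sum)
    ultimately show ?thesis by simp
  qed
  thus "vanishes S (slot f) (q j)" using ea[OF j] by (simp add: vanishes_def)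
qed

text \<open>Component i of the equation defining \<Theta>, multiplied by F to make it polynomial in
  the slots.\<close>

definition relation\<Theta> :: "'n \<Rightarrow> pexp" where
  "relation\<Theta> i = Add (Mul (pexp_at (Suc CARD('n)) F) (Var (index i))) (Mul (Cst (-1)) (Add (pexp_at (Suc CARD('n)) (\<lambda>x. grad F x $ i))
     (Mul (pexp_at (Suc CARD('n)) F) (psum (\<lambda>l. Mul (Var (Suc (2 * CARD('n)) + l)) (pexp_at (Suc CARD('n)) (\<lambda>x. grad (G (coord_at l)) x $ i))) CARD('n)))))"

lemma sum_coord_at: "(\<Sum>l<CARD('n). g (coord_at l)) = (\<Sum>a\<in>UNIV. g (a :: 'n))"
  using sum.reindex_bij_betw[OF bij_index[where 'n='n], of "\<lambda>l. g (coord_at l)"] by simp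

lemma peval_relation\<Theta>: "peval \<rho> (relation\<Theta> i) = F (vec_at (Suc CARD('n)) \<rho>) * \<rho> (index i) - (grad F (vec_at (Suc CARD('n)) \<rho>) $ i
     + F (vec_at (Suc CARD('n)) \<rho>) * (\<Sum>a\<in>UNIV. vec_at (Suc (2 * CARD('n))) \<rho> $ a * grad (G a) (vec_at (Suc CARD('n)) \<rho>) $ i))"
proof -
  have "(\<Sum>l<CARD('n). \<rho> (Suc (2 * CARD('n)) + l) * grad (G (coord_at l)) (vec_at (Suc CARD('n)) \<rho>) $ i)
     = (\<Sum>l<CARD('n). vec_at (Suc (2 * CARD('n))) \<rho> $ (coord_at l :: 'n) * grad (G (coord_at l)) (vec_at (Suc CARD('n)) \<rho>) $ i)"
    by (intro sum.cong) (auto simp: index_coord_at)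
  also have "\<dots> = (\<Sum>a\<in>UNIV. vec_at (Suc (2 * CARD('n))) \<rho> $ a * grad (G a) (vec_at (Suc CARD('n)) \<rho>) $ i)"
    by (rule sum_coord_at)
  finally show ?thesis
    by (simp add: relation\<Theta>_def peval_pexp_at F G is_poly_grad del: add_Suc vec_at_nth)
qed

lemma vars_below_relation\<Theta>: "vars_below (3 * CARD('n) + 2) (relation\<Theta> i)"
proof -
  have "index i < (3 * CARD('n) + 2)" using index_lt[of i] by linarith
  thus ?thesis unfolding relation\<Theta>_def by (auto intro!: vars_below_psum vars_below_pexp_at F is_poly_grad G)
qed

lemma vanishes_relation\<Theta>: "vanishes S (slot f) (relation\<Theta> i)"
  unfolding vanishes_def
proof
  fix x assume "x \<in> S"
  hence "F (fst x) \<noteq> 0" using h_F by (auto simp: S_def)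
  moreover have "slot f x (index i) = \<Theta> x $ i" by (simp add: slot_def)
  ultimately show "peval (slot f x) (relation\<Theta> i) = 0"
    by (simp add: peval_relation\<Theta> del: vec_at_nth) (simp add: \<Theta>_def distrib_left)
qed

text \<open>The equation z h = 1 for the last slot z; it keeps h nonzero at every point of the
  closure.\<close>

definition relation_h :: pexp where
  "relation_h = Add (Mul (Var (Suc (3 * CARD('n)))) (pexp_at (Suc CARD('n)) h)) (Cst (-1))"

lemma vanishes_relation_h: "vanishes S (slot f) relation_h" and vars_below_relation_h: "vars_below (3 * CARD('n) + 2) relation_h"
  by (auto simp: relation_h_def vanishes_def peval_pexp_at h_poly S_def intro: vars_below_pexp_at)

text \<open>The equations of C, the support of c, the equation z h = 1 and the equation of \<Theta>
  are all vanishing expressions, so a complex point over all slots is a genuine point of S.\<close>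

lemma point_of_gen_point:
  fixes \<tau> :: "nat \<Rightarrow> complex"
  assumes gen_point: "gen_point S (slot f) (3 * CARD('n) + 2) \<tau>"
  defines "x \<equiv> (vec_at (Suc CARD('n)) \<tau>, vec_at (Suc (2 * CARD('n))) \<tau>)"
  shows "x \<in> S" and "\<Theta> x = vec_at 0 \<tau>"
proof -
  have z: "peval \<tau> p = 0" if "vars_below (3 * CARD('n) + 2) p" "vanishes S (slot f) p" for p using gen_point that by (auto simp: gen_point_def)
  have "peval \<tau> relation_h = 0" by (rule z[OF vars_below_relation_h vanishes_relation_h])
  hence hx: "h (fst x) \<noteq> 0" by (auto simp: relation_h_def peval_pexp_at h_poly x_def)
  have "fst x \<in> C"
  proof (rule ccontr)
    assume "fst x \<notin> C"
    then obtain g where g: "is_poly g" "\<forall>y\<in>C. g y = 0" "g (fst x) \<noteq> 0"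
      using zclosed_separate C by (metis irreducible_variety_def)
    have "peval \<tau> (pexp_at (Suc CARD('n)) g) = 0"
    proof (rule z)
      show "vars_below (3 * CARD('n) + 2) (pexp_at (Suc CARD('n)) g)" by (rule vars_below_pexp_at[OF g(1)]) simp
      show "vanishes S (slot f) (pexp_at (Suc CARD('n)) g)" using g(2) by (auto simp: vanishes_def peval_pexp_at[OF g(1)] S_def)
    qed
    thus False using g(3) by (simp add: peval_pexp_at[OF g(1)] x_def)
  qed
  moreover have "snd x $ i = 0" if i: "i \<notin> M" for i
  proof -
    have "peval \<tau> (Var (Suc (2 * CARD('n)) + index i)) = 0"
    proof (rule z)
      show "vars_below (3 * CARD('n) + 2) (Var (Suc (2 * CARD('n)) + index i))" by (simp add: less_SucI)
      show "vanishes S (slot f) (Var (Suc (2 * CARD('n)) + index i))" using i by (auto simp: vanishes_def S_def)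
    qed
    thus ?thesis by (simp add: x_def)
  qed
  ultimately show "x \<in> S" using hx by (simp add: S_def)
  have "\<Theta> x $ i = \<tau> (index i)" for i
  proof -
    have "peval \<tau> (relation\<Theta> i) = 0" by (rule z[OF vars_below_relation\<Theta> vanishes_relation\<Theta>])
    hence "F (fst x) * \<tau> (index i) = grad F (fst x) $ i + F (fst x) * (\<Sum>a\<in>UNIV. snd x $ a * grad (G a) (fst x) $ i)"
      by (simp add: peval_relation\<Theta> x_def del: vec_at_nth)
    thus ?thesis using h_F[OF hx] by (simp add: \<Theta>_def field_simps)
  qed
  thus "\<Theta> x = vec_at 0 \<tau>" by (simp add: vec_eq_iff)
qed

text \<open>The distinguished slot is read as zero, so that a function to be placed there is not
  defined through itself.\<close>

definition slot_fun :: "pexp \<Rightarrow> (complex^'n) \<times> (complex^'n) \<Rightarrow> complex" where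
  "slot_fun p x = peval (slot (\<lambda>_. 0) x) p"

lemma regular_slot_fun: "vars_below k p \<Longrightarrow> regular (slot_fun p)"
  unfolding slot_fun_def[abs_def] by (rule regular_peval) (auto intro: regular_slot regular_const)

text \<open>A derivation that is zero on p and c is zero on \<Theta>, on the inverse of h and on the
  distinguished function, since each satisfies an equation linear in it with a coefficient that is
  nonzero at x.\<close>

lemma tangent_at_determined:
  assumes x: "x \<in> S" and p: "vars_below (3 * CARD('n) + 2) p" and t: "tangent_at S (slot (slot_fun p)) (3 * CARD('n) + 2) x b"
    and b0: "vec_at (Suc CARD('n)) b = (0 :: complex^'n)" "vec_at (Suc (2 * CARD('n))) b = (0 :: complex^'n)" and i: "i < Suc CARD('n)"
  shows "b i = 0"
proof -
  let ?H = "slot (slot_fun p)"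
  let ?\<rho> = "\<lambda>l. Dual (?H x l) (b l)"
  have Fx: "F (fst x) \<noteq> 0" and hx: "h (fst x) \<noteq> 0" using x h_F by (auto simp: S_def)
  have dpol: "deps (peval ?\<rho> (pexp_at (Suc CARD('n)) g)) = 0" if "is_poly g" for g :: "complex^'n \<Rightarrow> complex"
    by (simp add: deps_pexp_at[OF that] b0 poly_dir_deriv[OF that])
  have dc: "b (Suc (2 * CARD('n)) + index a) = 0" "b (Suc CARD('n) + index a) = 0" for a :: 'n
    using arg_cong[OF b0(2), of "\<lambda>v. v $ a"] arg_cong[OF b0(1), of "\<lambda>v. v $ a"] by simp_all
  have dc': "b (Suc (2 * CARD('n)) + l) = 0" "b (Suc CARD('n) + l) = 0" if "l < CARD('n)" for l
    using dc[of "coord_at l"] index_coord_at[OF that] by simp_all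
  have du: "b (index a) = 0" for a :: 'n
  proof -
    have "deps (peval ?\<rho> (relation\<Theta> a)) = 0" by (rule tangD[OF t vars_below_relation\<Theta> vanishes_relation\<Theta>])
    moreover have "deps (peval ?\<rho> (psum (\<lambda>l. Mul (Var (Suc (2 * CARD('n)) + l)) (pexp_at (Suc CARD('n)) (\<lambda>x. grad (G (coord_at l)) x $ a))) CARD('n))) = 0"
      unfolding peval_psum deps_sum by (rule sum.neutral) (use dc' dpol[OF is_poly_grad[OF G]] in \<open>simp del: add_Suc\<close>)
    ultimately have "F (fst x) * b (index a) = 0"
      unfolding relation\<Theta>_def by (simp add: dpol F is_poly_grad dre_peval peval_pexp_at del: peval_psum)
    thus ?thesis using Fx by simp
  qed
  have bu: "b l = 0" if "l < CARD('n)" for l using du[of "coord_at l"] index_coord_at[OF that] by simp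
  have bz: "b (Suc (3 * CARD('n))) = 0"
  proof -
    have "deps (peval ?\<rho> relation_h) = 0" by (rule tangD[OF t vars_below_relation_h vanishes_relation_h])
    thus ?thesis using hx unfolding relation_h_def by (simp add: dpol[OF h_poly] dre_peval peval_pexp_at[OF h_poly])
  qed
  have bl: "b l = 0" if l: "l < (3 * CARD('n) + 2)" "l \<noteq> CARD('n)" for l
  proof -
    consider "l < CARD('n)" | "Suc CARD('n) \<le> l" "l < Suc (2 * CARD('n))" | "Suc (2 * CARD('n)) \<le> l" "l < Suc (3 * CARD('n))" | "l = Suc (3 * CARD('n))"
      using l by linarith
    thus ?thesis
    proof cases
      case 2 thus ?thesis using dc'(2)[of "l - Suc CARD('n)"] by simp
    next
      case 3 thus ?thesis using dc'(1)[of "l - Suc (2 * CARD('n))"] by simp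
    qed (use bu bz in auto)
  qed
  define \<sigma> where "\<sigma> l = (if l = CARD('n) then Cst 0 else Var l)" for l
  let ?p = "Add (Var CARD('n)) (Mul (Cst (-1)) (psubst \<sigma> p))"
  have "vars_below (3 * CARD('n) + 2) (psubst \<sigma> p)" by (rule vars_below_psubst[OF p]) (simp add: \<sigma>_def)
  hence "vars_below (3 * CARD('n) + 2) ?p" by simp
  moreover have "vanishes S ?H ?p"
  proof -
    have "peval (?H y) (psubst \<sigma> p) = slot_fun p y" for y
    proof -
      have "(\<lambda>i. peval (?H y) (\<sigma> i)) = slot (\<lambda>_. 0) y"
        by (rule ext) (simp add: \<sigma>_def slot_def)
      thus ?thesis by (simp add: peval_psubst slot_fun_def)
    qed
    thus ?thesis by (simp add: vanishes_def)
  qed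
  ultimately have "deps (peval ?\<rho> ?p) = 0" by (rule tangD[OF t])
  moreover have "deps (peval ?\<rho> (psubst \<sigma> p)) = 0"
    unfolding peval_psubst by (rule deps_zero[OF p]) (use bl in \<open>simp add: \<sigma>_def\<close>)
  ultimately have "b CARD('n) = 0" by simp
  thus ?thesis using bu i by (auto simp: less_Suc_eq)
qed

text \<open>A transcendental function would give n + 1 derivations at some x, independent on
  \<Theta> and that function. But n numbers determine a derivation there: its p part is tangent to
  C, so the gradients outside M detect it, and its c part is supported in M.\<close>

lemma algebraic_over_\<Theta>:
  assumes p: "vars_below (3 * CARD('n) + 2) p"
  shows "\<not> transc S (slot (slot_fun p)) CARD('n)"
proof
  assume tr: "transc S (slot (slot_fun p)) CARD('n)"
  let ?H = "slot (slot_fun p)"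
  have "\<exists>\<delta>. vars_below (3 * CARD('n) + 2) \<delta> \<and> \<not> vanishes S ?H \<delta> \<and> (\<forall>x\<in>S. peval (?H x) \<delta> \<noteq> 0 \<longrightarrow>
     (\<exists>b. (\<forall>j. tangent_at S ?H (3 * CARD('n) + 2) x (b j)) \<and> (\<forall>j. \<forall>i<Suc CARD('n). b j i = (if i = j then 1 else 0))))"
    by (rule generic_tangent_basis[OF integral_on_slot[OF regular_slot_fun[OF p]]])
       (use tr transc_\<Theta> in \<open>auto simp: less_Suc_eq\<close>)
  then obtain \<delta> where \<delta>: "\<not> vanishes S ?H \<delta>" "\<forall>x\<in>S. peval (?H x) \<delta> \<noteq> 0 \<longrightarrow>
     (\<exists>b. (\<forall>j. tangent_at S ?H (3 * CARD('n) + 2) x (b j)) \<and> (\<forall>j. \<forall>i<Suc CARD('n). b j i = (if i = j then 1 else 0)))"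
    by (elim exE conjE)
  obtain x where x: "x \<in> S" "peval (?H x) \<delta> \<noteq> 0" using \<delta>(1) by (auto simp: vanishes_def)
  obtain b where b: "\<forall>j. tangent_at S ?H (3 * CARD('n) + 2) x (b j)" "\<forall>j. \<forall>i<Suc CARD('n). b j i = (if i = j then 1 else 0)"
    using \<delta>(2)[rule_format, OF x] by (elim exE conjE)
  have dA: "det (\<chi> i. grad (G i) (fst x)) \<noteq> 0" using x(1) h_\<mu> by (auto simp: S_def \<mu>_def)
  \<comment> \<open>These n numbers as one vector: entries in M hold the c part, the others test the
    p part against the chart gradients.\<close>
  define y :: "(nat \<Rightarrow> complex) \<Rightarrow> complex^'n" where
    "y b = (\<chi> a. if a \<in> M then vec_at (Suc (2 * CARD('n))) b $ a else pairing (grad (G a) (fst x)) (vec_at (Suc CARD('n)) b))" for b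
  have y0: "b i = 0" if t: "tangent_at S ?H (3 * CARD('n) + 2) x b" and y: "y b = 0" and i: "i < Suc CARD('n)" for b i
  proof (rule tangent_at_determined[OF x(1) p t _ _ i])
    show "vec_at (Suc (2 * CARD('n))) b = (0 :: complex^'n)"
    proof -
      have "vec_at (Suc (2 * CARD('n))) b $ a = 0" for a :: 'n
      proof (cases "a \<in> M")
        case True thus ?thesis using arg_cong[OF y, of "\<lambda>v. v $ a"] by (simp add: y_def del: vec_at_nth)
      next
        case False
        have "deps (peval (\<lambda>l. Dual (?H x l) (b l)) (Var (Suc (2 * CARD('n)) + index a))) = 0"
        proof (rule tangD[OF t])
          show "vars_below (3 * CARD('n) + 2) (Var (Suc (2 * CARD('n)) + index a))" by (simp add: less_SucI)
          show "vanishes S ?H (Var (Suc (2 * CARD('n)) + index a))" using False by (auto simp: vanishes_def S_def)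
        qed
        thus ?thesis by simp
      qed
      thus ?thesis by (simp add: vec_eq_iff)
    qed
    let ?v = "vec_at (Suc CARD('n)) b :: complex^'n"
    have "?v \<in> tangent_space C (fst x)"
      unfolding tangent_space_def
    proof (intro CollectI allI impI)
      fix g assume g: "is_poly g \<and> (\<forall>y\<in>C. g y = 0)"
      have "deps (peval (\<lambda>l. Dual (?H x l) (b l)) (pexp_at (Suc CARD('n)) g)) = 0"
      proof (rule tangD[OF t])
        show "vars_below (3 * CARD('n) + 2) (pexp_at (Suc CARD('n)) g)" by (rule vars_below_pexp_at) (use g in auto)
        show "vanishes S ?H (pexp_at (Suc CARD('n)) g)" using g by (auto simp: vanishes_def peval_pexp_at S_def)
      qed
      thus "dir_deriv g (fst x) ?v = 0" using g by (simp add: deps_pexp_at)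
    qed
    hence "pairing (grad (G a) (fst x)) ?v = 0" for a
      using conormal_G[of a "fst x"] arg_cong[OF y, of "\<lambda>v. v $ a"]
      by (cases "a \<in> M") (auto simp: tangent_conormal y_def)
    hence "(\<chi> i. grad (G i) (fst x)) *v ?v = 0" by (simp add: mult_rows vec_eq_iff)
    thus "?v = 0" by (rule det_nz_solve(2)[OF dA])
  qed
  have ylin: "y (\<lambda>i. \<Sum>j<m. l j * b j i) = (\<Sum>j<m. l j *s y (b j))" for m :: nat and l
  proof -
    have vl: "(vec_at s (\<lambda>i. \<Sum>j<m. l j * b j i) :: complex^'n) = (\<Sum>j<m. l j *s vec_at s (b j))" for s
      by (simp add: vec_eq_iff)
    show ?thesis unfolding y_def vl
      by (simp add: vec_eq_iff pairing_sum_right pairing_scale_right del: vec_at_nth)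
  qed
  have "Suc CARD('n) \<le> vec.dim (UNIV :: (complex^'n) set)"
  proof (rule card_le_dim_family[OF vec.subspace_UNIV, of _ "\<lambda>j. y (b j)"])
    fix l i assume s: "(\<Sum>j<Suc CARD('n). l j *s y (b j)) = 0" and i: "i < Suc CARD('n)"
    have "tangent_at S ?H (3 * CARD('n) + 2) x (\<lambda>i. \<Sum>j<Suc CARD('n). l j * b j i)" by (rule tangent_at_linear) (use b(1) in simp)
    hence "(\<Sum>j<Suc CARD('n). l j * b j i) = 0" by (rule y0[OF _ _ i]) (simp only: ylin s)
    moreover have "(\<Sum>j<Suc CARD('n). l j * b j i) = (\<Sum>j<Suc CARD('n). if j = i then l j else 0)"
      using b(2) i by (intro sum.cong) auto
    ultimately show "l i = 0" using i by (simp del: sum.lessThan_Suc)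
  qed simp
  thus False using dim_le_CARD[of "UNIV :: (complex^'n) set"] by simp
qed

end

lemma irreducible_UNIV: "irreducible_variety (UNIV :: (complex^'n) set)"
  unfolding irreducible_variety_def
proof (intro conjI allI impI)
  have "UNIV = {x :: complex^'n. (0::complex) = 0}" by simp
  thus "zclosed (UNIV :: (complex^'n) set)" using zclosed_zero_set[OF is_poly.const[of 0]] by simp
  fix A B :: "(complex^'n) set" assume AB: "zclosed A \<and> zclosed B \<and> UNIV \<subseteq> A \<union> B"
  show "UNIV \<subseteq> A \<or> UNIV \<subseteq> B"
  proof (rule ccontr)
    assume "\<not> ?thesis"
    then obtain x y where xy: "x \<notin> A" "y \<notin> B" by blast
    obtain f where f: "is_poly f" "\<forall>z\<in>A. f z = 0" "f x \<noteq> 0" using zclosed_separate AB xy by blast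
    obtain g where g: "is_poly g" "\<forall>z\<in>B. g z = 0" "g y \<noteq> 0" using zclosed_separate AB xy by blast
    obtain z where "f z \<noteq> 0" "g z \<noteq> 0" using zopen_Int_UNIV_nonzero[OF f(1) g(1) f(3) g(3)] by blast
    thus False using f(2) g(2) AB by blast
  qed
qed simp

section \<open>Inverting \<Theta> on base points\<close>

context mld_chart
begin

definition layout :: "'n \<Rightarrow> (complex^'n) \<times> (complex^'n) \<Rightarrow> nat \<Rightarrow> complex" where
  "layout j = slot (\<lambda>x. fst x $ j)"

text \<open>The distinguished slot of \<open>layout j\<close> repeats coordinate j of p, so it can
  be replaced by the ordinary slot of that coordinate.\<close>

definition expand :: "'n \<Rightarrow> pexp \<Rightarrow> pexp" where
  "expand j p = psubst (\<lambda>i. if i = CARD('n) then Var (Suc CARD('n) + index j) else Var i) p"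

lemma vars_below_expand: "vars_below (3 * CARD('n) + 2) p \<Longrightarrow> vars_below (3 * CARD('n) + 2) (expand j p)"
proof -
  assume "vars_below (3 * CARD('n) + 2) p"
  moreover have "Suc CARD('n) + index j < 3 * CARD('n) + 2" using index_lt[of j] by linarith
  ultimately show ?thesis unfolding expand_def by (elim vars_below_psubst) (simp del: add_Suc)
qed

lemma slot_fun_expand: "slot_fun (expand j p) x = peval (layout j x) p"
proof -
  have "(\<lambda>i. peval (slot (\<lambda>_. 0) x) (if i = CARD('n) then Var (Suc CARD('n) + index j) else Var i)) = layout j x"
    by (rule ext) (auto simp: layout_def intro: slot_change)
  thus ?thesis by (simp add: slot_fun_def expand_def peval_psubst)
qed

lemma integral_on_layout: "integral_on S (layout j) k"
  unfolding layout_def by (rule integral_on_slot) (intro regular_fst rational_on.coord)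

lemma transc_layout: "i < CARD('n) \<Longrightarrow> transc S (layout j) i"
  unfolding layout_def by (rule transc_\<Theta>)

lemma peval_slot_layout: "vars_below CARD('n) p \<Longrightarrow> peval (slot f x) p = peval (layout j x) p"
  by (rule peval_cong) (auto simp: layout_def slot_change)

lemma ex_relation:
  assumes "vars_below (3 * CARD('n) + 2) p"
  obtains m q i where "relation S (slot (slot_fun (expand j p))) CARD('n) m q" "i < m" "\<not> vanishes S (slot (slot_fun (expand j p))) (q i)"
  using algebraic_over_\<Theta>[OF vars_below_expand[OF assms]] unfolding transc_def by blast

text \<open>The function p is algebraic over \<Theta>. After division by powers of p, the constant
  term of a relation is a nonzero function of \<Theta> divisible by p: this is the hypothesis
  \<open>dvs\<close> of the lifting lemma.\<close>

lemma layout_divides: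
  assumes m: "CARD('n) \<le> m" "m \<le> 3 * CARD('n) + 2" and p: "vars_below m p" and nz: "\<not> vanishes S (layout j) p"
  shows "\<exists>\<gamma> r. vars_below CARD('n) \<gamma> \<and> vars_below m r \<and> \<not> vanishes S (layout j) \<gamma> \<and>
     (\<forall>x\<in>S. peval (layout j x) \<gamma> = peval (layout j x) p * peval (layout j x) r)"
proof -
  let ?f = "slot_fun (expand j p)"
  have vp: "vars_below (3 * CARD('n) + 2) p" using vars_below_mono[OF p m(2)] .
  obtain d q i where r: "relation S (slot ?f) CARD('n) d q" "i < d" "\<not> vanishes S (slot ?f) (q i)"
    by (rule ex_relation[OF vp])
  have "\<not> vanishes S (slot ?f) (Var CARD('n))" using nz by (simp add: vanishes_def slot_fun_expand)
  from relation_constant_term[OF integral_on_slot[OF regular_slot_fun[OF vars_below_expand[OF vp]]] this r]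
  obtain c s where c: "vars_below CARD('n) c" "vars_below (Suc CARD('n)) s" "\<not> vanishes S (slot ?f) c"
    "\<forall>x\<in>S. peval (slot ?f x) c = slot ?f x CARD('n) * peval (slot ?f x) s" by (elim exE conjE)
  \<comment> \<open>The cofactor s finds p in the distinguished slot; substituting p itself
    expresses it in the slots of \<open>layout j\<close>.\<close>
  define t where "t = psubst (\<lambda>i. if i = CARD('n) then p else Var i) s"
  have "vars_below m t" unfolding t_def by (rule vars_below_psubst[OF c(2)]) (use p m in auto)
  moreover have "peval (slot ?f x) s = peval (layout j x) t" for x
    unfolding t_def peval_psubst
    by (rule peval_cong[OF c(2)]) (auto simp: layout_def slot_change slot_fun_expand)
  ultimately show ?thesis using c(1,3,4) peval_slot_layout[OF c(1), of ?f _ j]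
    by (intro exI[of _ c] exI[of _ t]) (auto simp: vanishes_def slot_fun_expand)
qed

lemma layout_algebraic:
  assumes m: "CARD('n) \<le> m" "m < 3 * CARD('n) + 2"
  shows "\<not> transc S (layout j) m"
proof
  assume tr: "transc S (layout j) m"
  let ?f = "slot_fun (expand j (Var m))"
  have "vars_below (3 * CARD('n) + 2) (Var m)" using m by simp
  then obtain d q i where r: "relation S (slot ?f) CARD('n) d q" "i < d" "\<not> vanishes S (slot ?f) (q i)"
    by (rule ex_relation)
  have vq: "vars_below CARD('n) (q l)" if "l < d" for l using r(1) that by (simp add: relation_def)
  have eq: "peval (slot ?f x) (q l) = peval (layout j x) (q l)" if "l < d" for l x
    by (rule peval_slot_layout[OF vq[OF that]])
  have "relation S (layout j) m d q"
    unfolding relation_def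
  proof (intro conjI allI impI ballI)
    show "vars_below m (q l)" if "l < d" for l using vars_below_mono[OF vq[OF that] m(1)] .
    fix x assume "x \<in> S"
    hence "(\<Sum>l<d. peval (slot ?f x) (q l) * slot ?f x CARD('n) ^ l) = 0" using r(1) by (simp add: relation_def)
    thus "(\<Sum>l<d. peval (layout j x) (q l) * layout j x m ^ l) = 0" by (simp add: eq slot_fun_expand)
  qed
  hence "vanishes S (layout j) (q i)" using tr r(2) by (simp add: transc_def)
  thus False using r(3) eq[OF r(2)] by (simp add: vanishes_def)
qed

text \<open>For k = n this makes \<Theta> onto a principal open set; for k = n + 1 it also
  prescribes coordinate j of the base point.\<close>

lemma layout_lift:
  assumes k: "CARD('n) \<le> k" "k \<le> 3 * CARD('n) + 2"
  shows "\<exists>\<delta>. vars_below CARD('n) \<delta> \<and> \<not> vanishes S (layout j) \<delta> \<and> (\<forall>\<tau>. gen_point S (layout j) k \<tau> \<longrightarrow> peval \<tau> \<delta> \<noteq> 0 \<longrightarrow>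
     (\<exists>x\<in>S. \<Theta> x = vec_at 0 \<tau> \<and> (CARD('n) < k \<longrightarrow> fst x $ j = \<tau> CARD('n))))"
proof -
  let ?H = "layout j"
  have "\<exists>\<delta>. vars_below k \<delta> \<and> \<not> vanishes S ?H \<delta> \<and> (\<forall>\<tau>::nat \<Rightarrow> complex. gen_point S ?H k \<tau> \<longrightarrow> peval \<tau> \<delta> \<noteq> 0 \<longrightarrow>
     (\<exists>\<tau>'. gen_point S ?H (3 * CARD('n) + 2) \<tau>' \<and> (\<forall>i<k. \<tau>' i = \<tau> i)))"
  proof (rule lift_gen_point[OF integral_on_layout k(2)])
    fix l p assume l: "k \<le> l" "l \<le> 3 * CARD('n) + 2" "vars_below l p" "\<not> vanishes S ?H p"
    have "CARD('n) \<le> l" using l k by simp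
    from layout_divides[OF this l(2,3,4)]
    obtain \<gamma> r where "vars_below CARD('n) \<gamma>" "vars_below l r" "\<not> vanishes S ?H \<gamma>" "\<forall>x\<in>S. peval (?H x) \<gamma> = peval (?H x) p * peval (?H x) r"
      by (elim exE conjE)
    thus "\<exists>\<gamma> r. vars_below k \<gamma> \<and> vars_below l r \<and> \<not> vanishes S ?H \<gamma> \<and> (\<forall>x\<in>S. peval (?H x) \<gamma> = peval (?H x) p * peval (?H x) r)"
      using vars_below_mono[OF _ k(1)] by blast
  qed (use layout_algebraic k in auto)
  then obtain \<delta> where \<delta>: "vars_below k \<delta>" "\<not> vanishes S ?H \<delta>" "\<forall>\<tau>::nat \<Rightarrow> complex. gen_point S ?H k \<tau> \<longrightarrow> peval \<tau> \<delta> \<noteq> 0 \<longrightarrow>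
     (\<exists>\<tau>'. gen_point S ?H (3 * CARD('n) + 2) \<tau>' \<and> (\<forall>i<k. \<tau>' i = \<tau> i))" by (elim exE conjE)
  \<comment> \<open>The condition \<delta> may involve all k slots; its multiple \<gamma> depends on
    \<Theta> alone.\<close>
  obtain \<gamma> r where \<gamma>: "vars_below CARD('n) \<gamma>" "vars_below k r" "\<not> vanishes S ?H \<gamma>" "\<forall>x\<in>S. peval (?H x) \<gamma> = peval (?H x) \<delta> * peval (?H x) r"
    using layout_divides[OF k \<delta>(1,2)] by (elim exE conjE)
  have "\<exists>x\<in>S. \<Theta> x = vec_at 0 \<tau> \<and> (CARD('n) < k \<longrightarrow> fst x $ j = \<tau> CARD('n))"
    if \<tau>: "gen_point S ?H k \<tau>" "peval \<tau> \<gamma> \<noteq> 0" for \<tau>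
  proof -
    let ?p = "Add \<gamma> (Mul (Cst (-1)) (Mul \<delta> r))"
    have "vars_below k ?p" using \<gamma> \<delta> vars_below_mono[OF \<gamma>(1) k(1)] by simp
    moreover have "vanishes S ?H ?p" using \<gamma>(4) by (simp add: vanishes_def)
    ultimately have "peval \<tau> ?p = 0" using \<tau>(1) by (simp add: gen_point_def del: peval.simps)
    hence "peval \<tau> \<delta> \<noteq> 0" using \<tau>(2) by auto
    then obtain \<tau>' where \<tau>': "gen_point S ?H (3 * CARD('n) + 2) \<tau>'" "\<forall>i<k. \<tau>' i = \<tau> i" using \<delta>(3) \<tau>(1) by blast
    have \<tau>'s: "gen_point S (slot (\<lambda>x. fst x $ j)) (3 * CARD('n) + 2) \<tau>'" using \<tau>'(1) by (simp add: layout_def)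
    let ?x = "(vec_at (Suc CARD('n)) \<tau>', vec_at (Suc (2 * CARD('n))) \<tau>') :: (complex^'n) \<times> (complex^'n)"
    have "\<Theta> ?x = vec_at 0 \<tau>"
    proof -
      have "index a < k" for a :: 'n using index_lt[of a] k(1) by linarith
      thus ?thesis unfolding point_of_gen_point(2)[OF \<tau>'s] using \<tau>'(2) by (simp add: vec_eq_iff)
    qed
    moreover have "fst ?x $ j = \<tau> CARD('n)" if "CARD('n) < k"
    proof -
      let ?q = "Add (Var CARD('n)) (Mul (Cst (-1)) (Var (Suc (CARD('n) + index j))))"
      have "Suc (CARD('n) + index j) < 3 * CARD('n) + 2" using index_lt[of j] by linarith
      hence "vars_below (3 * CARD('n) + 2) ?q" by (simp only: vars_below.simps) simp
      moreover have "vanishes S ?H ?q" by (simp add: vanishes_def layout_def)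
      ultimately have "peval \<tau>' ?q = 0" using \<tau>'(1) by (simp add: gen_point_def del: peval.simps)
      thus ?thesis using \<tau>'(2) that by simp
    qed
    ultimately show ?thesis using point_of_gen_point(1)[OF \<tau>'s] by blast
  qed
  thus ?thesis using \<gamma>(1,3) by blast
qed

definition pexp_val :: "pexp \<Rightarrow> complex^'n \<Rightarrow> complex" where
  "pexp_val p y = peval (\<lambda>l. y $ coord_at l) p"

lemma pexp_val_poly: "vars_below CARD('n) p \<Longrightarrow> is_poly (pexp_val p)"
  unfolding pexp_val_def by (erule is_poly_peval) (rule is_poly.coord)

lemma pexp_val_layout: "vars_below CARD('n) p \<Longrightarrow> peval (layout j x) p = pexp_val p (\<Theta> x)"
  unfolding pexp_val_def by (rule peval_cong) (auto simp: layout_def slot_def)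

lemma pexp_val_vec_at: "vars_below CARD('n) p \<Longrightarrow> peval \<tau> p = pexp_val p (vec_at 0 \<tau>)"
  unfolding pexp_val_def by (rule peval_cong) (auto simp: index_coord_at)

lemma \<Theta>_fibre_unique:
  assumes "x \<in> S" "y \<in> S" "\<Theta> x = \<Theta> y" "\<omega> (\<Theta> x) \<noteq> 0"
  shows "fst x = fst y"
  using unique[OF assms(4)] S_critical[OF assms(1)] S_critical[OF assms(2)] assms(3) by auto

text \<open>If the minimal polynomial of a coordinate of p over the coordinates of \<open>\<Theta>\<close> had degree at
  least two, then a second root would lift to a second critical point.\<close>
lemma coordinate_rational:
  "\<exists>a b. is_poly a \<and> is_poly b \<and> (\<exists>u. b u \<noteq> 0) \<and> (\<forall>x\<in>S. a (\<Theta> x) + b (\<Theta> x) * fst x $ j = 0)"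
proof -
  let ?H = "layout j"
  let ?n = "CARD('n)"
  have "\<not> transc S ?H ?n" by (rule layout_algebraic) auto
  then obtain e q where m: "min_relation S ?H ?n e q" by (rule ex_min_relation)
  have vq: "vars_below ?n (q i)" if "i < Suc e" for i using m that by (simp add: min_relation_def relation_def)
  have Hn: "?H x ?n = fst x $ j" for x by (simp add: layout_def)
  have relation: "(\<Sum>i<Suc e. pexp_val (q i) (\<Theta> x) * (fst x $ j) ^ i) = 0" if "x \<in> S" for x
  proof -
    have "(\<Sum>i<Suc e. peval (?H x) (q i) * ?H x ?n ^ i) = 0" using m that by (simp add: min_relation_def relation_def)
    moreover have "peval (?H x) (q i) = pexp_val (q i) (\<Theta> x)" if "i < Suc e" for i by (rule pexp_val_layout[OF vq[OF that]])
    ultimately show ?thesis by (simp add: Hn)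
  qed
  have e0: "e \<noteq> 0" using min_relation_pos[OF m] by simp
  have qe: "\<not> vanishes S ?H (q e)" using m by (simp add: min_relation_def)
  have "e = 1"
  proof (rule ccontr)
    assume "e \<noteq> 1"
    with e0 have e2: "2 \<le> e" by simp
    \<comment> \<open>The condition of \<open>poly_second_root\<close>. It is linear in the
      distinguished variable, so minimality of e \<ge> 2 keeps it from vanishing on S.\<close>
    define R where "R = Add (Mul (Mul (Cst (of_nat e)) (q e)) (Var ?n)) (q (e - 1))"
    have vq1: "vars_below ?n (q (e - 1))" by (rule vq) simp
    have vR: "vars_below (Suc ?n) R" using vars_below_mono[OF vq[of e], of "Suc ?n"] vars_below_mono[OF vq1, of "Suc ?n"] by (simp add: R_def)
    have nR: "\<not> vanishes S ?H R"
    proof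
      assume z: "vanishes S ?H R"
      define r where "r i = (if i = 0 then q (e - 1) else Mul (Cst (of_nat e)) (q e))" for i :: nat
      have "relation S ?H ?n 2 r"
        unfolding relation_def
      proof (intro conjI allI impI ballI)
        show "vars_below ?n (r i)" if "i < 2" for i using vq[of e] vq1 by (simp add: r_def)
        fix x assume "x \<in> S"
        thus "(\<Sum>i<2. peval (?H x) (r i) * ?H x ?n ^ i) = 0" using z by (simp add: vanishes_def R_def r_def numeral_2_eq_2 add.commute)
      qed
      hence "vanishes S ?H (r 1)" using m e2 by (simp add: min_relation_def)
      thus False using qe e0 by (simp add: vanishes_def r_def)
    qed
    have k: "?n \<le> Suc ?n" "Suc ?n \<le> 3 * ?n + 2" by auto
    obtain \<delta> where \<delta>: "vars_below ?n \<delta>" "\<not> vanishes S ?H \<delta>" "\<forall>\<tau>. gen_point S ?H (Suc ?n) \<tau> \<longrightarrow> peval \<tau> \<delta> \<noteq> 0 \<longrightarrow>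
       (\<exists>x\<in>S. \<Theta> x = vec_at 0 \<tau> \<and> (?n < Suc ?n \<longrightarrow> fst x $ j = \<tau> ?n))"
      using layout_lift[OF k, of j] by (elim exE conjE)
    obtain u0 where u0: "\<omega> u0 \<noteq> 0" using \<omega>_nz by blast
    obtain x0 where x0: "x0 \<in> S" "\<omega> (\<Theta> x0) \<noteq> 0" using \<Theta>_nonzero[OF \<omega> u0] by blast
    have v\<omega>: "vars_below ?n (pexp_at 0 \<omega>)" by (rule vars_below_pexp_at[OF \<omega>]) simp
    have peval\<omega>: "peval (?H x) (pexp_at 0 \<omega>) = \<omega> (\<Theta> x)" for x by (simp add: peval_pexp_at[OF \<omega>] layout_def)
    have n\<omega>: "\<not> vanishes S ?H (pexp_at 0 \<omega>)" using x0 by (auto simp: vanishes_def peval\<omega>)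
    have up: "vars_below (Suc ?n) p" if "vars_below ?n p" for p using vars_below_mono[OF that] by simp
    \<comment> \<open>One x for which a second root exists, the root lifts, and the critical point
      of \<Theta>(x) is unique.\<close>
    have "\<not> vanishes S ?H (Mul (Mul R (q e)) (Mul \<delta> (pexp_at 0 \<omega>)))"
      using vR nR qe up[OF vq[of e]] \<delta>(2) up[OF \<delta>(1)] n\<omega> up[OF v\<omega>]
      by (intro integral_on_mult[OF integral_on_layout[of j "Suc ?n"]]) (simp_all del: peval.simps)
    then obtain x where x: "x \<in> S" "peval (?H x) R \<noteq> 0" "peval (?H x) (q e) \<noteq> 0" "peval (?H x) \<delta> \<noteq> 0" "\<omega> (\<Theta> x) \<noteq> 0"
      by (auto simp: vanishes_def peval\<omega>)
    define A where "A i = pexp_val (q i) (\<Theta> x)" for i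
    have "\<exists>t'. t' \<noteq> fst x $ j \<and> (\<Sum>i<Suc e. A i * t' ^ i) = 0"
    proof (rule poly_second_root[of e A "fst x $ j"])
      show "A e \<noteq> 0" using x(3) pexp_val_layout[OF vq[of e], of j x] by (simp add: A_def)
      show "(\<Sum>i<Suc e. A i * (fst x $ j) ^ i) = 0" unfolding A_def by (rule relation[OF x(1)])
      show "of_nat e * A e * fst x $ j + A (e - 1) \<noteq> 0"
        using x(2) pexp_val_layout[OF vq[of e], of j x] pexp_val_layout[OF vq1, of j x]
        by (simp add: R_def A_def Hn)
    qed (rule e0)
    then obtain t where t: "t \<noteq> fst x $ j" "(\<Sum>i<Suc e. A i * t ^ i) = 0" by blast
    define \<tau> where "\<tau> l = \<Theta> x $ coord_at l" for l
    have v\<tau>: "vec_at 0 \<tau> = \<Theta> x" by (simp add: vec_eq_iff \<tau>_def)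
    have gen_point\<tau>: "gen_point S ?H ?n \<tau>" by (rule gen_point_trans[OF S_ne]) (rule transc_layout)
    have e\<tau>: "peval \<tau> p = pexp_val p (\<Theta> x)" if "vars_below ?n p" for p using pexp_val_vec_at[OF that, of \<tau>] by (simp add: v\<tau>)
    have "gen_point S ?H (Suc ?n) (\<tau>(?n := t))"
    proof (rule ext_alg[OF m gen_point\<tau>])
      have "peval \<tau> (q e) \<noteq> 0" using x(3) pexp_val_layout[OF vq[of e], of j x] e\<tau>[OF vq[of e]] by simp
      thus "b = 0" if "b * peval \<tau> (q e) = 0" for b using that by simp
      have "(\<Sum>i<Suc e. peval \<tau> (q i) * t ^ i) = (\<Sum>i<Suc e. A i * t ^ i)"
        by (intro sum.cong refl) (simp add: A_def e\<tau>[OF vq])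
      thus "(\<Sum>i<Suc e. peval \<tau> (q i) * t ^ i) = 0" using t(2) by simp
    qed
    moreover have "peval (\<tau>(?n := t)) \<delta> \<noteq> 0"
      using x(4) pexp_val_layout[OF \<delta>(1), of j x] e\<tau>[OF \<delta>(1)] peval_upd[OF \<delta>(1), of ?n \<tau> t] by simp
    ultimately obtain y where y: "y \<in> S" "\<Theta> y = vec_at 0 (\<tau>(?n := t))" "fst y $ j = (\<tau>(?n := t)) ?n"
      using \<delta>(3) by blast
    have "index a \<noteq> ?n" for a :: 'n using index_lt[of a] by linarith
    hence "vec_at 0 (\<tau>(?n := t)) = \<Theta> x" unfolding v\<tau>[symmetric] by (simp add: vec_eq_iff)
    hence "fst x = fst y" using \<Theta>_fibre_unique[OF x(1) y(1) _ x(5)] y(2) by simp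
    thus False using y(3) t(1) by simp
  qed
  hence rel1: "pexp_val (q 0) (\<Theta> x) + pexp_val (q 1) (\<Theta> x) * fst x $ j = 0" if "x \<in> S" for x
    using relation[OF that] by simp
  have "\<exists>x\<in>S. pexp_val (q 1) (\<Theta> x) \<noteq> 0"
    using qe pexp_val_layout[OF vq[of 1], of j] \<open>e = 1\<close> by (auto simp: vanishes_def)
  thus ?thesis using rel1 vq[of 0] vq[of 1] \<open>e = 1\<close>
    by (intro exI[of _ "pexp_val (q 0)"] exI[of _ "pexp_val (q 1)"]) (auto intro: pexp_val_poly)
qed

text \<open>The factors of \<eta> secure uniqueness of the critical point, surjectivity of \<Theta>
  and nonzero denominators.\<close>

lemma ex_section:
  "\<exists>\<eta> a b. is_poly \<eta> \<and> (\<exists>u. \<eta> u \<noteq> 0) \<and> (\<forall>j. is_poly (a j) \<and> is_poly (b j)) \<and>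
     (\<forall>u. \<eta> u \<noteq> 0 \<longrightarrow> \<omega> u \<noteq> 0 \<and> (\<forall>j. b j u \<noteq> 0) \<and> (\<exists>x\<in>S. \<Theta> x = u)) \<and>
     (\<forall>x\<in>S. \<forall>j. b j (\<Theta> x) \<noteq> 0 \<longrightarrow> fst x $ j = a j (\<Theta> x) / b j (\<Theta> x))"
proof -
  have "\<forall>j. \<exists>a b. is_poly a \<and> is_poly b \<and> (\<exists>u. b u \<noteq> 0) \<and> (\<forall>x\<in>S. a (\<Theta> x) + b (\<Theta> x) * fst x $ j = 0)"
    using coordinate_rational by blast
  from choice[OF this] obtain a where "\<forall>j. \<exists>b. is_poly (a j) \<and> is_poly b \<and> (\<exists>u. b u \<noteq> 0) \<and>
      (\<forall>x\<in>S. a j (\<Theta> x) + b (\<Theta> x) * fst x $ j = 0)" by (rule exE)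
  from choice[OF this] obtain b where *: "\<forall>j. is_poly (a j) \<and> is_poly (b j) \<and> (\<exists>u. b j u \<noteq> 0) \<and>
      (\<forall>x\<in>S. a j (\<Theta> x) + b j (\<Theta> x) * fst x $ j = 0)" by (rule exE)
  have ab: "is_poly (a j)" "is_poly (b j)" "\<exists>u. b j u \<noteq> 0"
    "x \<in> S \<Longrightarrow> a j (\<Theta> x) + b j (\<Theta> x) * fst x $ j = 0" for j x
    using * by simp_all
  define j0 :: 'n where "j0 = undefined"
  obtain \<delta> where \<delta>: "vars_below CARD('n) \<delta>" "\<not> vanishes S (layout j0) \<delta>" "\<forall>\<tau>. gen_point S (layout j0) CARD('n) \<tau> \<longrightarrow> peval \<tau> \<delta> \<noteq> 0 \<longrightarrow>
     (\<exists>x\<in>S. \<Theta> x = vec_at 0 \<tau> \<and> (CARD('n) < CARD('n) \<longrightarrow> fst x $ j0 = \<tau> CARD('n)))"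
    using layout_lift[of "CARD('n)" j0] by auto
  define \<eta> where "\<eta> u = \<omega> u * pexp_val \<delta> u * (\<Prod>j\<in>UNIV. b j u)" for u
  have p\<delta>: "is_poly (pexp_val \<delta>)" by (rule pexp_val_poly[OF \<delta>(1)])
  have pb: "is_poly (\<lambda>u. \<Prod>j\<in>UNIV. b j u)" by (intro is_poly_prod ab)
  have p\<eta>: "is_poly \<eta>" unfolding \<eta>_def[abs_def] by (intro is_poly.mult \<omega> p\<delta> pb)
  have "\<exists>u. pexp_val \<delta> u \<noteq> 0" using \<delta>(2) pexp_val_layout[OF \<delta>(1)] by (auto simp: vanishes_def)
  then obtain u1 where u1: "\<omega> u1 * pexp_val \<delta> u1 \<noteq> 0" using zopen_Int_UNIV_nonzero[OF \<omega> p\<delta>] \<omega>_nz by force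
  obtain u2 where "\<forall>j. b j u2 \<noteq> 0"
    using irreducible_finite_nonzero[OF irreducible_UNIV, of UNIV b] ab by auto
  hence "(\<Prod>j\<in>UNIV. b j u2) \<noteq> 0" by simp
  then obtain u3 where "\<eta> u3 \<noteq> 0"
    using zopen_Int_UNIV_nonzero[OF is_poly.mult[OF \<omega> p\<delta>] pb u1] unfolding \<eta>_def by force
  moreover have "\<exists>x\<in>S. \<Theta> x = u" if u: "pexp_val \<delta> u \<noteq> 0" for u
  proof -
    define \<tau> where "\<tau> l = u $ coord_at l" for l
    have v: "vec_at 0 \<tau> = u" by (simp add: vec_eq_iff \<tau>_def)
    have "gen_point S (layout j0) CARD('n) \<tau>" by (rule gen_point_trans[OF S_ne]) (rule transc_layout)
    moreover have "peval \<tau> \<delta> \<noteq> 0" using u pexp_val_vec_at[OF \<delta>(1), of \<tau>] by (simp add: v)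
    ultimately show ?thesis using \<delta>(3) v by blast
  qed
  moreover have "fst x $ j = a j (\<Theta> x) / b j (\<Theta> x) * (-1)" if "x \<in> S" "b j (\<Theta> x) \<noteq> 0" for x j
    using ab(4)[OF that(1), of j] that(2) by (simp add: field_simps add_eq_0_iff)
  ultimately show ?thesis using p\<eta> ab(1,2)
    by (intro exI[of _ \<eta>] exI[of _ "\<lambda>j u. - a j u"] exI[of _ b])
       (auto simp: \<eta>_def intro: is_poly_uminus)
qed

lemma regular_poly_\<Theta>: "is_poly k \<Longrightarrow> regular (\<lambda>x. k (\<Theta> x))"
  by (induction rule: is_poly.induct) (auto intro: regular_const regular_\<Theta> regular_add regular_mult)

lemma cone_point_tangent: "p \<in> C \<Longrightarrow> p \<in> tangent_space C p"
  unfolding tangent_space_def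
proof (intro CollectI allI impI)
  fix f assume p: "p \<in> C" and f: "is_poly f \<and> (\<forall>y\<in>C. f y = 0)"
  have "p + s *s p \<in> C" for s using cone[OF p, of "1 + s"] by (simp add: vec.scale_left_distrib)
  hence "(\<lambda>s. f (p + s *s p)) = (\<lambda>s. 0)" using f by auto
  thus "dir_deriv f p p = 0" by (simp add: dir_deriv_def)
qed

lemma F_euler: "dir_deriv F p p = of_nat d * F p"
proof -
  have "p + s *s p = (1 + s) *s p" for s by (simp add: vec.scale_left_distrib)
  hence "F (p + s *s p) = (1 + s) ^ d * F p" for s by (simp only: F_hom)
  hence "dir_deriv F p p = deriv (\<lambda>s. (1 + s) ^ d * F p) 0" unfolding dir_deriv_def by simp
  also have "\<dots> = of_nat d * F p" by (rule DERIV_imp_deriv) (auto intro!: derivative_eq_intros)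
  finally show ?thesis .
qed

text \<open>Homogeneity of grad log F of degree -1, with quotients multiplied out.\<close>

lemma F_deriv_scale:
  assumes s: "s \<noteq> 0"
  shows "dir_deriv F (s *s p) v * F p * s = dir_deriv F p v * F (s *s p)"
proof -
  have "dir_deriv (\<lambda>x. F (s *s x)) p v = dir_deriv F (s *s p) (\<chi> i. dir_deriv (\<lambda>y. (s *s y) $ i) p v)"
    by (rule chain_rule[OF F _ open_UNIV UNIV_I]) (auto intro: rational_on.mult rational_on.const rational_on.coord)
  also have "(\<chi> i. dir_deriv (\<lambda>y. (s *s y) $ i) p v) = s *s v"
    by (simp add: vec_eq_iff dir_deriv_mult[OF rational_on.const rational_on.coord open_UNIV UNIV_I])
  also have "dir_deriv F (s *s p) (s *s v) = s * dir_deriv F (s *s p) v"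
    by (simp add: poly_dir_deriv[OF F] pairing_scale_right)
  finally have "s * dir_deriv F (s *s p) v = dir_deriv (\<lambda>x. s ^ d * F x) p v" by (simp add: F_hom)
  also have "\<dots> = s ^ d * dir_deriv F p v"
    by (simp add: dir_deriv_mult[OF rational_on.const is_poly_rational_on[OF F] open_UNIV UNIV_I])
  finally show ?thesis by (simp add: F_hom mult_ac)
qed

text \<open>The source of (a): scaling p by the inverse of t keeps the tangent space and multiplies
  grad log F by t, as u is multiplied.\<close>

lemma crit_points_scale:
  assumes t: "t \<noteq> 0" and p: "p \<in> crit_points F C u"
  shows "inverse t *s p \<in> crit_points F C (t *s u)"
proof -
  let ?s = "inverse t"
  have s: "?s \<noteq> 0" using t by simp
  have T: "tangent_space C (?s *s p) = tangent_space C p" by (rule tangent_cone_scale[OF cone s])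
  have pC: "p \<in> C" "vec.dim (tangent_space C p) = zdim C" "F p \<noteq> 0"
    "\<And>v. v \<in> tangent_space C p \<Longrightarrow> dir_deriv F p v / F p - pairing u v = 0"
    using p by (auto simp: crit_points_def smooth_points_def)
  have Fs: "F (?s *s p) \<noteq> 0" using pC(3) s by (simp add: F_hom)
  have "dir_deriv F (?s *s p) v / F (?s *s p) - pairing (t *s u) v = 0" if v: "v \<in> tangent_space C p" for v
  proof -
    have "dir_deriv F (?s *s p) v * F p = dir_deriv F p v * F (?s *s p) * t"
      using F_deriv_scale[OF s, of p v] t by (simp add: field_simps)
    hence "dir_deriv F (?s *s p) v / F (?s *s p) = t * (dir_deriv F p v / F p)"
      using pC(3) Fs by (simp add: field_simps)
    also have "dir_deriv F p v / F p = pairing u v" using pC(4)[OF v] by simp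
    finally show ?thesis by (simp add: pairing_scale_left)
  qed
  thus ?thesis using pC(1,2) cone T Fs by (auto simp: crit_points_def smooth_points_def)
qed

lemma ex_candidate:
  "\<exists>D \<Psi>. dominant_rational_map D \<Psi> C \<and> inv_homogeneous D \<Psi> \<and> log_gradient_condition F D \<Psi>"
proof -
  obtain \<eta> a b where *: "is_poly \<eta> \<and> (\<exists>u. \<eta> u \<noteq> 0) \<and> (\<forall>j. is_poly (a j) \<and> is_poly (b j)) \<and>
     (\<forall>u. \<eta> u \<noteq> 0 \<longrightarrow> \<omega> u \<noteq> 0 \<and> (\<forall>j. b j u \<noteq> 0) \<and> (\<exists>x\<in>S. \<Theta> x = u)) \<and>
     (\<forall>x\<in>S. \<forall>j. b j (\<Theta> x) \<noteq> 0 \<longrightarrow> fst x $ j = a j (\<Theta> x) / b j (\<Theta> x))"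
    using ex_section by (elim exE)
  have \<eta>: "is_poly \<eta>" "\<exists>u. \<eta> u \<noteq> 0" and ab0: "\<forall>j. is_poly (a j) \<and> is_poly (b j)"
    and sec: "\<forall>u. \<eta> u \<noteq> 0 \<longrightarrow> \<omega> u \<noteq> 0 \<and> (\<forall>j. b j u \<noteq> 0) \<and> (\<exists>x\<in>S. \<Theta> x = u)"
    and eq: "\<forall>x\<in>S. \<forall>j. b j (\<Theta> x) \<noteq> 0 \<longrightarrow> fst x $ j = a j (\<Theta> x) / b j (\<Theta> x)"
    using * by simp_all
  have ab: "is_poly (a j)" "is_poly (b j)" for j using ab0 by simp_all
  define D where "D = {u. \<eta> u \<noteq> 0}"
  define \<Psi> where "\<Psi> u = (\<chi> j. a j u / b j u)" for u
  have oD: "open D" unfolding D_def by (rule open_basic[OF \<eta>(1)])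
  have \<Psi>\<Theta>: "fst x = \<Psi> (\<Theta> x)" if "x \<in> S" "\<Theta> x \<in> D" for x
    using eq sec that by (simp add: vec_eq_iff \<Psi>_def D_def)
  have bD: "\<forall>u\<in>D. b i u \<noteq> 0" for i using sec by (simp add: D_def)
  have rp: "rational_on D (\<lambda>u. \<Psi> u $ i)" for i
    using rational_on_divide[OF is_poly_rational_on[OF ab(1)] is_poly_rational_on[OF ab(2)] bD] by (simp add: \<Psi>_def)
  have crit: "crit_points F C u = {\<Psi> u}" if u: "u \<in> D" for u
  proof -
    have "\<eta> u \<noteq> 0" using u by (simp add: D_def)
    then obtain x where x: "x \<in> S" "\<Theta> x = u" and "\<omega> u \<noteq> 0" using sec by blast
    have "\<Psi> u \<in> crit_points F C u" using S_critical[OF x(1)] \<Psi>\<Theta>[OF x(1)] x(2) u by simp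
    thus ?thesis using unique[OF \<open>\<omega> u \<noteq> 0\<close>] by auto
  qed
  have cr: "\<Psi> u \<in> C" "F (\<Psi> u) \<noteq> 0" "\<And>v. v \<in> tangent_space C (\<Psi> u) \<Longrightarrow> dir_deriv F (\<Psi> u) v / F (\<Psi> u) = pairing u v"
    if "u \<in> D" for u
  proof -
    have "\<Psi> u \<in> crit_points F C u" using crit[OF that] by simp
    thus "\<Psi> u \<in> C" "F (\<Psi> u) \<noteq> 0" "\<And>v. v \<in> tangent_space C (\<Psi> u) \<Longrightarrow> dir_deriv F (\<Psi> u) v / F (\<Psi> u) = pairing u v"
      by (auto simp: crit_points_def smooth_points_def)
  qed
  \<comment> \<open>A point of the cone is tangent to the cone at itself, so criticality in this
    direction and Euler's identity for F give the constant d; differentiating it turns criticality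
    into (b).\<close>
  have pd: "pairing u (\<Psi> u) = of_nat d" if u: "u \<in> D" for u
    using cr(3)[OF u cone_point_tangent[OF cr(1)[OF u]]] cr(2)[OF u] F_euler[of "\<Psi> u"] by simp
  have "dominant_rational_map D \<Psi> C"
    unfolding dominant_rational_map_def rational_map_def
  proof (intro conjI allI)
    show "zopen D" unfolding D_def by (rule zopen_basic[OF \<eta>(1)])
    show "D \<noteq> {}" using \<eta>(2) by (simp add: D_def)
    show "\<exists>p q. is_poly p \<and> is_poly q \<and> (\<forall>u\<in>D. q u \<noteq> 0 \<and> \<Psi> u $ i = p u / q u)" for i
      using bD ab by (intro exI[of _ "a i"] exI[of _ "b i"]) (simp add: \<Psi>_def)
    show im: "\<Psi> ` D \<subseteq> C" using cr(1) by auto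
    show "zclosure (\<Psi> ` D) = C"
    proof
      show "zclosure (\<Psi> ` D) \<subseteq> C" using C im by (intro zclosure_minimal) (auto simp: irreducible_variety_def)
      show "C \<subseteq> zclosure (\<Psi> ` D)"
      proof (rule ccontr)
        assume "\<not> ?thesis"
        then obtain y where y: "y \<in> C" "y \<notin> zclosure (\<Psi> ` D)" by blast
        obtain f where f: "is_poly f" "\<forall>z\<in>zclosure (\<Psi> ` D). f z = 0" "f y \<noteq> 0"
          using zclosed_separate[OF zclosed_zclosure y(2)] by blast
        \<comment> \<open>The pair (p, 0) shows that f is not identically zero on base points of S;
          at a common nonzero x of f and \<eta>(\<Theta>) the base point is \<Psi>(\<Theta>(x)),
          where f should vanish.\<close>
        obtain p where p: "p \<in> C" "f p \<noteq> 0" "h p \<noteq> 0"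
          using irreducible_common_nonzero[OF C f(1) h_poly y(1) f(3) p0(1) h_p0] by blast
        have "(p, 0) \<in> S" using p by (simp add: S_def)
        moreover have "regular (\<lambda>x. f (fst x))" by (intro regular_fst is_poly_rational_on f)
        moreover have "regular (\<lambda>x. \<eta> (\<Theta> x))"
          by (rule regular_poly_\<Theta>[OF \<eta>(1)])
        moreover obtain x1 where "x1 \<in> S" "\<eta> (\<Theta> x1) \<noteq> 0" using \<eta> \<Theta>_nonzero by blast
        ultimately obtain x where x: "x \<in> S" "f (fst x) \<noteq> 0" "\<eta> (\<Theta> x) \<noteq> 0"
          using regular_domain[of "\<lambda>x. f (fst x)" "\<lambda>x. \<eta> (\<Theta> x)" "(p, 0)" x1] p by auto
        have "\<Theta> x \<in> D" using x by (simp add: D_def)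
        hence "fst x \<in> zclosure (\<Psi> ` D)" using \<Psi>\<Theta>[OF x(1)] zclosure_superset[of "\<Psi> ` D"] by auto
        thus False using f(2) x(2) by blast
      qed
    qed
  qed
  moreover have "inv_homogeneous D \<Psi>"
    unfolding inv_homogeneous_def
  proof (intro allI impI)
    fix u t assume ut: "u \<in> D \<and> t \<noteq> 0 \<and> t *s u \<in> D"
    have "inverse t *s \<Psi> u \<in> crit_points F C (t *s u)"
      by (rule crit_points_scale) (use ut crit in auto)
    thus "\<Psi> (t *s u) = inverse t *s \<Psi> u" using crit[of "t *s u"] ut by simp
  qed
  moreover have "log_gradient_condition F D \<Psi>"
    unfolding log_gradient_condition_def
  proof (intro exI[of _ D] conjI ballI allI subset_refl)
    show "zopen D" unfolding D_def by (rule zopen_basic[OF \<eta>(1)])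
    show "D \<noteq> {}" using \<eta>(2) by (simp add: D_def)
    fix u w assume u: "u \<in> D"
    show "F (\<Psi> u) \<noteq> 0" by (rule cr(2)[OF u])
    have "jacobian \<Psi> u w \<in> tangent_space C (\<Psi> u)" by (rule jacobian_tangent[OF oD rp u]) (rule cr(1))
    hence "dir_deriv F (\<Psi> u) (jacobian \<Psi> u w) / F (\<Psi> u) = pairing u (jacobian \<Psi> u w)" by (rule cr(3)[OF u])
    moreover have "dir_deriv (\<lambda>x. F (\<Psi> x)) u w = dir_deriv F (\<Psi> u) (jacobian \<Psi> u w)"
      unfolding jacobian_def by (rule chain_rule[OF F rp oD u])
    moreover have "pairing w (\<Psi> u) + pairing u (jacobian \<Psi> u w) = 0"
      by (rule pairing_const_deriv[OF oD rp pd u])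
    ultimately show "dir_deriv (\<lambda>x. F (\<Psi> x)) u w / F (\<Psi> u) = - pairing w (\<Psi> u)"
      by (simp add: add_eq_0_iff)
  qed
  ultimately show ?thesis by blast
qed

end

lemma mld_one_candidate:
  fixes C :: "(complex^'n) set"
  assumes C: "projective_cone C" and F: "homogeneous_poly F" and mld: "has_MLD F C 1"
  shows "\<exists>D \<Psi>. dominant_rational_map D \<Psi> C \<and> inv_homogeneous D \<Psi> \<and> log_gradient_condition F D \<Psi>"
proof -
  obtain U where U: "zopen U" "U \<noteq> {}" "\<forall>u\<in>U. finite (crit_points F C u) \<and> card (crit_points F C u) = 1"
    using mld unfolding has_MLD_def by blast
  obtain u0 where "u0 \<in> U" using U(2) by blast
  then obtain \<omega> where \<omega>: "is_poly \<omega>" "\<omega> u0 \<noteq> 0" "{x. \<omega> x \<noteq> 0} \<subseteq> U" using zopen_basic_subset[OF U(1)] by blast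
  obtain d where d: "\<And>t x. F (t *s x) = t ^ d * F x" and pF: "is_poly F"
    using F unfolding homogeneous_poly_def by blast
  interpret mld_one C F d \<omega>
  proof unfold_locales
    show "\<exists>p. crit_points F C u = {p}" if "\<omega> u \<noteq> 0" for u
      using U(3) \<omega>(3) that by (auto simp: card_1_singleton_iff)
  qed (use C \<omega> d pF in \<open>auto simp: projective_cone_def\<close>)
  obtain p G M where "charted p G M" using ex_charted by blast
  then interpret mld_chart C F d \<omega> p G M by unfold_locales
  show ?thesis by (rule ex_candidate)
qed

theorem theorem3p1:
  fixes C :: "(complex^'n) set" and F :: "complex^'n \<Rightarrow> complex"
  assumes "projective_cone C"
    and "homogeneous_poly F"
  shows "(has_MLD F C 1 \<longleftrightarrow>
           (\<exists>D \<Psi>. dominant_rational_map D \<Psi> C \<and> inv_homogeneous D \<Psi>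
                  \<and> log_gradient_condition F D \<Psi>))
       \<and> (\<forall>D \<Psi>. has_MLD F C 1 \<and> dominant_rational_map D \<Psi> C \<and> inv_homogeneous D \<Psi>
                  \<and> log_gradient_condition F D \<Psi> \<longrightarrow>
             (\<exists>U. zopen U \<and> U \<noteq> {} \<and> U \<subseteq> D \<and> (\<forall>u\<in>U. crit_points F C u = {\<Psi> u})))"
proof (intro conjI iffI allI impI)
  assume "has_MLD F C 1"
  thus "\<exists>D \<Psi>. dominant_rational_map D \<Psi> C \<and> inv_homogeneous D \<Psi> \<and> log_gradient_condition F D \<Psi>"
    by (rule mld_one_candidate[OF assms])
next
  assume "\<exists>D \<Psi>. dominant_rational_map D \<Psi> C \<and> inv_homogeneous D \<Psi> \<and> log_gradient_condition F D \<Psi>"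
  then obtain D \<Psi> where "dominant_rational_map D \<Psi> C" "inv_homogeneous D \<Psi>" "log_gradient_condition F D \<Psi>"
    by blast
  from candidate_is_mle[OF assms this] obtain U where U: "zopen U" "U \<noteq> {}"
    "\<forall>u\<in>U. crit_points F C u = {\<Psi> u}" by blast
  thus "has_MLD F C 1" unfolding has_MLD_def by (intro exI[of _ U]) simp
next
  fix D \<Psi>
  assume "has_MLD F C 1 \<and> dominant_rational_map D \<Psi> C \<and> inv_homogeneous D \<Psi> \<and> log_gradient_condition F D \<Psi>"
  thus "\<exists>U. zopen U \<and> U \<noteq> {} \<and> U \<subseteq> D \<and> (\<forall>u\<in>U. crit_points F C u = {\<Psi> u})"
    using candidate_is_mle[OF assms] by blast
qed

end
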